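(* The \textsf{NAE-3SAT-KS} problem is $\mathsf{NP}$-complete.
   Context: The \textsf{NAE-3SAT-KS} problem: the input is a 3SAT instance $\psi$ consisting of a collection $C$ of clauses over a set $U$ of variables such that (1) every clause of $C$ has exactly $3$ literals; (2) for every $u\in U$, each of the literals $u$ and $\bar u$ appears in at most $2$ clauses of $C$; (3) for every $u\in U$, at least one of $u$ or $\bar u$ appears in exactly $2$ clauses of $C$; (4) any two clauses share at most one literal, and no variable appears twice in the same clause. The question is whether there is a truth assignment to $U$ such that every clause of $\psi$ has at least one true literal and at least one false literal. *)

theory Defs
  imports Main "HOL-Computational_Algebra.Polynomial"
begin

section \<open>Deterministic multi-tape Turing machines\<close>

text \<open>
  A machine has \<open>tapes M\<close> two-way infinite tapes, the states \<open>{..<states M}\<close> and the tape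
  alphabet \<open>{..<symbols M}\<close>, in which 0 is the blank and 1 and 2 stand for the bits 0 and 1.
  The transition function maps a state and the symbols under the heads to a new state and, for
  each tape, the symbol to write and the direction in which to move.
\<close>

datatype dir = MoveLeft | Stay | MoveRight

record tm =
  tapes :: nat
  states :: nat
  symbols :: nat
  start :: nat
  halt :: nat
  delta :: "nat \<Rightarrow> nat list \<Rightarrow> nat \<times> (nat \<times> dir) list"

definition wf_tm :: "tm \<Rightarrow> bool" where
  "wf_tm M \<longleftrightarrow>
     tapes M \<ge> 1 \<and> symbols M \<ge> 3 \<and> start M < states M \<and> halt M < states M \<and>
     (\<forall>q < states M. \<forall>rs. length rs = tapes M \<and> (\<forall>r \<in> set rs. r < symbols M) \<longrightarrow>
        fst (delta M q rs) < states M \<and>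
        length (snd (delta M q rs)) = tapes M \<and>
        (\<forall>(s, d) \<in> set (snd (delta M q rs)). s < symbols M))"

text \<open>A tape consists of a head position and the cell contents; a configuration of the current
  state and the tapes.\<close>

type_synonym tape = "int \<times> (int \<Rightarrow> nat)"
type_synonym config = "nat \<times> tape list"

definition read :: "tape \<Rightarrow> nat" where
  "read t = snd t (fst t)"

fun displacement :: "dir \<Rightarrow> int" where
  "displacement MoveLeft = -1"
| "displacement Stay = 0"
| "displacement MoveRight = 1"

fun act :: "nat \<times> dir \<Rightarrow> tape \<Rightarrow> tape" where
  "act (s, d) (h, f) = (h + displacement d, f(h := s))"

definition step :: "tm \<Rightarrow> config \<Rightarrow> config" where
  "step M c =
     (if fst c = halt M then c
      else (let (q, as) = delta M (fst c) (map read (snd c)) in (q, map2 act as (snd c))))"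

definition word_cells :: "bool list \<Rightarrow> int \<Rightarrow> nat" where
  "word_cells w i =
     (if 0 \<le> i \<and> i < int (length w) then (if w ! nat i then 2 else 1) else 0)"

text \<open>The input is on the first tape, all other tapes are blank, all heads are on cell 0.\<close>

definition init :: "tm \<Rightarrow> bool list \<Rightarrow> config" where
  "init M w = (start M, (0, word_cells w) # replicate (tapes M - 1) (0, word_cells []))"

text \<open>The output is read off the last tape. As halting configurations are fixed by \<^const>\<open>step\<close>,
  being halted after exactly \<open>t\<close> steps means halting within \<open>t\<close> steps.\<close>

definition outputs_within :: "tm \<Rightarrow> bool list \<Rightarrow> bool list \<Rightarrow> nat \<Rightarrow> bool" where
  "outputs_within M x y t \<longleftrightarrow>
     (let (q, ts) = (step M ^^ t) (init M x) in q = halt M \<and> snd (last ts) = word_cells y)"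

section \<open>NP-completeness\<close>

definition ptime_computable :: "(bool list \<Rightarrow> bool list) \<Rightarrow> bool" where
  "ptime_computable f \<longleftrightarrow>
     (\<exists>M. \<exists>p :: nat poly. wf_tm M \<and> (\<forall>x. outputs_within M x (f x) (poly p (length x))))"

definition class_P :: "bool list set set" where
  "class_P = {L. ptime_computable (\<lambda>x. [x \<in> L])}"

text \<open>A self-delimiting code for bit strings: each bit is preceded by a 1, a single 0 marks the
  end.\<close>

definition enc_bits :: "bool list \<Rightarrow> bool list" where
  "enc_bits w = concat (map (\<lambda>b. [True, b]) w) @ [False]"

definition pair :: "bool list \<Rightarrow> bool list \<Rightarrow> bool list" where
  "pair x u = enc_bits x @ u"

definition class_NP :: "bool list set set" where
  "class_NP =
     {L. \<exists>V \<in> class_P. \<exists>p :: nat poly.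
           \<forall>x. x \<in> L \<longleftrightarrow> (\<exists>u. length u \<le> poly p (length x) \<and> pair x u \<in> V)}"

definition ptime_reducible :: "bool list set \<Rightarrow> bool list set \<Rightarrow> bool" where
  "ptime_reducible A B \<longleftrightarrow> (\<exists>f. ptime_computable f \<and> (\<forall>x. x \<in> A \<longleftrightarrow> f x \<in> B))"

definition NP_hard :: "bool list set \<Rightarrow> bool" where
  "NP_hard B \<longleftrightarrow> (\<forall>A \<in> class_NP. ptime_reducible A B)"

definition NP_complete :: "bool list set \<Rightarrow> bool" where
  "NP_complete B \<longleftrightarrow> B \<in> class_NP \<and> NP_hard B"

section \<open>The problem NAE-3SAT-KS\<close>

datatype 'v literal = Pos 'v | Neg 'v

fun var :: "'v literal \<Rightarrow> 'v" where
  "var (Pos x) = x"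
| "var (Neg x) = x"

fun lit_true :: "('v \<Rightarrow> bool) \<Rightarrow> 'v literal \<Rightarrow> bool" where
  "lit_true \<tau> (Pos x) \<longleftrightarrow> \<tau> x"
| "lit_true \<tau> (Neg x) \<longleftrightarrow> \<not> \<tau> x"

type_synonym 'v clause = "'v literal list"

text \<open>The number of clauses of a collection (given as a list) in which a literal appears.\<close>

definition occurrences :: "'v clause list \<Rightarrow> 'v literal \<Rightarrow> nat" where
  "occurrences C l = card {i. i < length C \<and> l \<in> set (C ! i)}"

definition NAE_3SAT_KS_instance :: "'v set \<Rightarrow> 'v clause list \<Rightarrow> bool" where
  "NAE_3SAT_KS_instance U C \<longleftrightarrow>
     (\<forall>c \<in> set C. \<forall>l \<in> set c. var l \<in> U) \<and>
     (\<forall>c \<in> set C. length c = 3) \<and>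
     (\<forall>u \<in> U. occurrences C (Pos u) \<le> 2 \<and> occurrences C (Neg u) \<le> 2) \<and>
     (\<forall>u \<in> U. occurrences C (Pos u) = 2 \<or> occurrences C (Neg u) = 2) \<and>
     (\<forall>i < length C. \<forall>j < length C. i \<noteq> j \<longrightarrow> card (set (C ! i) \<inter> set (C ! j)) \<le> 1) \<and>
     (\<forall>c \<in> set C. distinct (map var c))"

definition NAE_satisfiable :: "'v clause list \<Rightarrow> bool" where
  "NAE_satisfiable C \<longleftrightarrow>
     (\<exists>\<tau>. \<forall>c \<in> set C. (\<exists>l \<in> set c. lit_true \<tau> l) \<and> (\<exists>l \<in> set c. \<not> lit_true \<tau> l))"

text \<open>Variables are natural numbers, written in binary with the least significant bit first.
  The encoding of an instance lists its variables and then its clauses.\<close>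

fun binary :: "nat \<Rightarrow> bool list" where
  "binary 0 = []"
| "binary (Suc n) = odd (Suc n) # binary (Suc n div 2)"

definition enc_nat :: "nat \<Rightarrow> bool list" where
  "enc_nat n = enc_bits (binary n)"

fun enc_literal :: "nat literal \<Rightarrow> bool list" where
  "enc_literal (Pos x) = True # enc_nat x"
| "enc_literal (Neg x) = False # enc_nat x"

definition enc_list :: "('a \<Rightarrow> bool list) \<Rightarrow> 'a list \<Rightarrow> bool list" where
  "enc_list f xs = concat (map (\<lambda>x. True # f x) xs) @ [False]"

definition enc_instance :: "nat list \<Rightarrow> nat clause list \<Rightarrow> bool list" where
  "enc_instance U C = enc_list enc_nat U @ enc_list (enc_list enc_literal) C"

definition NAE_3SAT_KS :: "bool list set" where
  "NAE_3SAT_KS =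
     {enc_instance U C | U C.
        distinct U \<and> NAE_3SAT_KS_instance (set U) C \<and> NAE_satisfiable C}"

subsection \<open>The encodings are injective\<close>

lemma enc_bits_prefix_free:
  "enc_bits v @ s = enc_bits w @ t \<longleftrightarrow> v = w \<and> s = t"
proof (induction v arbitrary: w)
  case Nil
  then show ?case by (cases w) (auto simp: enc_bits_def)
next
  case (Cons a v)
  then show ?case by (cases w) (auto simp: enc_bits_def)
qed

lemma pair_inject: "pair x u = pair y v \<longleftrightarrow> x = y \<and> u = v"
  by (simp add: pair_def enc_bits_prefix_free)

lemma binary_inject: "binary m = binary n \<longleftrightarrow> m = n"
proof (induction m arbitrary: n rule: less_induct)
  case (less m)
  show ?case
  proof (cases m)
    case 0
    then show ?thesis by (cases n) auto
  next
    case (Suc m')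
    show ?thesis
    proof (cases n)
      case 0
      with Suc show ?thesis by simp
    next
      case (Suc n')
      have "m div 2 < m" using \<open>m = Suc m'\<close> by simp
      then have "binary m = binary n \<longleftrightarrow> odd m = odd n \<and> m div 2 = n div 2"
        using less.IH[of "m div 2" "n div 2"] \<open>m = Suc m'\<close> Suc by simp
      also have "\<dots> \<longleftrightarrow> m = n" by presburger
      finally show ?thesis .
    qed
  qed
qed

lemma enc_nat_prefix_free:
  "enc_nat m @ s = enc_nat n @ t \<longleftrightarrow> m = n \<and> s = t"
  by (simp add: enc_nat_def enc_bits_prefix_free binary_inject)

lemma enc_literal_prefix_free:
  "enc_literal k @ s = enc_literal l @ t \<longleftrightarrow> k = l \<and> s = t"
  by (cases k; cases l) (simp_all add: enc_nat_prefix_free)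

lemma enc_list_prefix_free:
  assumes "\<And>x y s t. f x @ s = f y @ t \<longleftrightarrow> x = y \<and> s = t"
  shows "enc_list f xs @ s = enc_list f ys @ t \<longleftrightarrow> xs = ys \<and> s = t"
proof (induction xs arbitrary: ys)
  case Nil
  then show ?case by (cases ys) (auto simp: enc_list_def)
next
  case (Cons x xs)
  then show ?case by (cases ys) (auto simp: enc_list_def assms)
qed

lemma enc_instance_inject:
  "enc_instance U C = enc_instance V D \<longleftrightarrow> U = V \<and> C = D"
proof -
  note pf = enc_list_prefix_free[of "enc_list enc_literal", OF enc_list_prefix_free,
      OF enc_literal_prefix_free, where s = "[]" and t = "[]", simplified]
  show ?thesis
    by (simp add: enc_instance_def enc_list_prefix_free[OF enc_nat_prefix_free] pf)
qed

end

theory Submission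
  imports Defs "HOL-Library.Countable_Set"
begin

text \<open>
  Programs over stacks with while loops are Turing machines whose states are the continuations of
  the program. The functions computed by such programs in polynomial time are closed under
  composition, pairing, case distinction and folds over lists whose accumulator stays small, so
  that list functions are seen to be polynomial-time from their definitions.

  Hardness: describe every tape relative to its head. Then the next content of a cell depends on
  boundedly many cells, and a run of a verifier is described by implications of bounded length
  between statements ``cell \<open>j\<close> of tape \<open>k\<close> contains \<open>a\<close> at time \<open>t\<close>''; acceptance is the absence of
  the symbol for a rejecting answer. Clauses become not-all-equal triples by means of a variable
  standing for false and of chaining variables. To bound the occurrences of literals, the clauses
  \<open>{a, \<not>b, z}\<close>, \<open>{b, \<not>c, z}\<close>, \<open>{\<not>c, a, \<not>z}\<close> force \<open>a = b = c\<close>, and \<open>{c, \<not>b', y}\<close>, \<open>{\<not>a, b', y}\<close>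
  continue the equality to the next block \<open>a', b', c'\<close>; in a ring of such blocks each block keeps
  one free positive slot of \<open>c\<close> and one free negative slot of \<open>a\<close>. Every literal then occurs in at
  most two clauses, and two clauses in which it occurs determine it, so no two clauses share two
  literals.

  Membership: the certificate consists of the parsed instance and the true variables, so that the
  verifier never parses its input: it encodes the instance, compares the result with the input and
  tests the conditions.
\<close>

section \<open>Structured tape programs\<close>

datatype prog =
    Put nat "bool option" dir
  | Move nat dir
  | Seq prog prog (infixl ";;" 60)
  | Ite nat "nat set" prog prog
  | While nat "nat set" prog

fun symbol :: "bool option \<Rightarrow> nat" where
  "symbol None = 0"
| "symbol (Some False) = 1"
| "symbol (Some True) = 2"

fun continuation :: "prog list \<Rightarrow> (nat \<Rightarrow> nat) \<Rightarrow> prog list" where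
  "continuation [] f = []"
| "continuation (Put r s d # k) f = k"
| "continuation (Move r d # k) f = k"
| "continuation ((p ;; q) # k) f = p # q # k"
| "continuation (Ite r S p q # k) f = (if f r \<in> S then p else q) # k"
| "continuation (While r S p # k) f = (if f r \<in> S then p # While r S p # k else k)"

fun action :: "prog list \<Rightarrow> (nat \<Rightarrow> nat) \<Rightarrow> nat \<Rightarrow> nat \<times> dir" where
  "action (Put r s d # k) f i = (if i = r then (symbol s, d) else (f i, Stay))"
| "action (Move r d # k) f i = (f i, if i = r then d else Stay)"
| "action k f i = (f i, Stay)"

definition prog_step :: "prog list \<times> (nat \<Rightarrow> tape) \<Rightarrow> prog list \<times> (nat \<Rightarrow> tape)" where
  "prog_step c = (let f = (\<lambda>i. read (snd c i)) in
     (continuation (fst c) f, \<lambda>i. act (action (fst c) f i) (snd c i)))"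

fun registers :: "prog \<Rightarrow> nat set" where
  "registers (Put r s d) = {r}"
| "registers (Move r d) = {r}"
| "registers (p ;; q) = registers p \<union> registers q"
| "registers (Ite r S p q) = {r} \<union> registers p \<union> registers q"
| "registers (While r S p) = {r} \<union> registers p"

lemma fst_prog_step: "fst (prog_step c) = continuation (fst c) (\<lambda>i. read (snd c i))"
  and snd_prog_step: "snd (prog_step c) r = act (action (fst c) (\<lambda>i. read (snd c i)) r) (snd c r)"
  by (simp_all add: prog_step_def Let_def)

lemma finite_registers: "finite (registers p)"
  by (induction p) auto

lemma act_read_Stay [simp]: "act (read t, Stay) t = t"
  by (cases t) (simp add: read_def)

lemma continuation_cong:
  assumes "\<And>q r. q \<in> set k \<Longrightarrow> r \<in> registers q \<Longrightarrow> f r = g r"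
  shows "continuation k f = continuation k g"
proof (cases "(k, f)" rule: continuation.cases[case_names Nil Put Move Seq Ite While])
  case (Ite r S p q k' f')
  then have "f r = g r" using assms[of "Ite r S p q" r] by simp
  with Ite show ?thesis by simp
next
  case (While r S p k' f')
  then have "f r = g r" using assms[of "While r S p" r] by simp
  with While show ?thesis by simp
qed auto

lemma action_cong: "f i = g i \<Longrightarrow> action k f i = action k g i"
  by (cases "(k, f, i)" rule: action.cases) auto

lemma action_bound: "f i < 3 \<Longrightarrow> fst (action k f i) < 3"
proof (cases "(k, f, i)" rule: action.cases[case_names Put])
  case (Put r s d k f' i')
  moreover have "symbol s < 3" by (cases s rule: symbol.cases) auto
  ultimately show "f i < 3 \<Longrightarrow> ?thesis" by auto
qed auto

lemma action_untouched: "r \<notin> \<Union>(registers ` set k) \<Longrightarrow> action k f r = (f r, Stay)"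
  by (cases "(k, f, r)" rule: action.cases) auto

lemma registers_continuation:
  "\<Union>(registers ` set (continuation k f)) \<subseteq> \<Union>(registers ` set k)"
  by (cases "(k, f)" rule: continuation.cases) auto

subsection \<open>Compilation\<close>

fun conts :: "prog \<Rightarrow> prog list \<Rightarrow> prog list set" where
  "conts (Put r s d) k = {Put r s d # k}"
| "conts (Move r d) k = {Move r d # k}"
| "conts (p ;; q) k = {(p ;; q) # k} \<union> conts p (q # k) \<union> conts q k"
| "conts (Ite r S p q) k = {Ite r S p q # k} \<union> conts p k \<union> conts q k"
| "conts (While r S p) k = {While r S p # k} \<union> conts p (While r S p # k)"

definition all_conts :: "prog \<Rightarrow> prog list set" where
  "all_conts p = insert [] (conts p [])"

lemma finite_conts: "finite (conts p k)"
  by (induction p arbitrary: k) auto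

lemma self_in_conts: "p # k \<in> conts p k"
  by (cases p) auto

lemma continuation_in_conts: "c \<in> conts p k \<Longrightarrow> continuation c f \<in> insert k (conts p k)"
proof (induction p arbitrary: k)
  case (Seq p q)
  then show ?case using self_in_conts[of p "q # k"] self_in_conts[of q k] by fastforce
next
  case (Ite r S p q)
  from Ite.prems consider "c = Ite r S p q # k" | "c \<in> conts p k" | "c \<in> conts q k" by auto
  then show ?case
    by cases
      (use self_in_conts[of p k] self_in_conts[of q k] Ite.IH(1)[of k] Ite.IH(2)[of k] in auto)
next
  case (While r S p)
  then show ?case using self_in_conts[of p "While r S p # k"] by fastforce
qed auto

lemma registers_conts:
  "c \<in> conts p k \<Longrightarrow> q \<in> set c \<Longrightarrow> registers q \<subseteq> registers p \<union> \<Union>(registers ` set k)"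
  by (induction p arbitrary: k) fastforce+

lemma countable_all_conts [simp]: "countable (all_conts p)"
  by (simp add: all_conts_def finite_conts countable_finite)

lemma singleton_in_all_conts [simp]: "[p] \<in> all_conts p"
  and Nil_in_all_conts [simp]: "[] \<in> all_conts p"
  by (simp_all add: all_conts_def self_in_conts)

lemma continuation_in_all_conts: "c \<in> all_conts p \<Longrightarrow> continuation c f \<in> all_conts p"
  using continuation_in_conts[of c p "[]" f] by (auto simp: all_conts_def)

lemma registers_all_conts: "c \<in> all_conts p \<Longrightarrow> q \<in> set c \<Longrightarrow> registers q \<subseteq> registers p"
  using registers_conts[of c p "[]" q] by (auto simp: all_conts_def)

lemma to_nat_on_all_conts_less:
  "c \<in> all_conts p \<Longrightarrow> to_nat_on (all_conts p) c < card (all_conts p)"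
  using to_nat_on_finite[of "all_conts p"]
  by (auto simp: all_conts_def finite_conts bij_betw_def)

definition scanned :: "nat list \<Rightarrow> nat \<Rightarrow> nat" where
  "scanned rs i = (if i < length rs then rs ! i else 0)"

definition machine :: "nat \<Rightarrow> prog \<Rightarrow> tm" where
  "machine K p = \<lparr>tapes = K, states = card (all_conts p), symbols = 3,
     start = to_nat_on (all_conts p) [p], halt = to_nat_on (all_conts p) [],
     delta = (\<lambda>q rs. let c = from_nat_into (all_conts p) q in
       (to_nat_on (all_conts p) (continuation c (scanned rs)),
        map (action c (scanned rs)) [0..<K]))\<rparr>"

definition machine_config :: "nat \<Rightarrow> prog \<Rightarrow> prog list \<times> (nat \<Rightarrow> tape) \<Rightarrow> config" where
  "machine_config K p c = (to_nat_on (all_conts p) (fst c), map (snd c) [0..<K])"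

definition input_tapes :: "bool list \<Rightarrow> nat \<Rightarrow> tape" where
  "input_tapes w = (\<lambda>i. (0, word_cells (if i = 0 then w else [])))"

lemma wf_machine:
  assumes "K \<ge> 1"
  shows "wf_tm (machine K p)"
  unfolding wf_tm_def
proof (intro conjI allI impI)
  fix q rs
  assume rs: "length rs = tapes (machine K p) \<and> (\<forall>r\<in>set rs. r < symbols (machine K p))"
  let ?d = "delta (machine K p) q rs" and ?c = "from_nat_into (all_conts p) q"
  have "?c \<in> all_conts p"
    by (rule from_nat_into) (auto simp: all_conts_def)
  then show "fst ?d < states (machine K p)"
    by (simp add: machine_def Let_def continuation_in_all_conts to_nat_on_all_conts_less)
  show "length (snd ?d) = tapes (machine K p)"
    by (simp add: machine_def Let_def)
  have "fst (action ?c (scanned rs) i) < 3" for i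
    by (rule action_bound) (use rs in \<open>auto simp: machine_def scanned_def\<close>)
  then show "\<forall>(s, d)\<in>set (snd ?d). s < symbols (machine K p)"
    by (auto simp: machine_def Let_def case_prod_beta)
qed (use assms in \<open>auto simp: machine_def to_nat_on_all_conts_less\<close>)

lemma step_machine:
  assumes "fst c \<in> all_conts p" "registers p \<subseteq> {..<K}"
  shows "step (machine K p) (machine_config K p c) = machine_config K p (prog_step c)"
proof (cases "fst c = []")
  case True
  then show ?thesis
    by (simp add: step_def machine_def machine_config_def prog_step_def)
next
  case False
  let ?rs = "map read (map (snd c) [0..<K])"
  have scanned: "scanned ?rs i = read (snd c i)" if "i < K" for i
    using that by (simp add: scanned_def)
  have "continuation (fst c) (scanned ?rs) = continuation (fst c) (\<lambda>i. read (snd c i))"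
    by (rule continuation_cong, rule scanned)
      (use registers_all_conts assms in \<open>meson lessThan_iff subsetD\<close>)
  moreover have "action (fst c) (scanned ?rs) i = action (fst c) (\<lambda>i. read (snd c i)) i"
    if "i < K" for i
    by (rule action_cong) (rule scanned[OF that])
  ultimately show ?thesis
    using assms(1) False
    by (auto simp: step_def machine_def machine_config_def prog_step_def Let_def
        intro!: nth_equalityI)
qed

lemma init_machine: "K \<ge> 1 \<Longrightarrow> init (machine K p) w = machine_config K p ([p], input_tapes w)"
  by (auto simp: init_def machine_def machine_config_def input_tapes_def nth_Cons'
      intro!: nth_equalityI)

lemma machine_simulates:
  assumes "registers p \<subseteq> {..<K}" "K \<ge> 1"
  shows "(step (machine K p) ^^ n) (init (machine K p) w) =
    machine_config K p ((prog_step ^^ n) ([p], input_tapes w))"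
proof -
  let ?c = "\<lambda>n. (prog_step ^^ n) ([p], input_tapes w)"
  have "(step (machine K p) ^^ n) (init (machine K p) w) = machine_config K p (?c n) \<and>
      fst (?c n) \<in> all_conts p" for n
  proof (induction n)
    case (Suc n)
    then have "fst (?c (Suc n)) \<in> all_conts p"
      by (simp add: fst_prog_step continuation_in_all_conts)
    then show ?case using Suc step_machine[OF _ assms(1), of "?c n"] by simp
  qed (use assms(2) in \<open>simp add: init_machine\<close>)
  then show ?thesis by blast
qed

subsection \<open>Runs of programs\<close>

definition tape_runs :: "prog list \<Rightarrow> nat \<Rightarrow> (nat \<Rightarrow> tape) \<Rightarrow> (nat \<Rightarrow> tape) \<Rightarrow> bool" where
  "tape_runs ps n T T' \<longleftrightarrow> (\<exists>m\<le>n. \<forall>k. (prog_step ^^ m) (ps @ k, T) = (k, T'))"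

lemma tape_runs_mono: "tape_runs ps m T T' \<Longrightarrow> m \<le> n \<Longrightarrow> tape_runs ps n T T'"
  unfolding tape_runs_def by (meson order_trans)

lemma tape_runs_step:
  assumes "\<And>k. prog_step (p # k, T) = (ps @ k, T')" "tape_runs ps n T' T''"
  shows "tape_runs [p] (Suc n) T T''"
proof -
  from assms(2) obtain m where "m \<le> n" "\<And>k. (prog_step ^^ m) (ps @ k, T') = (k, T'')"
    unfolding tape_runs_def by blast
  then have "(prog_step ^^ Suc m) ([p] @ k, T) = (k, T'')" for k
    by (simp add: assms(1) funpow_swap1)
  with \<open>m \<le> n\<close> show ?thesis unfolding tape_runs_def by (meson Suc_le_mono)
qed

lemma tape_runs_append:
  assumes "tape_runs ps m T T'" "tape_runs qs n T' T''"
  shows "tape_runs (ps @ qs) (m + n) T T''"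
proof -
  from assms obtain m' n' where "m' \<le> m" "n' \<le> n"
    and "\<And>k. (prog_step ^^ m') (ps @ k, T) = (k, T')"
    and "\<And>k. (prog_step ^^ n') (qs @ k, T') = (k, T'')"
    unfolding tape_runs_def by blast
  then have "(prog_step ^^ (n' + m')) ((ps @ qs) @ k, T) = (k, T'')" for k
    by (simp add: funpow_add)
  with \<open>m' \<le> m\<close> \<open>n' \<le> n\<close> show ?thesis
    unfolding tape_runs_def by (metis add_mono add.commute)
qed

lemma tape_runs_Put: "tape_runs [Put r s d] 1 T (T(r := act (symbol s, d) (T r)))"
  unfolding tape_runs_def by (rule exI[of _ 1]) (auto simp: prog_step_def)

lemma tape_runs_Move: "tape_runs [Move r d] 1 T (T(r := act (read (T r), d) (T r)))"
  unfolding tape_runs_def by (rule exI[of _ 1]) (auto simp: prog_step_def)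

lemma tape_runs_Seq:
  "tape_runs [p] m T T' \<Longrightarrow> tape_runs [q] n T' T'' \<Longrightarrow> tape_runs [p ;; q] (Suc (m + n)) T T''"
  by (rule tape_runs_step[where ps = "[p] @ [q]"], simp add: prog_step_def)
    (rule tape_runs_append)

lemma tape_runs_Ite:
  "tape_runs [if read (T r) \<in> S then p else q] n T T' \<Longrightarrow>
   tape_runs [Ite r S p q] (Suc n) T T'"
  by (rule tape_runs_step) (simp_all add: prog_step_def)

lemma tape_runs_While_stop: "read (T r) \<notin> S \<Longrightarrow> tape_runs [While r S p] 1 T T"
  unfolding tape_runs_def by (rule exI[of _ 1]) (simp add: prog_step_def)

lemma tape_runs_While_step:
  "read (T r) \<in> S \<Longrightarrow> tape_runs [p] m T T' \<Longrightarrow> tape_runs [While r S p] n T' T'' \<Longrightarrow>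
   tape_runs [While r S p] (Suc (m + n)) T T''"
  by (rule tape_runs_step[where ps = "[p] @ [While r S p]"], simp add: prog_step_def)
    (rule tape_runs_append)

lemma tape_runs_untouched:
  assumes "tape_runs [p] n T T'" "r \<notin> registers p"
  shows "T' r = T r"
proof -
  let ?c = "\<lambda>m. (prog_step ^^ m) ([p], T)"
  have "r \<notin> \<Union>(registers ` set (fst (?c m))) \<and> snd (?c m) r = T r" for m
  proof (induction m)
    case (Suc m)
    have "r \<notin> \<Union>(registers ` set (fst (prog_step (?c m))))"
      unfolding fst_prog_step using Suc registers_continuation by blast
    moreover have "snd (prog_step (?c m)) r = T r"
      using Suc action_untouched[of r "fst (?c m)"] by (simp add: snd_prog_step)
    ultimately show ?case by simp
  qed (simp add: assms(2))
  moreover obtain m where "?c m = ([], T')"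
    using assms(1) unfolding tape_runs_def by fastforce
  ultimately show ?thesis by (metis snd_conv)
qed

subsection \<open>Tapes as stacks\<close>

text \<open>A stack occupies the cells from the head to the right; it grows to the left.\<close>

definition stack :: "tape \<Rightarrow> bool list \<Rightarrow> bool" where
  "stack t w \<longleftrightarrow> snd t = (\<lambda>i. word_cells w (i - fst t))"

lemma word_cells_Nil [simp]: "word_cells [] = (\<lambda>_. 0)"
  by (auto simp: word_cells_def)

lemma word_cells_Cons:
  "word_cells (b # w) i = (if i = 0 then symbol (Some b) else word_cells w (i - 1))"
proof -
  have "i > 0 \<Longrightarrow> nat i = Suc (nat (i - 1))" by simp
  then show ?thesis by (cases b) (auto simp: word_cells_def)
qed

lemma word_cells_snoc: "(word_cells v)(int (length v) := symbol (Some b)) = word_cells (v @ [b])"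
  by (cases b) (auto simp: word_cells_def nth_append fun_eq_iff)

fun top_symbol :: "bool list \<Rightarrow> nat" where
  "top_symbol [] = 0"
| "top_symbol (b # w) = symbol (Some b)"

lemma top_symbol_eq_0_iff: "top_symbol w = 0 \<longleftrightarrow> w = []"
  by (cases w; cases "hd w") auto

lemma symbol_Some [simp]: "symbol (Some b) = Suc 0 \<longleftrightarrow> \<not> b" "symbol (Some b) = 2 \<longleftrightarrow> b"
  by (cases b; simp)+

lemma stack_read: "stack t w \<Longrightarrow> read t = top_symbol w"
  by (cases w) (auto simp: stack_def read_def word_cells_Cons)

lemma stack_pop: "stack t w \<Longrightarrow> stack (act (0, MoveRight) t) (tl w)"
proof (cases t)
  case (Pair h f)
  have neg: "word_cells v i = 0" if "i < 0" for v i using that by (simp add: word_cells_def)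
  assume "stack t w"
  then show ?thesis
    by (cases w) (auto simp: Pair stack_def word_cells_Cons neg fun_eq_iff algebra_simps)
qed

lemma stack_push:
  "stack t w \<Longrightarrow> stack (act (symbol (Some b), Stay) (act (read t, MoveLeft) t)) (b # w)"
  by (cases t) (auto simp: stack_def word_cells_Cons fun_eq_iff read_def algebra_simps)

definition runs :: "prog \<Rightarrow> nat \<Rightarrow> (nat \<Rightarrow> bool list) \<Rightarrow> (nat \<Rightarrow> bool list) \<Rightarrow> bool" where
  "runs p n \<sigma> \<sigma>' \<longleftrightarrow> (\<forall>T. (\<forall>i. stack (T i) (\<sigma> i)) \<longrightarrow>
     (\<exists>T'. (\<forall>i. stack (T' i) (\<sigma>' i)) \<and> tape_runs [p] n T T'))"

lemma runs_eq: "runs p m \<sigma> \<sigma>' \<Longrightarrow> \<sigma>' = \<sigma>'' \<Longrightarrow> m \<le> n \<Longrightarrow> runs p n \<sigma> \<sigma>''"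
  unfolding runs_def by (meson tape_runs_mono)

lemma runs_Seq [trans]: "runs p m \<sigma> \<sigma>' \<Longrightarrow> runs q n \<sigma>' \<sigma>'' \<Longrightarrow> runs (p ;; q) (Suc (m + n)) \<sigma> \<sigma>''"
  unfolding runs_def by (meson tape_runs_Seq)

lemma runs_Ite:
  "runs (if top_symbol (\<sigma> r) \<in> S then p else q) n \<sigma> \<sigma>' \<Longrightarrow> runs (Ite r S p q) (Suc n) \<sigma> \<sigma>'"
  unfolding runs_def using tape_runs_Ite stack_read by metis

lemma runs_While_stop: "top_symbol (\<sigma> r) \<notin> S \<Longrightarrow> runs (While r S p) 1 \<sigma> \<sigma>"
  unfolding runs_def using tape_runs_While_stop stack_read by metis

lemma runs_While_step:
  "top_symbol (\<sigma> r) \<in> S \<Longrightarrow> runs p m \<sigma> \<sigma>' \<Longrightarrow> runs (While r S p) n \<sigma>' \<sigma>'' \<Longrightarrow>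
   runs (While r S p) (Suc (m + n)) \<sigma> \<sigma>''"
  unfolding runs_def using tape_runs_While_step stack_read by metis

definition skip :: prog where
  "skip = Move 0 Stay"

lemma runs_skip: "runs skip 1 \<sigma> \<sigma>"
  unfolding runs_def skip_def using tape_runs_Move[of 0 Stay]
  by (metis act_read_Stay fun_upd_triv)

definition pop :: "nat \<Rightarrow> prog" where
  "pop r = Put r None MoveRight"

lemma runs_pop: "runs (pop r) 1 \<sigma> (\<sigma>(r := tl (\<sigma> r)))"
  unfolding runs_def
proof (intro allI impI)
  fix T assume "\<forall>i. stack (T i) (\<sigma> i)"
  then have "\<forall>i. stack ((T(r := act (symbol None, MoveRight) (T r))) i) ((\<sigma>(r := tl (\<sigma> r))) i)"
    using stack_pop by auto
  then show "\<exists>T'. (\<forall>i. stack (T' i) ((\<sigma>(r := tl (\<sigma> r))) i)) \<and> tape_runs [pop r] 1 T T'"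
    unfolding pop_def using tape_runs_Put by blast
qed

definition push :: "nat \<Rightarrow> bool \<Rightarrow> prog" where
  "push r b = Move r MoveLeft ;; Put r (Some b) Stay"

lemma runs_push: "runs (push r b) 3 \<sigma> (\<sigma>(r := b # \<sigma> r))"
  unfolding runs_def
proof (intro allI impI)
  fix T assume "\<forall>i. stack (T i) (\<sigma> i)"
  moreover define T1 where "T1 = T(r := act (read (T r), MoveLeft) (T r))"
  moreover define T2 where "T2 = T1(r := act (symbol (Some b), Stay) (T1 r))"
  ultimately have "\<forall>i. stack (T2 i) ((\<sigma>(r := b # \<sigma> r)) i)"
    using stack_push by simp
  moreover have "tape_runs [push r b] (Suc (1 + 1)) T T2"
    unfolding push_def T2_def T1_def by (rule tape_runs_Seq[OF tape_runs_Move tape_runs_Put])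
  ultimately show "\<exists>T'. (\<forall>i. stack (T' i) ((\<sigma>(r := b # \<sigma> r)) i)) \<and> tape_runs [push r b] 3 T T'"
    by (metis numeral_3_eq_3 one_add_one numeral_2_eq_2)
qed

subsection \<open>A library of stack programs\<close>

fun push_word :: "nat \<Rightarrow> bool list \<Rightarrow> prog" where
  "push_word r [] = skip"
| "push_word r (b # w) = push_word r w ;; push r b"

lemma runs_push_word: "runs (push_word r w) (4 * length w + 1) \<sigma> (\<sigma>(r := w @ \<sigma> r))"
proof (induction w)
  case Nil
  show ?case using runs_skip by simp
next
  case (Cons b w)
  note Cons
  also have "runs (push r b) 3 (\<sigma>(r := w @ \<sigma> r)) (\<sigma>(r := (b # w) @ \<sigma> r))"
    by (rule runs_eq[OF runs_push]) auto
  finally show ?case unfolding push_word.simps by (rule runs_eq) auto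
qed

definition pop_case :: "nat \<Rightarrow> (bool \<Rightarrow> prog) \<Rightarrow> prog" where
  "pop_case r f = Ite r {2} (pop r ;; f True) (pop r ;; f False)"

lemma runs_pop_case:
  assumes "runs (f (\<sigma> r \<noteq> [] \<and> hd (\<sigma> r))) n (\<sigma>(r := tl (\<sigma> r))) \<sigma>'"
  shows "runs (pop_case r f) (n + 3) \<sigma> \<sigma>'"
proof -
  have "top_symbol (\<sigma> r) \<in> {2} \<longleftrightarrow> \<sigma> r \<noteq> [] \<and> hd (\<sigma> r)" by (cases "\<sigma> r") auto
  with runs_Seq[OF runs_pop assms]
  have "runs (if top_symbol (\<sigma> r) \<in> {2} then pop r ;; f True else pop r ;; f False) (n + 2) \<sigma> \<sigma>'"
    by (cases "\<sigma> r \<noteq> [] \<and> hd (\<sigma> r)") auto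
  from runs_Ite[OF this] show ?thesis
    unfolding pop_case_def by (rule runs_eq) simp_all
qed

lemma runs_pop_case_Cons:
  "runs (f b) n (\<sigma>(r := w)) \<sigma>' \<Longrightarrow> runs (pop_case r f) (n + 3) (\<sigma>(r := b # w)) \<sigma>'"
  by (rule runs_pop_case) simp

definition drain :: "nat \<Rightarrow> (bool \<Rightarrow> prog) \<Rightarrow> prog" where
  "drain r f = While r {1, 2} (pop_case r f)"

text \<open>Here \<^term>\<open>S u\<close> are the stacks once \<^term>\<open>u\<close> has been popped from register \<^term>\<open>r\<close>,
  up to the content of \<^term>\<open>r\<close> itself.\<close>

lemma runs_drain:
  assumes "\<And>u b v. w = u @ b # v \<Longrightarrow> runs (f b) n ((S u)(r := v)) ((S (u @ [b]))(r := v))"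
    and "(S [])(r := w) = \<sigma>"
  shows "runs (drain r f) ((n + 4) * length w + 1) \<sigma> ((S w)(r := []))"
proof -
  have "runs (drain r f) ((n + 4) * length v + 1) ((S u)(r := v)) ((S w)(r := []))"
    if "w = u @ v" for u v
    using that
  proof (induction v arbitrary: u)
    case Nil
    then show ?case unfolding drain_def by (intro runs_eq[OF runs_While_stop]) auto
  next
    case (Cons b v)
    have "runs (pop_case r f) (n + 3) ((S u)(r := b # v)) ((S (u @ [b]))(r := v))"
      by (rule runs_pop_case_Cons) (rule assms(1)[OF Cons.prems])
    moreover have "top_symbol (((S u)(r := b # v)) r) \<in> {1, 2}" by simp
    moreover have "runs (drain r f) ((n + 4) * length v + 1)
        ((S (u @ [b]))(r := v)) ((S w)(r := []))"
      by (rule Cons.IH) (use Cons.prems in simp)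
    ultimately have "runs (drain r f) (Suc (n + 3 + ((n + 4) * length v + 1)))
        ((S u)(r := b # v)) ((S w)(r := []))"
      unfolding drain_def by (metis runs_While_step)
    then show ?case by (rule runs_eq) auto
  qed
  from this[of "[]" w] show ?thesis by (simp add: assms(2))
qed

definition clear :: "nat \<Rightarrow> prog" where
  "clear r = drain r (\<lambda>_. skip)"

lemma runs_clear: "runs (clear r) (5 * length (\<sigma> r) + 1) \<sigma> (\<sigma>(r := []))"
  unfolding clear_def
  by (rule runs_eq[OF runs_drain[where S = "\<lambda>_. \<sigma>" and w = "\<sigma> r", OF runs_skip]]) simp_all

definition transduce :: "nat \<Rightarrow> (bool \<Rightarrow> bool list) \<Rightarrow> nat \<Rightarrow> prog" where
  "transduce r g r' = drain r (\<lambda>b. push_word r' (g b))"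

lemma runs_transduce:
  assumes "r \<noteq> r'" "\<And>b. length (g b) \<le> m"
  shows "runs (transduce r g r') ((4 * m + 5) * length (\<sigma> r) + 1) \<sigma>
    (\<sigma>(r := [], r' := concat (map g (rev (\<sigma> r))) @ \<sigma> r'))"
proof -
  define S where "S u = \<sigma>(r' := concat (map g (rev u)) @ \<sigma> r')" for u
  have "runs (push_word r' (g b)) (4 * m + 1) ((S u)(r := v)) ((S (u @ [b]))(r := v))" for u b v
    by (rule runs_eq[OF runs_push_word]) (use assms in \<open>auto simp: S_def\<close>)
  moreover have "(S [])(r := \<sigma> r) = \<sigma>" by (simp add: S_def)
  ultimately show ?thesis
    unfolding transduce_def by (rule runs_eq[OF runs_drain]) (use assms in \<open>auto simp: S_def\<close>)
qed

definition reverse_onto :: "nat \<Rightarrow> nat \<Rightarrow> prog" where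
  "reverse_onto r r' = transduce r (\<lambda>b. [b]) r'"

lemma runs_reverse_onto:
  "r \<noteq> r' \<Longrightarrow>
   runs (reverse_onto r r') (9 * length (\<sigma> r) + 1) \<sigma> (\<sigma>(r := [], r' := rev (\<sigma> r) @ \<sigma> r'))"
  unfolding reverse_onto_def by (rule runs_eq[OF runs_transduce[where m = 1]]) auto

definition transfer :: "nat \<Rightarrow> nat \<Rightarrow> nat \<Rightarrow> prog" where
  "transfer r s r' = reverse_onto r s ;; reverse_onto s r'"

lemma runs_transfer:
  assumes "distinct [r, s, r']" "\<sigma> s = []"
  shows "runs (transfer r s r') (18 * length (\<sigma> r) + 3) \<sigma> (\<sigma>(r := [], r' := \<sigma> r @ \<sigma> r'))"
proof -
  have "runs (reverse_onto r s) (9 * length (\<sigma> r) + 1) \<sigma> (\<sigma>(r := [], s := rev (\<sigma> r)))"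
    by (rule runs_eq[OF runs_reverse_onto]) (use assms in auto)
  also have "runs (reverse_onto s r') (9 * length (\<sigma> r) + 1) \<dots> (\<sigma>(r := [], r' := \<sigma> r @ \<sigma> r'))"
    by (rule runs_eq[OF runs_reverse_onto]) (use assms in \<open>auto simp: fun_eq_iff\<close>)
  finally show ?thesis unfolding transfer_def by (rule runs_eq) auto
qed

definition duplicate :: "nat \<Rightarrow> nat \<Rightarrow> nat \<Rightarrow> prog" where
  "duplicate r s r' = reverse_onto r s ;; drain s (\<lambda>b. push r b ;; push r' b)"

lemma runs_duplicate:
  assumes "distinct [r, s, r']" "\<sigma> s = []"
  shows "runs (duplicate r s r') (20 * length (\<sigma> r) + 3) \<sigma> (\<sigma>(r' := \<sigma> r @ \<sigma> r'))"
proof -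
  define S where "S u = \<sigma>(r := rev u, r' := rev u @ \<sigma> r')" for u
  have "runs (push r b ;; push r' b) 7 ((S u)(s := v)) ((S (u @ [b]))(s := v))" for u b v
    by (rule runs_eq[OF runs_Seq[OF runs_push runs_push]])
      (use assms in \<open>auto simp: S_def fun_eq_iff\<close>)
  then have copy: "runs (drain s (\<lambda>b. push r b ;; push r' b)) (11 * length (\<sigma> r) + 1)
      ((S [])(s := rev (\<sigma> r))) ((S (rev (\<sigma> r)))(s := []))"
    by (rule runs_eq[OF runs_drain[where w = "rev (\<sigma> r)"]]) simp_all
  have "runs (reverse_onto r s) (9 * length (\<sigma> r) + 1) \<sigma> ((S [])(s := rev (\<sigma> r)))"
    by (rule runs_eq[OF runs_reverse_onto]) (use assms in \<open>auto simp: S_def fun_eq_iff\<close>)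
  also note copy
  finally show ?thesis
    unfolding duplicate_def by (rule runs_eq) (use assms in \<open>auto simp: S_def fun_eq_iff\<close>)
qed

definition push_pair :: "nat \<Rightarrow> nat \<Rightarrow> nat \<Rightarrow> prog" where
  "push_pair r s r' = reverse_onto r s ;; push r' False ;; transduce s (\<lambda>b. [True, b]) r'"

lemma runs_push_pair:
  assumes "distinct [r, s, r']" "\<sigma> s = []"
  shows "runs (push_pair r s r') (22 * length (\<sigma> r) + 7) \<sigma> (\<sigma>(r := [], r' := pair (\<sigma> r) (\<sigma> r')))"
proof -
  have "runs (reverse_onto r s) (9 * length (\<sigma> r) + 1) \<sigma> (\<sigma>(r := [], s := rev (\<sigma> r)))"
    by (rule runs_eq[OF runs_reverse_onto]) (use assms in auto)
  also have "runs (push r' False) 3 \<dots> (\<sigma>(r := [], s := rev (\<sigma> r), r' := False # \<sigma> r'))"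
    by (rule runs_eq[OF runs_push]) (use assms in auto)
  also have "runs (transduce s (\<lambda>b. [True, b]) r') (13 * length (\<sigma> r) + 1) \<dots>
      (\<sigma>(r := [], r' := pair (\<sigma> r) (\<sigma> r')))"
    by (rule runs_eq[OF runs_transduce[where m = 2]])
      (use assms in \<open>auto simp: fun_eq_iff pair_def enc_bits_def\<close>)
  finally show ?thesis unfolding push_pair_def by (rule runs_eq) auto
qed

text \<open>A left inverse of \<^const>\<open>pair\<close>, total so that verifiers can apply it to arbitrary words.\<close>

fun unpair :: "bool list \<Rightarrow> bool list \<times> bool list" where
  "unpair [] = ([], [])"
| "unpair (False # w) = ([], w)"
| "unpair [True] = ([False], [])"
| "unpair (True # b # w) = (b # fst (unpair w), snd (unpair w))"

lemma unpair_pair [simp]: "unpair (pair u v) = (u, v)"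
  by (induction u) (auto simp: pair_def enc_bits_def)

lemma length_pair: "length (pair u v) = 2 * length u + length v + 1"
  by (induction u) (auto simp: pair_def enc_bits_def)

lemma pair_neq_Nil [simp]: "pair u v \<noteq> []"
  by (simp add: pair_def enc_bits_def)

lemma length_unpair: "2 * length (fst (unpair w)) + length (snd (unpair w)) \<le> length w + 1"
  by (induction w rule: unpair.induct) auto

definition split_loop :: "nat \<Rightarrow> nat \<Rightarrow> prog" where
  "split_loop r r' = While r {2} (pop r ;; pop_case r (push r'))"

lemma runs_split_loop_step:
  assumes "r \<noteq> r'" "\<sigma> r = True # w"
    and "runs (split_loop r r') n (\<sigma>(r := tl w, r' := (w \<noteq> [] \<and> hd w) # \<sigma> r')) \<sigma>'"
  shows "runs (split_loop r r') (n + 9) \<sigma> \<sigma>'"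
proof -
  have "runs (pop r ;; pop_case r (push r')) 8 \<sigma> (\<sigma>(r := tl w, r' := (w \<noteq> [] \<and> hd w) # \<sigma> r'))"
    by (rule runs_eq[OF runs_Seq[OF runs_pop runs_pop_case[OF runs_push]]])
      (use assms(1,2) in auto)
  from runs_While_step[OF _ this assms(3)[unfolded split_loop_def]] show ?thesis
    unfolding split_loop_def by (rule runs_eq) (use assms(2) in auto)
qed

lemma runs_split_loop:
  assumes "r \<noteq> r'" "\<sigma> r = w"
  shows "\<exists>v. tl v = snd (unpair w) \<and> runs (split_loop r r') (9 * length w + 1) \<sigma>
    (\<sigma>(r := v, r' := rev (fst (unpair w)) @ \<sigma> r'))"
  using assms(2)
proof (induction w arbitrary: \<sigma> rule: unpair.induct[case_names Nil Stop Single Bit])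
  case Nil
  then show ?case unfolding split_loop_def
    by (intro exI[of _ "[]"] conjI runs_eq[OF runs_While_stop]) auto
next
  case (Stop w)
  then show ?case unfolding split_loop_def
    by (intro exI[of _ "False # w"] conjI runs_eq[OF runs_While_stop]) auto
next
  case Single
  let ?\<sigma> = "\<sigma>(r := [], r' := False # \<sigma> r')"
  have "runs (split_loop r r') 1 ?\<sigma> ?\<sigma>"
    unfolding split_loop_def using assms(1) by (intro runs_While_stop) simp
  then have "runs (split_loop r r') (1 + 9) \<sigma> ?\<sigma>"
    by (intro runs_split_loop_step[where w = "[]"]) (simp_all add: assms(1) Single)
  then have "runs (split_loop r r') (9 * length [True] + 1) \<sigma>
      (\<sigma>(r := [], r' := rev (fst (unpair [True])) @ \<sigma> r'))"
    by (rule runs_eq) auto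
  then show ?case by (intro exI[of _ "[]"] conjI) simp
next
  case (Bit b w)
  let ?\<sigma> = "\<sigma>(r := w, r' := b # \<sigma> r')"
  have "?\<sigma> r = w" using assms(1) by simp
  from Bit.IH[of ?\<sigma>, OF this] obtain v where v: "tl v = snd (unpair w)"
    "runs (split_loop r r') (9 * length w + 1) ?\<sigma> (?\<sigma>(r := v, r' := rev (fst (unpair w)) @ ?\<sigma> r'))"
    by blast
  then have "runs (split_loop r r') (9 * length w + 1 + 9) \<sigma>
      (?\<sigma>(r := v, r' := rev (fst (unpair w)) @ ?\<sigma> r'))"
    by (intro runs_split_loop_step[where w = "b # w"]) (simp_all add: assms(1) Bit.prems)
  then have "runs (split_loop r r') (9 * length (True # b # w) + 1) \<sigma>
      (\<sigma>(r := v, r' := rev (fst (unpair (True # b # w))) @ \<sigma> r'))"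
    by (rule runs_eq) auto
  then show ?case using v(1) by (intro exI[of _ v] conjI) simp
qed

definition unpack :: "nat \<Rightarrow> prog" where
  "unpack b = split_loop b (b + 1) ;; pop b ;; reverse_onto b (b + 2) ;; reverse_onto (b + 1) b ;;
     reverse_onto (b + 2) (b + 1)"

lemma runs_unpack:
  assumes "\<sigma> b = w" "\<sigma> (b + 1) = []" "\<sigma> (b + 2) = []" "unpair w = (u, v)"
  shows "runs (unpack b) (40 * length w + 40) \<sigma> (\<sigma>(b := u, b + 1 := v))"
proof -
  obtain v' where v': "tl v' = v"
    "runs (split_loop b (b + 1)) (9 * length w + 1) \<sigma> (\<sigma>(b := v', b + 1 := rev u))"
    using runs_split_loop[of b "b + 1" \<sigma> w] assms(1,2,4) by auto
  note v'(2)
  also have "runs (pop b) 1 \<dots> (\<sigma>(b := v, b + 1 := rev u))"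
    by (rule runs_eq[OF runs_pop]) (use v'(1) in auto)
  also have "runs (reverse_onto b (b + 2)) (9 * length v + 1) \<dots>
      (\<sigma>(b := [], b + 1 := rev u, b + 2 := rev v))"
    by (rule runs_eq[OF runs_reverse_onto]) (use assms in auto)
  also have "runs (reverse_onto (b + 1) b) (9 * length u + 1) \<dots> (\<sigma>(b := u, b + 2 := rev v))"
    by (rule runs_eq[OF runs_reverse_onto]) (use assms in \<open>auto simp: fun_eq_iff\<close>)
  also have "runs (reverse_onto (b + 2) (b + 1)) (9 * length v + 1) \<dots> (\<sigma>(b := u, b + 1 := v))"
    by (rule runs_eq[OF runs_reverse_onto]) (use assms in \<open>auto simp: fun_eq_iff\<close>)
  finally show ?thesis
    unfolding unpack_def by (rule runs_eq) (use length_unpair[of w] assms(4) in auto)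
qed

section \<open>Polynomial-time functions on encodable types\<close>

definition poly_bounded :: "(nat \<Rightarrow> nat) \<Rightarrow> bool" where
  "poly_bounded t \<longleftrightarrow> (\<exists>p :: nat poly. \<forall>n. t n \<le> poly p n)"

lemma poly_nat_mono: "m \<le> n \<Longrightarrow> poly (p :: nat poly) m \<le> poly p n"
  by (induction p) (simp_all add: mult_le_mono)

lemma poly_bounded_const: "poly_bounded (\<lambda>n. c)"
  unfolding poly_bounded_def by (intro exI[of _ "[:c:]"]) simp

lemma poly_bounded_id: "poly_bounded (\<lambda>n. n)"
  unfolding poly_bounded_def by (intro exI[of _ "[:0, 1:]"]) simp

lemma poly_bounded_add:
  assumes "poly_bounded s" "poly_bounded t"
  shows "poly_bounded (\<lambda>n. s n + t n)"
proof -
  obtain p q where "\<And>n. s n \<le> poly p n" "\<And>n. t n \<le> poly q n"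
    using assms unfolding poly_bounded_def by blast
  then have "s n + t n \<le> poly (p + q) n" for n by (simp add: add_mono)
  then show ?thesis unfolding poly_bounded_def by blast
qed

lemma poly_bounded_mult:
  assumes "poly_bounded s" "poly_bounded t"
  shows "poly_bounded (\<lambda>n. s n * t n)"
proof -
  obtain p q where "\<And>n. s n \<le> poly p n" "\<And>n. t n \<le> poly q n"
    using assms unfolding poly_bounded_def by blast
  then have "s n * t n \<le> poly (p * q) n" for n by (simp add: mult_le_mono)
  then show ?thesis unfolding poly_bounded_def by blast
qed

lemma poly_bounded_Suc: "poly_bounded s \<Longrightarrow> poly_bounded (\<lambda>n. Suc (s n))"
  using poly_bounded_add[OF _ poly_bounded_const[of 1]] by simp

lemma poly_bounded_poly:
  assumes "poly_bounded t"
  shows "poly_bounded (\<lambda>n. poly p (t n))"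
proof -
  obtain q where "\<And>n. t n \<le> poly q n" using assms unfolding poly_bounded_def by blast
  then have "poly p (t n) \<le> poly (pcompose p q) n" for n
    by (simp add: poly_pcompose poly_nat_mono)
  then show ?thesis unfolding poly_bounded_def by blast
qed

lemmas poly_bounded_intros = poly_bounded_const poly_bounded_id poly_bounded_add
  poly_bounded_mult poly_bounded_Suc poly_bounded_poly

class encodable =
  fixes code :: "'a \<Rightarrow> bool list"
  assumes code_inject: "code x = code y \<longleftrightarrow> x = y"

abbreviation size_of :: "'a::encodable \<Rightarrow> nat" where
  "size_of x \<equiv> length (code x)"

text \<open>The program \<^term>\<open>P b\<close> uses the registers above \<^term>\<open>b\<close> as scratch space and leaves those
  below untouched.\<close>

definition computes ::
  "(nat \<Rightarrow> prog) \<Rightarrow> ('a::encodable \<Rightarrow> 'b::encodable) \<Rightarrow> (nat \<Rightarrow> nat) \<Rightarrow> bool" where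
  "computes P f t \<longleftrightarrow> (\<forall>b \<sigma> x. \<sigma> b = code x \<longrightarrow> (\<forall>i>b. \<sigma> i = []) \<longrightarrow>
     runs (P b) (t (size_of x)) \<sigma> (\<sigma>(b := code (f x))))"

definition polytime :: "('a::encodable \<Rightarrow> 'b::encodable) \<Rightarrow> bool" where
  "polytime f \<longleftrightarrow>
     (\<exists>t P. poly_bounded t \<and> (\<forall>x. size_of (f x) \<le> t (size_of x)) \<and> computes P f t)"

lemma computesD:
  assumes "computes P f t" "\<sigma> b = code x" "\<forall>i>b. \<sigma> i = []"
  shows "runs (P b) (t (size_of x)) \<sigma> (\<sigma>(b := code (f x)))"
  using assms(1)[unfolded computes_def, THEN spec, of b] assms(2,3) by blast

lemma polytimeI:
  fixes f :: "'a::encodable \<Rightarrow> 'b::encodable"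
  assumes "poly_bounded t" "\<And>x. size_of (f x) \<le> t (size_of x)"
    and "\<And>b \<sigma> x. \<sigma> b = code x \<Longrightarrow> \<forall>i>b. \<sigma> i = [] \<Longrightarrow>
      runs (P b) (t (size_of x)) \<sigma> (\<sigma>(b := code (f x)))"
  shows "polytime f"
  unfolding polytime_def computes_def
  by (rule exI[of _ t], rule exI[of _ P]) (use assms in blast)

lemma polytimeE:
  fixes f :: "'a::encodable \<Rightarrow> 'b::encodable"
  assumes "polytime f"
  obtains q P where "\<And>x. size_of (f x) \<le> poly q (size_of x)" "computes P f (poly q)"
proof -
  from assms obtain t P where t: "poly_bounded t" "\<forall>x. size_of (f x) \<le> t (size_of x)"
    and P: "computes P f t"
    unfolding polytime_def by blast
  from t(1) obtain q where q: "\<And>n. t n \<le> poly q n" unfolding poly_bounded_def by blast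
  with P have "computes P f (poly q)"
    unfolding computes_def by (blast intro: runs_eq[OF _ refl])
  moreover have "size_of (f x) \<le> poly q (size_of x)" for x using t(2) q le_trans by blast
  ultimately show ?thesis by (rule that[rotated])
qed

lemma polytime_size:
  assumes "polytime f" obtains q where "\<And>x. size_of (f x) \<le> poly q (size_of x)"
  using assms by (rule polytimeE) blast

lemma polytime_code_eq: "polytime f \<Longrightarrow> (\<And>x. code (g x) = code (f x)) \<Longrightarrow> polytime g"
  unfolding polytime_def computes_def by simp

named_theorems polytime_intros

lemma polytime_id [polytime_intros]: "polytime (\<lambda>x. x)"
  by (rule polytimeI[where t = "\<lambda>n. n + 1" and P = "\<lambda>b. skip"])
    (auto intro!: poly_bounded_intros runs_eq[OF runs_skip])

lemma polytime_const [polytime_intros]: "polytime (\<lambda>x. c)"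
  by (rule polytimeI[where t = "\<lambda>n. 5 * n + 4 * size_of c + 3"
        and P = "\<lambda>b. clear b ;; push_word b (code c)"])
    (auto intro!: poly_bounded_intros runs_eq[OF runs_Seq[OF runs_clear runs_push_word]])

lemma polytime_prefix: "(\<And>x. code (f x) = w @ code x) \<Longrightarrow> polytime f"
  by (rule polytimeI[where t = "\<lambda>n. n + 4 * length w + 1" and P = "\<lambda>b. push_word b w"])
    (auto intro!: poly_bounded_intros runs_eq[OF runs_push_word])

lemma polytime_tl_code: "(\<And>x. code (f x) = tl (code x)) \<Longrightarrow> polytime f"
  by (rule polytimeI[where t = "\<lambda>n. n + 1" and P = pop])
    (auto intro!: poly_bounded_intros runs_eq[OF runs_pop])

lemma polytime_comp:
  fixes f :: "'a::encodable \<Rightarrow> 'b::encodable" and g :: "'b \<Rightarrow> 'c::encodable"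
  assumes "polytime g" "polytime f"
  shows "polytime (\<lambda>x. g (f x))"
proof -
  obtain q P where f: "\<And>x. size_of (f x) \<le> poly q (size_of x)" "computes P f (poly q)"
    using polytimeE[OF assms(2)] by metis
  obtain q' P' where g: "\<And>x. size_of (g x) \<le> poly q' (size_of x)" "computes P' g (poly q')"
    using polytimeE[OF assms(1)] by metis
  define t where "t n = Suc (poly q n + poly q' (poly q n))" for n
  have mono: "poly q' (size_of (f x)) \<le> poly q' (poly q (size_of x))" for x
    by (rule poly_nat_mono[OF f(1)])
  show ?thesis
  proof (rule polytimeI[where t = t and P = "\<lambda>b. P b ;; P' b"])
    show "poly_bounded t" unfolding t_def by (intro poly_bounded_intros)
    show "size_of (g (f x)) \<le> t (size_of x)" for x
      using g(1)[of "f x"] mono[of x] by (simp add: t_def)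
  next
    fix b :: nat and \<sigma> and x :: 'a
    assume \<sigma>: "\<sigma> b = code x" "\<forall>i>b. \<sigma> i = []"
    then have "runs (P b) (poly q (size_of x)) \<sigma> (\<sigma>(b := code (f x)))" by (rule computesD[OF f(2)])
    also have "runs (P' b) (poly q' (size_of (f x))) \<dots> (\<sigma>(b := code (g (f x))))"
      by (rule runs_eq[OF computesD[OF g(2)]]) (use \<sigma> in auto)
    finally show "runs (P b ;; P' b) (t (size_of x)) \<sigma> (\<sigma>(b := code (g (f x))))"
      by (rule runs_eq) (use mono[of x] in \<open>simp_all add: t_def\<close>)
  qed
qed

subsection \<open>Encodings\<close>

instantiation prod :: (encodable, encodable) encodable
begin
definition code_prod :: "'a \<times> 'b \<Rightarrow> bool list" where
  "code_prod x = pair (code (fst x)) (code (snd x))"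
instance by standard (auto simp: code_prod_def pair_inject code_inject prod_eq_iff)
end

instantiation bool :: encodable
begin
definition code_bool :: "bool \<Rightarrow> bool list" where "code_bool b = [b]"
instance by standard (auto simp: code_bool_def)
end

instantiation nat :: encodable
begin
definition code_nat :: "nat \<Rightarrow> bool list" where "code_nat n = replicate n True"
instance by standard (auto simp: code_nat_def)
end

instantiation list :: (encodable) encodable
begin
definition code_list :: "'a list \<Rightarrow> bool list" where
  "code_list xs = concat (map (\<lambda>x. enc_bits (code x)) xs)"
instance
proof
  show "code x = code y \<longleftrightarrow> x = y" for x y :: "'a list"
  proof (induction x arbitrary: y)
    case Nil
    then show ?case by (cases y) (auto simp: code_list_def enc_bits_def)
  next
    case (Cons a x)
    have "enc_bits (code a) \<noteq> []" by (simp add: enc_bits_def)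
    with Cons show ?case
      by (cases y) (simp_all add: code_list_def enc_bits_prefix_free code_inject)
  qed
qed
end

instantiation literal :: (encodable) encodable
begin
fun code_literal :: "'a literal \<Rightarrow> bool list" where
  "code_literal (Pos v) = True # code v"
| "code_literal (Neg v) = False # code v"
instance
proof
  show "code x = code y \<longleftrightarrow> x = y" for x y :: "'a literal"
    by (cases x; cases y) (auto simp: code_inject)
qed
end

text \<open>Words that code themselves; \<^typ>\<open>bool list\<close> carries the encoding of lists.\<close>

datatype raw = Raw (unraw: "bool list")

instantiation raw :: encodable
begin
definition code_raw :: "raw \<Rightarrow> bool list" where "code_raw = unraw"
instance by standard (auto simp: code_raw_def raw.expand)
end

lemma code_Raw [simp]: "code (Raw w) = w"
  by (simp add: code_raw_def)

lemma code_Nil [simp]: "code [] = []"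
  by (simp add: code_list_def)

lemma code_Cons: "code (x # xs) = pair (code x) (code xs)"
  by (simp add: code_list_def pair_def)

lemma code_append: "code (xs @ ys) = code xs @ code ys"
  by (simp add: code_list_def)

lemma code_bools: "code (w :: bool list) = concat (map (\<lambda>c. [True, c, False]) w)"
  by (induction w) (auto simp: code_list_def code_bool_def enc_bits_def)

lemma code_Pair: "code (x, y) = pair (code x) (code y)"
  by (simp add: code_prod_def)

lemma size_Pair [simp]: "size_of (x, y) = 2 * size_of x + size_of y + 1"
  by (simp add: code_Pair length_pair)

lemma size_Cons [simp]: "size_of (x # xs) = 2 * size_of x + size_of xs + 1"
  by (simp add: code_Cons length_pair)

lemma size_append [simp]: "size_of (xs @ ys) = size_of xs + size_of ys"
  by (simp add: code_append)

lemma size_bool [simp]: "size_of (b :: bool) = 1"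
  by (simp add: code_bool_def)

lemma size_nat [simp]: "size_of (n :: nat) = n"
  by (simp add: code_nat_def)

lemma size_bools: "size_of (w :: bool list) = 3 * length w"
  by (induction w) simp_all

lemma code_eq_Nil_iff [simp]: "code (xs :: 'a::encodable list) = [] \<longleftrightarrow> xs = []"
  using code_inject[of xs "[]"] by simp

lemma length_le_size: "length xs \<le> size_of xs"
  by (induction xs) auto

lemma size_elem_le: "x \<in> set xs \<Longrightarrow> size_of x \<le> size_of xs"
  by (induction xs) auto

lemma size_drop_le: "size_of (drop i xs) \<le> size_of xs"
  by (metis append_take_drop_id le_add2 size_append)

subsection \<open>Pairs, tests and iteration\<close>

lemma polytime_Pair [polytime_intros]:
  fixes f :: "'a::encodable \<Rightarrow> 'b::encodable" and g :: "'a \<Rightarrow> 'c::encodable"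
  assumes "polytime f" "polytime g"
  shows "polytime (\<lambda>x. (f x, g x))"
proof -
  obtain q P where f: "\<And>x. size_of (f x) \<le> poly q (size_of x)" "computes P f (poly q)"
    using polytimeE[OF assms(1)] by metis
  obtain q' P' where g: "\<And>x. size_of (g x) \<le> poly q' (size_of x)" "computes P' g (poly q')"
    using polytimeE[OF assms(2)] by metis
  define t where "t n = 60 * (n + poly q n + poly q' n) + 60" for n
  define R where "R b = duplicate b (b+1) (b+2) ;; P (b+2) ;; transfer b (b+1) (b+3) ;;
    P' (b+3) ;; transfer (b+3) (b+1) b ;; push_pair (b+2) (b+1) b" for b
  show ?thesis
  proof (rule polytimeI[where t = t and P = R])
    show "poly_bounded t" unfolding t_def by (intro poly_bounded_intros)
    show "size_of (f x, g x) \<le> t (size_of x)" for x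
      using f(1)[of x] g(1)[of x] by (simp add: t_def)
  next
    fix b :: nat and \<sigma> and x :: 'a
    assume \<sigma>: "\<sigma> b = code x" "\<forall>i>b. \<sigma> i = []"
    let ?n = "size_of x" and ?X = "code x" and ?U = "code (f x)" and ?V = "code (g x)"
    have "runs (duplicate b (b+1) (b+2)) (20 * ?n + 3) \<sigma> (\<sigma>(b+2 := ?X))"
      by (rule runs_eq[OF runs_duplicate]) (use \<sigma> in auto)
    also have "runs (P (b+2)) (poly q ?n) \<dots> (\<sigma>(b+2 := ?U))"
      by (rule runs_eq[OF computesD[OF f(2), of _ _ x]]) (use \<sigma> in auto)
    also have "runs (transfer b (b+1) (b+3)) (18 * ?n + 3) \<dots> (\<sigma>(b := [], b+2 := ?U, b+3 := ?X))"
      by (rule runs_eq[OF runs_transfer]) (use \<sigma> in auto)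
    also have "runs (P' (b+3)) (poly q' ?n) \<dots> (\<sigma>(b := [], b+2 := ?U, b+3 := ?V))"
      by (rule runs_eq[OF computesD[OF g(2), of _ _ x]]) (use \<sigma> in auto)
    also have "runs (transfer (b+3) (b+1) b) (18 * size_of (g x) + 3) \<dots> (\<sigma>(b := ?V, b+2 := ?U))"
      by (rule runs_eq[OF runs_transfer]) (use \<sigma> in auto)
    also have "runs (push_pair (b+2) (b+1) b) (22 * size_of (f x) + 7) \<dots> (\<sigma>(b := pair ?U ?V))"
      by (rule runs_eq[OF runs_push_pair]) (use \<sigma> in auto)
    finally show "runs (R b) (t ?n) \<sigma> (\<sigma>(b := code (f x, g x)))"
      unfolding R_def
      by (rule runs_eq) (use f(1)[of x] g(1)[of x] in \<open>simp_all add: code_Pair t_def\<close>)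
  qed
qed

lemma polytime_unpack:
  fixes f :: "'a::encodable \<Rightarrow> 'b::encodable"
  assumes code: "\<And>x. code (f x) = F (fst (unpair (code x))) (snd (unpair (code x)))"
    and length: "\<And>u v. length (F u v) \<le> c * (length u + length v)"
    and runs: "\<And>b \<sigma> u v. \<sigma> b = u \<Longrightarrow> \<sigma> (b+1) = v \<Longrightarrow> \<forall>i>b+1. \<sigma> i = [] \<Longrightarrow>
      runs (P b) (c * (length u + length v + 1)) \<sigma> (\<sigma>(b := F u v, b+1 := []))"
  shows "polytime f"
proof (rule polytimeI[where t = "\<lambda>n. (40 * n + 40) + c * (n + 2) + 1"
      and P = "\<lambda>b. unpack b ;; P b"])
  fix x :: 'a
  let ?u = "fst (unpair (code x))" and ?v = "snd (unpair (code x))"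
  have uv: "length ?u + length ?v \<le> size_of x + 1" using length_unpair[of "code x"] by simp
  have "size_of (f x) \<le> c * (size_of x + 1)"
    unfolding code using length by (rule le_trans) (rule mult_le_mono2[OF uv])
  then show "size_of (f x) \<le> (40 * size_of x + 40) + c * (size_of x + 2) + 1" by simp
  fix b :: nat and \<sigma>
  assume \<sigma>: "\<sigma> b = code x" "\<forall>i>b. \<sigma> i = []"
  then have "runs (unpack b) (40 * size_of x + 40) \<sigma> (\<sigma>(b := ?u, b+1 := ?v))"
    by (intro runs_unpack) auto
  also have "runs (P b) (c * (length ?u + length ?v + 1)) \<dots> (\<sigma>(b := code (f x)))"
    by (rule runs_eq[OF runs]) (use \<sigma> in \<open>auto simp: code\<close>)
  finally show "runs (unpack b ;; P b) ((40 * size_of x + 40) + c * (size_of x + 2) + 1) \<sigma>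
      (\<sigma>(b := code (f x)))"
    by (rule runs_eq) (use mult_le_mono2[OF uv, of c] in \<open>simp_all add: algebra_simps\<close>)
qed (intro poly_bounded_intros)

lemma polytime_unpair_fst: "(\<And>x. code (f x) = fst (unpair (code x))) \<Longrightarrow> polytime f"
  by (rule polytime_unpack[where F = "\<lambda>u v. u" and c = 5 and P = "\<lambda>b. clear (b+1)"])
    (auto intro!: runs_eq[OF runs_clear])

lemma polytime_unpair_snd: "(\<And>x. code (f x) = snd (unpair (code x))) \<Longrightarrow> polytime f"
  by (rule polytime_unpack[where F = "\<lambda>u v. v" and c = 20
        and P = "\<lambda>b. clear b ;; transfer (b+1) (b+2) b"])
    (auto intro!: runs_eq[OF runs_Seq[OF runs_clear runs_transfer]])

lemma polytime_unpair_append: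
  "(\<And>x. code (f x) = fst (unpair (code x)) @ snd (unpair (code x))) \<Longrightarrow> polytime f"
  by (rule polytime_unpack[where F = "(@)" and c = 40
        and P = "\<lambda>b. transfer b (b+2) (b+1) ;; transfer (b+1) (b+2) b"])
    (auto intro!: runs_eq[OF runs_Seq[OF runs_transfer runs_transfer]])

lemma polytime_top_symbol:
  fixes f :: "'a::encodable \<Rightarrow> bool"
  assumes "\<And>x. f x \<longleftrightarrow> top_symbol (code x) \<in> S"
  shows "polytime f"
proof (rule polytimeI[where t = "\<lambda>n. 5 * n + 10"
      and P = "\<lambda>b. Ite b S (clear b ;; push b True) (clear b ;; push b False)"])
  fix b :: nat and \<sigma> and x :: 'a
  assume \<sigma>: "\<sigma> b = code x" "\<forall>i>b. \<sigma> i = []"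
  have "runs (clear b ;; push b c) (5 * size_of x + 5) \<sigma> (\<sigma>(b := [c]))" for c
    by (rule runs_eq[OF runs_Seq[OF runs_clear runs_push]]) (use \<sigma> in auto)
  then have "runs
      (if top_symbol (\<sigma> b) \<in> S then clear b ;; push b True else clear b ;; push b False)
      (5 * size_of x + 5) \<sigma> (\<sigma>(b := code (f x)))"
    using \<sigma> assms[of x] by (simp add: code_bool_def)
  from runs_Ite[OF this]
  show "runs (Ite b S (clear b ;; push b True) (clear b ;; push b False)) (5 * size_of x + 10) \<sigma>
      (\<sigma>(b := code (f x)))"
    by (rule runs_eq) auto
qed (auto intro!: poly_bounded_intros)

lemma polytime_if [polytime_intros]:
  fixes c :: "'a::encodable \<Rightarrow> bool" and f g :: "'a \<Rightarrow> 'b::encodable"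
  assumes "polytime c" "polytime f" "polytime g"
  shows "polytime (\<lambda>x. if c x then f x else g x)"
proof -
  obtain p C where c: "computes C c (poly p)"
    using polytimeE[OF assms(1)] by metis
  obtain q P where f: "\<And>x. size_of (f x) \<le> poly q (size_of x)" "computes P f (poly q)"
    using polytimeE[OF assms(2)] by metis
  obtain q' P' where g: "\<And>x. size_of (g x) \<le> poly q' (size_of x)" "computes P' g (poly q')"
    using polytimeE[OF assms(3)] by metis
  define t where "t n = 20 * n + poly p n + poly q n + poly q' n + 20" for n
  define R where "R b = duplicate b (b+2) (b+1) ;; C (b+1) ;;
    pop_case (b+1) (\<lambda>c. if c then P b else P' b)" for b
  show ?thesis
  proof (rule polytimeI[where t = t and P = R])
    show "poly_bounded t" unfolding t_def by (intro poly_bounded_intros)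
    show "size_of (if c x then f x else g x) \<le> t (size_of x)" for x
      using f(1)[of x] g(1)[of x] by (simp add: t_def)
  next
    fix b :: nat and \<sigma> and x :: 'a
    assume \<sigma>: "\<sigma> b = code x" "\<forall>i>b. \<sigma> i = []"
    let ?n = "size_of x" and ?h = "if c x then f x else g x"
    have "\<sigma>(b+1 := []) = \<sigma>" using \<sigma>(2) by auto
    then have branch: "runs (if c x then P b else P' b) (poly q ?n + poly q' ?n) (\<sigma>(b+1 := []))
        (\<sigma>(b := code ?h))"
      using runs_eq[OF computesD[OF f(2) \<sigma>] refl] runs_eq[OF computesD[OF g(2) \<sigma>] refl] by simp
    have "runs (duplicate b (b+2) (b+1)) (20 * ?n + 3) \<sigma> (\<sigma>(b+1 := code x))"
      by (rule runs_eq[OF runs_duplicate]) (use \<sigma> in auto)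
    also have "runs (C (b+1)) (poly p ?n) \<dots> (\<sigma>(b+1 := [c x]))"
      by (rule runs_eq[OF computesD[OF c, of _ _ x]]) (use \<sigma> in \<open>auto simp: code_bool_def\<close>)
    also note runs_pop_case_Cons[where f = "\<lambda>c. if c then P b else P' b", OF branch]
    finally show "runs (R b) (t ?n) \<sigma> (\<sigma>(b := code ?h))"
      unfolding R_def by (rule runs_eq) (simp_all add: t_def)
  qed
qed

lemma runs_drain_iterate:
  fixes g :: "'a::encodable \<Rightarrow> 'a"
  assumes "computes P g t" "\<sigma> b = w" "\<sigma> (b+1) = code y" "\<forall>i>b+1. \<sigma> i = []"
    and time: "\<And>i. i \<le> length w \<Longrightarrow> t (size_of ((g ^^ i) y)) \<le> n"
  shows "runs (drain b (\<lambda>_. P (b+1))) ((n + 4) * length w + 1) \<sigma>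
    (\<sigma>(b := [], b+1 := code ((g ^^ length w) y)))"
proof -
  define S where "S u = \<sigma>(b+1 := code ((g ^^ length u) y))" for u :: "bool list"
  have "runs (P (b+1)) n ((S u)(b := v)) ((S (u @ [a]))(b := v))" if "w = u @ a # v" for u a v
  proof (rule runs_eq[OF computesD[OF assms(1), of _ _ "(g ^^ length u) y"]])
    show "t (size_of ((g ^^ length u) y)) \<le> n" using that by (intro time) simp
  qed (use assms in \<open>auto simp: S_def\<close>)
  moreover have "(S [])(b := w) = \<sigma>" using assms by (auto simp: S_def)
  ultimately show ?thesis
    by (rule runs_eq[OF runs_drain]) (auto simp: S_def)
qed

text \<open>The number of iterations is the length of a code, as the loop pops that code bit by bit.\<close>

lemma polytime_funpow_size:
  fixes g :: "'a::encodable \<Rightarrow> 'a" and s :: "'e::encodable \<Rightarrow> 'a" and c :: "'e \<Rightarrow> 'c::encodable"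
  assumes "polytime g" "polytime s" "polytime c"
    and size: "\<And>x i. i \<le> size_of (c x) \<Longrightarrow> size_of ((g ^^ i) (s x)) \<le> poly B (size_of x)"
  shows "polytime (\<lambda>x. (g ^^ size_of (c x)) (s x))"
proof -
  obtain q P where g: "computes P g (poly q)"
    using polytimeE[OF assms(1)] by metis
  obtain q' Q where cs: "\<And>x. size_of (c x, s x) \<le> poly q' (size_of x)"
    "computes Q (\<lambda>x. (c x, s x)) (poly q')"
    using polytimeE[OF polytime_Pair[OF assms(3,2)]] by metis
  define t where "t n = 41 * poly q' n + (poly q (poly B n) + 4) * poly q' n + 18 * poly B n + 50"
    for n
  define R where
    "R b = Q b ;; unpack b ;; drain b (\<lambda>_. P (b+1)) ;; transfer (b+1) (b+2) b" for b
  show ?thesis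
  proof (rule polytimeI[where t = t and P = R])
    show "poly_bounded t" unfolding t_def by (intro poly_bounded_intros)
    show "size_of ((g ^^ size_of (c x)) (s x)) \<le> t (size_of x)" for x
      using size[of "size_of (c x)" x] by (simp add: t_def)
  next
    fix b :: nat and \<sigma> and x :: 'e
    assume \<sigma>: "\<sigma> b = code x" "\<forall>i>b. \<sigma> i = []"
    let ?n = "size_of (c x)" and ?q = "poly q (poly B (size_of x))"
    let ?h = "(g ^^ ?n) (s x)"
    have time: "(?q + 4) * ?n \<le> (?q + 4) * poly q' (size_of x)"
      using cs(1)[of x] by (intro mult_le_mono2) simp
    have "runs (Q b) (poly q' (size_of x)) \<sigma> (\<sigma>(b := code (c x, s x)))"
      by (rule computesD[OF cs(2) \<sigma>])
    also have "runs (unpack b) (40 * size_of (c x, s x) + 40) \<dots>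
        (\<sigma>(b := code (c x), b+1 := code (s x)))"
      by (rule runs_eq[OF runs_unpack]) (use \<sigma> in \<open>auto simp: code_Pair\<close>)
    also have "runs (drain b (\<lambda>_. P (b+1))) ((?q + 4) * ?n + 1) \<dots> (\<sigma>(b := [], b+1 := code ?h))"
      by (rule runs_eq[OF runs_drain_iterate[OF g, where y = "s x" and n = ?q]])
        (use \<sigma> in \<open>auto intro!: poly_nat_mono size\<close>)
    also have "runs (transfer (b+1) (b+2) b) (18 * size_of ?h + 3) \<dots> (\<sigma>(b := code ?h))"
      by (rule runs_eq[OF runs_transfer]) (use \<sigma> in auto)
    finally show "runs (R b) (t (size_of x)) \<sigma> (\<sigma>(b := code ?h))"
      unfolding R_def
      by (rule runs_eq) (use size[of ?n x] cs(1)[of x] time in \<open>simp_all only: t_def, linarith\<close>)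
  qed
qed

lemma polytime_code_self: "polytime (code :: 'a::encodable \<Rightarrow> bool list)"
proof (rule polytimeI[where t = "\<lambda>n. 26 * n + 3" and P = "\<lambda>b. reverse_onto b (b+1) ;;
    transduce (b+1) (\<lambda>c. [True, c, False]) b"])
  fix b :: nat and \<sigma> and x :: 'a
  assume \<sigma>: "\<sigma> b = code x" "\<forall>i>b. \<sigma> i = []"
  have "runs (reverse_onto b (b+1)) (9 * size_of x + 1) \<sigma> (\<sigma>(b := [], b+1 := rev (code x)))"
    by (rule runs_eq[OF runs_reverse_onto]) (use \<sigma> in auto)
  also have "runs (transduce (b+1) (\<lambda>c. [True, c, False]) b) (17 * size_of x + 1) \<dots>
      (\<sigma>(b := code (code x)))"
    by (rule runs_eq[OF runs_transduce[where m = 3]]) (use \<sigma> in \<open>auto simp: code_bools\<close>)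
  finally show "runs (reverse_onto b (b+1) ;; transduce (b+1) (\<lambda>c. [True, c, False]) b)
      (26 * size_of x + 3) \<sigma> (\<sigma>(b := code (code x)))"
    by (rule runs_eq) auto
qed (auto intro!: poly_bounded_intros simp: size_bools)

subsection \<open>Polynomial-time functions are computed by Turing machines\<close>

lemma outputs_within_mono:
  assumes "outputs_within M x y t" "t \<le> t'"
  shows "outputs_within M x y t'"
proof -
  obtain ts where ts: "(step M ^^ t) (init M x) = (halt M, ts)" "snd (last ts) = word_cells y"
    using assms(1) by (auto simp: outputs_within_def split: prod.splits)
  have "(step M ^^ n) (halt M, ts) = (halt M, ts)" for n
    by (induction n) (auto simp: step_def)
  moreover have "(step M ^^ t') (init M x) = (step M ^^ (t' - t)) ((step M ^^ t) (init M x))"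
    using assms(2) by (metis comp_apply funpow_add le_add_diff_inverse2)
  ultimately show ?thesis using ts by (simp add: outputs_within_def)
qed

lemma outputs_within_machine:
  assumes "tape_runs [p] n (input_tapes w) T" "snd (T r) = word_cells y"
    and "registers p \<subseteq> {..<Suc r}"
  shows "outputs_within (machine (Suc r) p) w y n"
proof -
  from assms(1) obtain m where m: "m \<le> n" "(prog_step ^^ m) ([p], input_tapes w) = ([], T)"
    unfolding tape_runs_def by (metis append_Nil2)
  have "(step (machine (Suc r) p) ^^ m) (init (machine (Suc r) p) w) =
      (halt (machine (Suc r) p), map T [0..<Suc r])"
    using machine_simulates[OF assms(3), of m w] m(2) by (simp add: machine_config_def machine_def)
  then have "outputs_within (machine (Suc r) p) w y m"
    using assms(2) by (simp add: outputs_within_def)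
  then show ?thesis using m(1) by (rule outputs_within_mono)
qed

text \<open>Unlike a stack, the output is written to the right. In the code of a word, a bit \<^term>\<open>a\<close>
  appears as \<^term>\<open>[True, a, False]\<close>.\<close>

definition write_bit :: "nat \<Rightarrow> prog" where
  "write_bit r = pop 0 ;; Ite 0 {2} (Put r (Some True) MoveRight) (Put r (Some False) MoveRight) ;;
     pop 0 ;; pop 0"

definition write_output :: "nat \<Rightarrow> prog" where
  "write_output r = While 0 {1, 2} (write_bit r)"

lemma tape_runs_pop:
  "stack (T r) w \<Longrightarrow> \<exists>t. stack t (tl w) \<and> tape_runs [pop r] 1 T (T(r := t))"
  unfolding pop_def using tape_runs_Put[of r None MoveRight T] stack_pop by fastforce

lemma tape_runs_write_bit:
  assumes "stack (T 0) (True # a # False # w)" "T r = (int (length v), word_cells v)" "r \<noteq> 0"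
  shows "\<exists>t. stack t w \<and>
    tape_runs [write_bit r] 8 T (T(0 := t, r := (int (length (v @ [a])), word_cells (v @ [a]))))"
proof -
  let ?t = "(int (length (v @ [a])), word_cells (v @ [a]))"
  obtain t1 where t1: "stack t1 (a # False # w)" "tape_runs [pop 0] 1 T (T(0 := t1))"
    using tape_runs_pop[of T 0, OF assms(1)] by auto
  have "tape_runs [Put r (Some a) MoveRight] 1 (T(0 := t1)) (T(0 := t1, r := ?t))"
    using tape_runs_Put[of r "Some a" MoveRight "T(0 := t1)"] assms(2,3)
    by (simp add: word_cells_snoc add.commute)
  then have put: "tape_runs [Ite 0 {2} (Put r (Some True) MoveRight) (Put r (Some False) MoveRight)]
      (Suc 1) (T(0 := t1)) (T(0 := t1, r := ?t))"
    by (intro tape_runs_Ite) (use stack_read[OF t1(1)] in \<open>cases a; simp\<close>)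
  obtain t2 where t2: "stack t2 (False # w)"
    "tape_runs [pop 0] 1 (T(0 := t1, r := ?t)) (T(0 := t2, r := ?t))"
    using tape_runs_pop[of "T(0 := t1, r := ?t)" 0] t1(1) assms(3)
    by (fastforce simp: fun_upd_twist)
  obtain t3 where t3: "stack t3 w"
    "tape_runs [pop 0] 1 (T(0 := t2, r := ?t)) (T(0 := t3, r := ?t))"
    using tape_runs_pop[of "T(0 := t2, r := ?t)" 0] t2(1) assms(3)
    by (fastforce simp: fun_upd_twist)
  have "tape_runs [write_bit r] 8 T (T(0 := t3, r := ?t))"
    unfolding write_bit_def
    by (rule tape_runs_mono
        [OF tape_runs_Seq[OF tape_runs_Seq[OF tape_runs_Seq[OF t1(2) put] t2(2)] t3(2)]]) simp
  with t3(1) show ?thesis by blast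
qed

lemma tape_runs_write_output:
  assumes "stack (T 0) (code (w :: bool list))" "T r = (int (length v), word_cells v)" "r \<noteq> 0"
  shows "\<exists>T'. tape_runs [write_output r] (9 * length w + 1) T T' \<and> snd (T' r) = word_cells (v @ w)"
  using assms(1,2)
proof (induction w arbitrary: T v)
  case Nil
  then have "tape_runs [write_output r] 1 T T"
    unfolding write_output_def by (intro tape_runs_While_stop) (simp add: stack_read)
  with Nil show ?case by auto
next
  case (Cons a w)
  let ?t = "(int (length (v @ [a])), word_cells (v @ [a]))"
  have code: "code (a # w) = True # a # False # code w" by (simp add: code_bools)
  obtain t where t: "stack t (code w)" "tape_runs [write_bit r] 8 T (T(0 := t, r := ?t))"
    using tape_runs_write_bit[of T a "code w" r v] Cons.prems code assms(3) by auto
  have "stack ((T(0 := t, r := ?t)) 0) (code w)" "(T(0 := t, r := ?t)) r = ?t"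
    using t(1) assms(3) by simp_all
  from Cons.IH[OF this] obtain T' where
    T': "tape_runs [write_output r] (9 * length w + 1) (T(0 := t, r := ?t)) T'"
      "snd (T' r) = word_cells ((v @ [a]) @ w)"
    by blast
  have "read (T 0) \<in> {1, 2}" using stack_read[OF Cons.prems(1)] code by simp
  from tape_runs_While_step[OF this t(2) T'(1)[unfolded write_output_def]]
  have "tape_runs [write_output r] (9 * length (a # w) + 1) T T'"
    unfolding write_output_def by (rule tape_runs_mono) simp
  with T'(2) show ?case by auto
qed

theorem polytime_raw_imp_ptime_computable:
  assumes "polytime (f :: raw \<Rightarrow> bool list)"
  shows "ptime_computable (\<lambda>x. f (Raw x))"
proof -
  obtain q P where size: "\<And>x. size_of (f x) \<le> poly q (size_of x)"
    and P: "computes P f (poly q)"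
    using polytimeE[OF assms] by metis
  obtain r where "\<forall>i\<in>insert 0 (registers (P 0)). i < r"
    using finite_nat_set_iff_bounded[of "insert 0 (registers (P 0))"] finite_registers by auto
  then have r: "r \<noteq> 0" "r \<notin> registers (P 0)" "registers (P 0 ;; write_output r) \<subseteq> {..<Suc r}"
    by (auto simp: write_output_def write_bit_def pop_def less_Suc_eq)
  define t where "t n = 10 * poly q n + 2" for n
  have run: "outputs_within (machine (Suc r) (P 0 ;; write_output r)) x (f (Raw x)) (t (length x))"
    for x
  proof -
    let ?\<sigma> = "(\<lambda>_. [])(0 := x)"
    have "\<forall>i. stack (input_tapes x i) (?\<sigma> i)"
      by (auto simp: input_tapes_def stack_def)
    moreover have "runs (P 0) (poly q (length x)) ?\<sigma> (?\<sigma>(0 := code (f (Raw x))))"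
      using computesD[OF P, of ?\<sigma> 0 "Raw x"] by simp
    ultimately obtain T where T: "\<forall>i. stack (T i) ((?\<sigma>(0 := code (f (Raw x)))) i)"
      "tape_runs [P 0] (poly q (length x)) (input_tapes x) T"
      unfolding runs_def by blast
    have "stack (T 0) (code (f (Raw x)))" using T(1) by (auto dest: spec[of _ 0])
    moreover have "T r = (int (length []), word_cells [])"
      using tape_runs_untouched[OF T(2) r(2)] r(1) by (simp add: input_tapes_def)
    ultimately obtain T' where T': "snd (T' r) = word_cells (f (Raw x))"
      "tape_runs [write_output r] (9 * length (f (Raw x)) + 1) T T'"
      using tape_runs_write_output[of T "f (Raw x)" r "[]"] r(1) by auto
    have "tape_runs [P 0 ;; write_output r] (t (length x)) (input_tapes x) T'"
      by (rule tape_runs_mono[OF tape_runs_Seq[OF T(2) T'(2)]])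
        (use size[of "Raw x"] in \<open>simp add: t_def size_bools\<close>)
    then show ?thesis using T'(1) r(3) by (rule outputs_within_machine)
  qed
  have "poly_bounded t" unfolding t_def by (intro poly_bounded_intros)
  then obtain q' where "\<And>n. t n \<le> poly q' n" unfolding poly_bounded_def by blast
  then show ?thesis
    unfolding ptime_computable_def using run wf_machine outputs_within_mono
    by (metis le_add1 plus_1_eq_Suc)
qed

corollary polytime_imp_ptime_computable:
  assumes "polytime (f :: bool list \<Rightarrow> bool list)"
  shows "ptime_computable f"
  using polytime_raw_imp_ptime_computable[OF polytime_comp[OF assms polytime_code_self]] by simp

subsection \<open>A library of polynomial-time functions\<close>

lemma polytime_fst [polytime_intros]: "polytime f \<Longrightarrow> polytime (\<lambda>x. fst (f x))"
  by (rule polytime_comp[OF polytime_unpair_fst]) (auto simp: code_prod_def)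

lemma polytime_snd [polytime_intros]: "polytime f \<Longrightarrow> polytime (\<lambda>x. snd (f x))"
  by (rule polytime_comp[OF polytime_unpair_snd]) (auto simp: code_prod_def)

lemma polytime_comp2:
  fixes g :: "'a::encodable \<Rightarrow> 'b::encodable \<Rightarrow> 'c::encodable"
  assumes "polytime (\<lambda>p. g (fst p) (snd p))" "polytime f" "polytime h"
  shows "polytime (\<lambda>x. g (f x) (h x))"
  using polytime_comp[OF assms(1) polytime_Pair[OF assms(2,3)]] by simp

lemma polytime_code [polytime_intros]: "polytime f \<Longrightarrow> polytime (\<lambda>x. code (f x))"
  by (rule polytime_comp[OF polytime_code_self])

lemma polytime_not [polytime_intros]: "polytime f \<Longrightarrow> polytime (\<lambda>x. \<not> f x)"
  by (rule polytime_code_eq[OF polytime_if[of f "\<lambda>_. False" "\<lambda>_. True"]])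
    (auto intro: polytime_const)

lemma polytime_conj [polytime_intros]: "polytime f \<Longrightarrow> polytime g \<Longrightarrow> polytime (\<lambda>x. f x \<and> g x)"
  by (rule polytime_code_eq[OF polytime_if[of f g "\<lambda>_. False"]]) (auto intro: polytime_const)

lemma polytime_disj [polytime_intros]: "polytime f \<Longrightarrow> polytime g \<Longrightarrow> polytime (\<lambda>x. f x \<or> g x)"
  by (rule polytime_code_eq[OF polytime_if[of f "\<lambda>_. True" g]]) (auto intro: polytime_const)

lemma polytime_imp [polytime_intros]: "polytime f \<Longrightarrow> polytime g \<Longrightarrow> polytime (\<lambda>x. f x \<longrightarrow> g x)"
  by (rule polytime_code_eq[OF polytime_if[of f g "\<lambda>_. True"]]) (auto intro: polytime_const)

lemma polytime_eq_bool:
  fixes f g :: "'a::encodable \<Rightarrow> bool"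
  shows "polytime f \<Longrightarrow> polytime g \<Longrightarrow> polytime (\<lambda>x. f x = g x)"
  by (rule polytime_code_eq[OF polytime_if[of f g "\<lambda>x. \<not> g x"]]) (auto intro: polytime_not)

lemma polytime_Cons [polytime_intros]:
  "polytime f \<Longrightarrow> polytime g \<Longrightarrow> polytime (\<lambda>x. f x # g x)"
  by (rule polytime_code_eq[OF polytime_Pair]) (auto simp: code_Cons code_Pair)

lemma polytime_append [polytime_intros]:
  "polytime f \<Longrightarrow> polytime g \<Longrightarrow> polytime (\<lambda>x. f x @ g x)"
  by (rule polytime_comp2[OF polytime_unpair_append]) (auto simp: code_append code_prod_def)

lemma polytime_tl [polytime_intros]:
  fixes f :: "'a::encodable \<Rightarrow> 'b::encodable list"
  shows "polytime f \<Longrightarrow> polytime (\<lambda>x. tl (f x))"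
proof (rule polytime_comp[OF polytime_unpair_snd[of tl]])
  show "code (tl xs) = snd (unpair (code xs))" for xs :: "'b list"
    by (cases xs) (auto simp: code_Cons)
qed

lemma polytime_eq_Nil [polytime_intros]:
  fixes f :: "'a::encodable \<Rightarrow> 'b::encodable list"
  shows "polytime f \<Longrightarrow> polytime (\<lambda>x. f x = [])"
  by (rule polytime_comp[OF polytime_top_symbol[of "\<lambda>xs. xs = []" "{0}"]])
    (simp_all add: top_symbol_eq_0_iff)

lemma polytime_hd [polytime_intros]:
  fixes f :: "'a::encodable \<Rightarrow> 'b::encodable list"
  assumes "polytime f"
  shows "polytime (\<lambda>x. hd (f x))"
proof (rule polytime_comp[OF _ assms])
  define nil where "nil = Raw (code (hd ([] :: 'b list)))"
  have "polytime (\<lambda>xs :: 'b list. if xs = [] then nil else Raw (fst (unpair (code xs))))"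
    by (intro polytime_intros polytime_unpair_fst) simp
  moreover have "code (hd xs) = code (if xs = [] then nil else Raw (fst (unpair (code xs))))"
    for xs :: "'b list"
    by (cases xs) (auto simp: nil_def code_Cons)
  ultimately show "polytime (hd :: 'b list \<Rightarrow> 'b)" by (rule polytime_code_eq)
qed

lemma polytime_Suc [polytime_intros]: "polytime f \<Longrightarrow> polytime (\<lambda>x. Suc (f x))"
  by (rule polytime_comp[OF polytime_prefix[of Suc "[True]"]]) (auto simp: code_nat_def)

lemma polytime_add [polytime_intros]:
  "polytime f \<Longrightarrow> polytime g \<Longrightarrow> polytime (\<lambda>x. f x + g x :: nat)"
  by (rule polytime_comp2[OF polytime_unpair_append])
    (auto simp: code_nat_def code_prod_def replicate_add)

lemma polytime_eq_0 [polytime_intros]: "polytime f \<Longrightarrow> polytime (\<lambda>x. f x = (0 :: nat))"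
  by (rule polytime_comp[OF polytime_top_symbol[of "\<lambda>n. n = 0" "{0}"]])
    (simp_all add: top_symbol_eq_0_iff code_nat_def)

lemma polytime_Pos [polytime_intros]: "polytime f \<Longrightarrow> polytime (\<lambda>x. Pos (f x))"
  by (rule polytime_comp[OF polytime_prefix[of Pos "[True]"]]) auto

lemma polytime_Neg [polytime_intros]: "polytime f \<Longrightarrow> polytime (\<lambda>x. Neg (f x))"
  by (rule polytime_comp[OF polytime_prefix[of Neg "[False]"]]) auto

lemma polytime_var [polytime_intros]:
  fixes f :: "'a::encodable \<Rightarrow> 'b::encodable literal"
  shows "polytime f \<Longrightarrow> polytime (\<lambda>x. var (f x))"
proof (rule polytime_comp[OF polytime_tl_code[of var]])
  show "code (var l) = tl (code l)" for l :: "'b literal" by (cases l) auto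
qed

fun is_Pos :: "'v literal \<Rightarrow> bool" where
  "is_Pos (Pos v) \<longleftrightarrow> True"
| "is_Pos (Neg v) \<longleftrightarrow> False"

lemma polytime_is_Pos [polytime_intros]:
  fixes f :: "'a::encodable \<Rightarrow> 'b::encodable literal"
  shows "polytime f \<Longrightarrow> polytime (\<lambda>x. is_Pos (f x))"
proof (rule polytime_comp[OF polytime_top_symbol[of is_Pos "{2}"]])
  show "is_Pos l \<longleftrightarrow> top_symbol (code l) \<in> {2}" for l :: "'b literal" by (cases l) auto
qed

lemma polytime_map_literal [polytime_intros]:
  fixes g :: "'a::encodable \<Rightarrow> 'b::encodable \<Rightarrow> 'c::encodable"
  assumes "polytime (\<lambda>p. g (fst p) (snd p))" "polytime l"
  shows "polytime (\<lambda>x. map_literal (g x) (l x))"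
proof -
  have "polytime (\<lambda>x. g x (var (l x)))"
    by (rule polytime_comp2[OF assms(1)]) (intro polytime_intros assms(2))+
  then have "polytime (\<lambda>x. if is_Pos (l x) then Pos (g x (var (l x))) else Neg (g x (var (l x))))"
    by (intro polytime_intros assms(2))
  moreover have "map_literal h k = (if is_Pos k then Pos (h (var k)) else Neg (h (var k)))"
    for h :: "'b \<Rightarrow> 'c" and k
    by (cases k) auto
  ultimately show ?thesis by simp
qed

lemma polytime_foldl:
  fixes f :: "'e::encodable \<Rightarrow> 'b::encodable \<Rightarrow> 'a::encodable \<Rightarrow> 'b" and s :: "'e \<Rightarrow> 'b"
  assumes f: "polytime (\<lambda>p. f (fst p) (fst (snd p)) (snd (snd p)))"
    and s: "polytime s" and xs: "polytime xs"
    and bound: "\<And>x i. size_of (foldl (f x) (s x) (take i (xs x))) \<le> poly B (size_of x)"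
  shows "polytime (\<lambda>x. foldl (f x) (s x) (xs x))"
proof -
  define g where "g = (\<lambda>p :: 'e \<times> 'b \<times> 'a list. if snd (snd p) = [] then p
    else (fst p, f (fst p) (fst (snd p)) (hd (snd (snd p))), tl (snd (snd p))))"
  define c where "c x = (x, s x, xs x)" for x
  have "polytime (\<lambda>p :: 'e \<times> 'b \<times> 'a list. f (fst p) (fst (snd p)) (hd (snd (snd p))))"
    using polytime_comp[OF f, of "\<lambda>p. (fst p, fst (snd p), hd (snd (snd p)))"]
    by (simp add: polytime_intros)
  then have g: "polytime g" unfolding g_def by (intro polytime_intros)
  have c: "polytime c" unfolding c_def by (intro polytime_intros s xs)
  have iterate: "(g ^^ i) (c x) = (x, foldl (f x) (s x) (take i (xs x)), drop i (xs x))"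
    for i and x :: 'e
  proof (induction i)
    case (Suc i)
    then show ?case
      by (cases "i < length (xs x)")
        (simp_all add: g_def take_Suc_conv_app_nth hd_drop_conv_nth drop_Suc tl_drop)
  qed (simp add: c_def)
  obtain q where "\<And>x. size_of (xs x) \<le> poly q (size_of x)"
    using polytime_size[OF xs] by blast
  then have "size_of ((g ^^ i) (c x)) \<le> poly ([:2, 2:] + 2 * B + q) (size_of x)"
    for i and x :: 'e
    using bound[of x i] size_drop_le[of i "xs x"] le_trans[of _ "size_of (xs x)"]
    by (fastforce simp: iterate)
  from polytime_fst[OF polytime_snd[OF polytime_funpow_size[OF g c xs this]]]
  show ?thesis by (simp add: iterate length_le_size)
qed

lemma size_foldl_le:
  assumes "\<And>b a. a \<in> set ys \<Longrightarrow> size_of (f b a) \<le> size_of b + k"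
  shows "size_of (foldl f b ys) \<le> size_of b + length ys * k"
  using assms
proof (induction ys arbitrary: b)
  case (Cons a ys)
  then have "size_of (foldl f (f b a) ys) \<le> size_of (f b a) + length ys * k" by simp
  moreover have "size_of (f b a) \<le> size_of b + k" using Cons.prems by simp
  ultimately show ?case by simp
qed simp

lemma polytime_foldl_additive:
  fixes f :: "'e::encodable \<Rightarrow> 'b::encodable \<Rightarrow> 'a::encodable \<Rightarrow> 'b" and s :: "'e \<Rightarrow> 'b"
  assumes f: "polytime (\<lambda>p. f (fst p) (fst (snd p)) (snd (snd p)))"
    and s: "polytime s" and xs: "polytime xs"
    and bound: "\<And>e b a. size_of (f e b a) \<le> size_of b + poly B (size_of e + size_of a)"
  shows "polytime (\<lambda>x. foldl (f x) (s x) (xs x))"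
proof -
  obtain p q where p: "\<And>x. size_of (s x) \<le> poly p (size_of x)"
    and q: "\<And>x. size_of (xs x) \<le> poly q (size_of x)"
    using polytime_size[OF s] polytime_size[OF xs] by metis
  show ?thesis
  proof (rule polytime_foldl[OF f s xs])
    fix i :: nat and x :: 'e
    let ?k = "poly B (size_of x + poly q (size_of x))"
    have "size_of (f x b a) \<le> size_of b + ?k" if "a \<in> set (take i (xs x))" for a b
    proof -
      have "size_of a \<le> poly q (size_of x)"
        using size_elem_le[OF in_set_takeD[OF that]] q[of x] by linarith
      then have "poly B (size_of x + size_of a) \<le> ?k" by (intro poly_nat_mono) simp
      then show ?thesis using bound[of x b a] by linarith
    qed
    then have "size_of (foldl (f x) (s x) (take i (xs x)))
        \<le> size_of (s x) + length (take i (xs x)) * ?k"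
      by (rule size_foldl_le)
    also have "\<dots> \<le> poly p (size_of x) + poly q (size_of x) * ?k"
      using p[of x] q[of x] length_le_size[of "xs x"] by (intro add_mono mult_right_mono) auto
    finally show "size_of (foldl (f x) (s x) (take i (xs x)))
        \<le> poly (p + q * pcompose B ([:0, 1:] + q)) (size_of x)"
      by (simp add: poly_pcompose)
  qed
qed

lemma polytime_size2:
  fixes g :: "'a::encodable \<Rightarrow> 'b::encodable \<Rightarrow> 'c::encodable"
  assumes "polytime (\<lambda>p. g (fst p) (snd p))"
  obtains q where "\<And>e a. size_of (g e a) \<le> poly q (size_of e + size_of a)"
proof -
  obtain q where q: "\<And>p. size_of (g (fst p) (snd p)) \<le> poly q (size_of p)"
    using polytime_size[OF assms] by blast
  have "size_of (g e a) \<le> poly (pcompose q [:1, 2:]) (size_of e + size_of a)" for e a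
  proof -
    have "poly q (size_of (e, a)) \<le> poly q (1 + 2 * (size_of e + size_of a))"
      by (intro poly_nat_mono) simp
    also have "\<dots> = poly (pcompose q [:1, 2:]) (size_of e + size_of a)"
      by (simp add: poly_pcompose mult.commute)
    finally show ?thesis using q[of "(e, a)"] by simp
  qed
  then show ?thesis using that by blast
qed

lemma polytime_concat_map:
  fixes g :: "'a::encodable \<Rightarrow> 'b::encodable \<Rightarrow> 'c::encodable list"
  assumes g: "polytime (\<lambda>p. g (fst p) (snd p))" and xs: "polytime xs"
  shows "polytime (\<lambda>x. concat (map (g x) (xs x)))"
proof -
  have concat: "foldl (\<lambda>b a. b @ h a) b ys = b @ concat (map h ys)"
    for h :: "'b \<Rightarrow> 'c list" and b ys
    by (induction ys arbitrary: b) auto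
  obtain q where q: "\<And>e a. size_of (g e a) \<le> poly q (size_of e + size_of a)"
    using polytime_size2[OF g] by blast
  have "polytime (\<lambda>p :: 'a \<times> 'c list \<times> 'b. g (fst p) (snd (snd p)))"
    by (rule polytime_comp2[OF g]) (intro polytime_intros)+
  then have "polytime (\<lambda>x. foldl (\<lambda>b a. b @ g x a) [] (xs x))"
    by (intro polytime_foldl_additive[where B = q and f = "\<lambda>x b a. b @ g x a"]
        polytime_intros xs)
      (use q in auto)
  then show ?thesis by (simp add: concat)
qed

lemma polytime_map [polytime_intros]:
  fixes g :: "'a::encodable \<Rightarrow> 'b::encodable \<Rightarrow> 'c::encodable"
  assumes "polytime (\<lambda>p. g (fst p) (snd p))" and "polytime xs"
  shows "polytime (\<lambda>x. map (g x) (xs x))"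
  using polytime_concat_map[of "\<lambda>x a. [g x a]" xs] assms
  by (simp add: polytime_intros)

lemma polytime_concat [polytime_intros]:
  fixes f :: "'a::encodable \<Rightarrow> 'b::encodable list list"
  shows "polytime f \<Longrightarrow> polytime (\<lambda>x. concat (f x))"
  using polytime_concat_map[of "\<lambda>x a. a" f] by (simp add: polytime_intros)

text \<open>As the list is fixed, its elements need not be encodable.\<close>

lemma polytime_concat_map_const:
  assumes "\<And>e. e \<in> set es \<Longrightarrow> polytime (g e)"
  shows "polytime (\<lambda>x. concat (map (\<lambda>e. g e x) es))"
  using assms
proof (induction es)
  case (Cons e es)
  then have "polytime (\<lambda>x. g e x @ concat (map (\<lambda>e. g e x) es))" by (intro polytime_append) auto
  then show ?case by simp
qed (simp add: polytime_const)

lemma polytime_map_const: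
  assumes "\<And>e. e \<in> set es \<Longrightarrow> polytime (g e)"
  shows "polytime (\<lambda>x. map (\<lambda>e. g e x) es)"
  using polytime_concat_map_const[of es "\<lambda>e x. [g e x]"] assms
  by (simp add: polytime_intros)

lemma polytime_filter [polytime_intros]:
  fixes P :: "'a::encodable \<Rightarrow> 'b::encodable \<Rightarrow> bool"
  assumes "polytime (\<lambda>p. P (fst p) (snd p))" and "polytime xs"
  shows "polytime (\<lambda>x. filter (P x) (xs x))"
proof -
  have "filter h ys = concat (map (\<lambda>a. if h a then [a] else []) ys)" for h :: "'b \<Rightarrow> bool" and ys
    by (induction ys) auto
  then show ?thesis
    using polytime_concat_map[of "\<lambda>x a. if P x a then [a] else []" xs] assms
    by (simp add: polytime_intros)
qed

lemma polytime_ball [polytime_intros]: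
  fixes P :: "'a::encodable \<Rightarrow> 'b::encodable \<Rightarrow> bool"
  assumes "polytime (\<lambda>p. P (fst p) (snd p))" and "polytime xs"
  shows "polytime (\<lambda>x. \<forall>a\<in>set (xs x). P x a)"
  using polytime_eq_Nil[OF polytime_filter[of "\<lambda>x a. \<not> P x a" xs]] assms
  by (simp add: polytime_intros filter_empty_conv)

lemma polytime_bex [polytime_intros]:
  fixes P :: "'a::encodable \<Rightarrow> 'b::encodable \<Rightarrow> bool"
  assumes "polytime (\<lambda>p. P (fst p) (snd p))" and "polytime xs"
  shows "polytime (\<lambda>x. \<exists>a\<in>set (xs x). P x a)"
  using polytime_not[OF polytime_ball[of "\<lambda>x a. \<not> P x a" xs]] assms
  by (simp add: polytime_intros)

lemma polytime_length [polytime_intros]: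
  fixes f :: "'a::encodable \<Rightarrow> 'b::encodable list"
  assumes "polytime f"
  shows "polytime (\<lambda>x. length (f x))"
proof -
  have "foldl (\<lambda>n a. Suc n) m ys = m + length ys" for m and ys :: "'b list"
    by (induction ys arbitrary: m) auto
  moreover have "polytime (\<lambda>x. foldl (\<lambda>n a. Suc n) 0 (f x))"
    by (rule polytime_foldl_additive[where B = 1 and f = "\<lambda>x n a. Suc n"])
      (auto intro!: polytime_intros assms)
  ultimately show ?thesis by simp
qed

lemma polytime_minus [polytime_intros]:
  assumes "polytime f" "polytime g"
  shows "polytime (\<lambda>x. f x - g x :: nat)"
proof -
  have "((\<lambda>m. m - 1) ^^ n) m = m - n" for m n :: nat
    by (induction n) auto
  moreover have "polytime (\<lambda>m :: nat. m - 1)"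
    by (rule polytime_tl_code) (simp add: code_nat_def)
  moreover obtain B where "\<And>x. f x \<le> poly B (size_of x)"
    using polytime_size[OF assms(1)] by (metis size_nat)
  then have "f x - i \<le> poly B (size_of x)" for x i
    by (meson diff_le_self le_trans)
  ultimately show ?thesis
    using polytime_funpow_size[of "\<lambda>m. m - 1" f g B] assms by simp
qed

lemma polytime_drop [polytime_intros]:
  fixes g :: "'a::encodable \<Rightarrow> 'b::encodable list"
  assumes "polytime f" "polytime g"
  shows "polytime (\<lambda>x. drop (f x) (g x))"
proof -
  have "(tl ^^ n) xs = drop n xs" for n and xs :: "'b list"
    by (induction n) (auto simp: drop_Suc tl_drop)
  moreover have "polytime (tl :: 'b list \<Rightarrow> 'b list)"
    by (intro polytime_intros)
  moreover obtain B where "\<And>x. size_of (g x) \<le> poly B (size_of x)"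
    using polytime_size[OF assms(2)] by metis
  then have "size_of (drop i (g x)) \<le> poly B (size_of x)" for x i
    using size_drop_le le_trans by blast
  ultimately show ?thesis
    using polytime_funpow_size[of tl g f B] assms by simp
qed

text \<open>Beyond the end of the list, \<^term>\<open>xs ! i\<close> is an unknown function of \<^term>\<open>i\<close>, which need not be
  computable; this one is constant there.\<close>

definition entry :: "'a list \<Rightarrow> nat \<Rightarrow> 'a" where
  "entry xs i = hd (drop i xs)"

lemma entry_eq_nth [simp]: "i < length xs \<Longrightarrow> entry xs i = xs ! i"
  by (simp add: entry_def hd_drop_conv_nth)

lemma polytime_entry [polytime_intros]:
  "polytime f \<Longrightarrow> polytime g \<Longrightarrow> polytime (\<lambda>x. entry (f x) (g x))"
  unfolding entry_def by (intro polytime_intros)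

lemma polytime_le [polytime_intros]:
  "polytime f \<Longrightarrow> polytime g \<Longrightarrow> polytime (\<lambda>x. f x \<le> (g x :: nat))"
  using polytime_eq_0[OF polytime_minus, of f g] by simp

lemma polytime_less [polytime_intros]:
  "polytime f \<Longrightarrow> polytime g \<Longrightarrow> polytime (\<lambda>x. f x < (g x :: nat))"
  using polytime_le[OF polytime_Suc, of f g] by (simp add: Suc_le_eq)

lemma polytime_replicate [polytime_intros]:
  assumes "polytime f" "polytime g"
  shows "polytime (\<lambda>x. replicate (f x) (g x))"
proof -
  have "polytime (\<lambda>x. map (\<lambda>_. g x) (code (f x)))"
    by (intro polytime_intros polytime_comp[OF assms(2)] assms(1))
  then show ?thesis by (simp add: map_replicate_const)
qed

lemma polytime_mult [polytime_intros]:
  fixes f g :: "'a::encodable \<Rightarrow> nat"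
  assumes "polytime f" "polytime g"
  shows "polytime (\<lambda>x. f x * g x)"
proof -
  have "polytime (\<lambda>x. length (concat (replicate (f x) (code (g x)))))"
    by (intro polytime_intros assms)
  then show ?thesis by (simp add: length_concat sum_list_replicate)
qed

lemma polytime_poly [polytime_intros]: "polytime f \<Longrightarrow> polytime (\<lambda>x. poly p (f x) :: nat)"
proof (induction p)
  case (pCons a p)
  have "polytime (\<lambda>x. a + f x * poly p (f x))" by (intro polytime_intros pCons)
  then show ?case by simp
qed (simp add: polytime_const)

lemma polytime_upt [polytime_intros]:
  assumes "polytime f"
  shows "polytime (\<lambda>x. [0..<f x])"
proof -
  have upt: "foldl (\<lambda>ns a. ns @ [length ns]) [] ys = [0..<length ys]" for ys :: "bool list"
    by (induction ys rule: rev_induct) auto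
  have size: "size_of [0..<n] = n * n" for n by (induction n) auto
  obtain q where q: "\<And>x. f x \<le> poly q (size_of x)"
    using polytime_size[OF assms] by (metis size_nat)
  have "polytime (\<lambda>x. foldl (\<lambda>ns a. ns @ [length ns]) [] (code (f x)))"
  proof (rule polytime_foldl[where B = "q * q" and f = "\<lambda>x ns a. ns @ [length ns]"])
    fix x i
    have "min (f x) i * min (f x) i \<le> poly q (size_of x) * poly q (size_of x)"
      using q[of x] by (intro mult_le_mono) auto
    then show "size_of (foldl (\<lambda>ns a. ns @ [length ns]) [] (take i (code (f x))))
        \<le> poly (q * q) (size_of x)"
      by (simp only: upt size length_take size_nat poly_mult)
  qed (intro polytime_intros assms)+
  then show ?thesis by (simp add: upt)
qed

lemma polytime_eq [polytime_intros]:
  assumes "polytime f" "polytime g"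
  shows "polytime (\<lambda>x. f x = g x)"
proof -
  let ?f = "\<lambda>x. code (f x)" and ?g = "\<lambda>x. code (g x)"
  have "polytime (\<lambda>x. length (?f x) \<le> length (?g x) \<and> length (?g x) \<le> length (?f x) \<and>
      (\<forall>i\<in>set [0..<length (?f x)]. entry (?f x) i = entry (?g x) i))"
    by (intro polytime_intros polytime_eq_bool polytime_comp[OF assms(1)]
        polytime_comp[OF assms(2)] assms)
  moreover have "length u \<le> length v \<and> length v \<le> length u \<and>
      (\<forall>i\<in>set [0..<length u]. entry u i = entry v i) \<longleftrightarrow> u = v" for u v :: "bool list"
    by (auto intro: nth_equalityI)
  ultimately show ?thesis by (simp add: code_inject)
qed

lemma polytime_mem [polytime_intros]:
  assumes "polytime f" "polytime g"
  shows "polytime (\<lambda>x. f x \<in> set (g x))"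
proof -
  have "polytime (\<lambda>x. \<exists>a\<in>set (g x). f x = a)"
    by (intro polytime_intros polytime_comp[OF assms(1)] assms(2))
  then show ?thesis by simp
qed

lemma polytime_remdups [polytime_intros]:
  fixes f :: "'a::encodable \<Rightarrow> 'b::encodable list"
  assumes "polytime f"
  shows "polytime (\<lambda>x. remdups (f x))"
proof -
  let ?step = "\<lambda>ys a. if a \<in> set ys then ys else a # ys"
  have "polytime (\<lambda>x. foldl (\<lambda>ys a. a # ys) [] (f x))"
    by (rule polytime_foldl_additive[where B = "[:1, 2:]" and f = "\<lambda>x ys a. a # ys"])
      (auto intro!: polytime_intros assms)
  then have "polytime (\<lambda>x. rev (f x))"
    by (simp add: foldl_conv_fold fold_Cons_rev)
  then have "polytime (\<lambda>x. foldl ?step [] (rev (f x)))"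
    by (intro polytime_foldl_additive[where B = "[:1, 2:]" and f = "\<lambda>x. ?step"])
      (auto intro!: polytime_intros)
  moreover have "foldl ?step [] (rev ys) = remdups ys" for ys :: "'b list"
    by (induction ys) auto
  ultimately show ?thesis by simp
qed

lemma polytime_distinct [polytime_intros]:
  assumes "polytime f"
  shows "polytime (\<lambda>x. distinct (f x))"
proof -
  have "polytime (\<lambda>x. remdups (f x) = f x)" by (intro polytime_intros assms)
  then show ?thesis by simp
qed

section \<open>From satisfiability to NAE-3SAT-KS\<close>

definition models :: "('v \<Rightarrow> bool) \<Rightarrow> 'v clause list \<Rightarrow> bool" where
  "models \<tau> \<phi> \<longleftrightarrow> (\<forall>c\<in>set \<phi>. \<exists>l\<in>set c. lit_true \<tau> l)"

definition cnf_sat :: "'v clause list \<Rightarrow> bool" where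
  "cnf_sat \<phi> \<longleftrightarrow> (\<exists>\<tau>. models \<tau> \<phi>)"

definition nae :: "('v \<Rightarrow> bool) \<Rightarrow> 'v clause \<Rightarrow> bool" where
  "nae \<tau> c \<longleftrightarrow> (\<exists>l\<in>set c. lit_true \<tau> l) \<and> (\<exists>l\<in>set c. \<not> lit_true \<tau> l)"

lemma NAE_satisfiable_iff_nae: "NAE_satisfiable C \<longleftrightarrow> (\<exists>\<tau>. \<forall>c\<in>set C. nae \<tau> c)"
  by (simp add: NAE_satisfiable_def nae_def)

lemma lit_true_complement: "lit_true (\<lambda>v. \<not> \<tau> v) l \<longleftrightarrow> \<not> lit_true \<tau> l"
  by (cases l) auto

lemma nae_complement: "nae (\<lambda>v. \<not> \<tau> v) c \<longleftrightarrow> nae \<tau> c"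
  by (auto simp: nae_def lit_true_complement)

lemma var_map_literal [simp]: "var (map_literal f l) = f (var l)"
  by (cases l) auto

lemma lit_true_map_literal [simp]: "lit_true \<tau> (map_literal f l) \<longleftrightarrow> lit_true (\<lambda>v. \<tau> (f v)) l"
  by (cases l) auto

subsection \<open>Not-all-equal triples\<close>

datatype 'v nae_var = Falsum | Orig 'v | Link nat nat

instantiation nae_var :: (encodable) encodable
begin
fun code_nae_var :: "'a nae_var \<Rightarrow> bool list" where
  "code_nae_var Falsum = [False]"
| "code_nae_var (Orig v) = [True, False] @ code v"
| "code_nae_var (Link k i) = [True, True] @ code (k, i)"
instance
proof
  show "code x = code y \<longleftrightarrow> x = y" for x y :: "'a nae_var"
    by (cases x; cases y) (auto simp: code_inject)
qed
end

lemma polytime_Orig [polytime_intros]: "polytime f \<Longrightarrow> polytime (\<lambda>x. Orig (f x))"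
  by (rule polytime_comp[OF polytime_prefix]) auto

lemma polytime_Link [polytime_intros]:
  "polytime f \<Longrightarrow> polytime g \<Longrightarrow> polytime (\<lambda>x. Link (f x) (g x) :: 'v::encodable nae_var)"
  by (rule polytime_comp2[OF polytime_prefix]) auto

text \<open>With \<^const>\<open>Falsum\<close> false, the variable \<^term>\<open>Link k i\<close> says that clause \<^term>\<open>k\<close> still
  has to be satisfied by one of its literals from position \<^term>\<open>i\<close> on.\<close>

definition triples :: "nat \<Rightarrow> 'v clause \<Rightarrow> 'v nae_var clause list" where
  "triples k c =
     [Pos (Link k 0), Pos Falsum, Pos Falsum] #
     [Neg (Link k (length c)), Pos Falsum, Pos Falsum] #
     map (\<lambda>i. [Neg (Link k i), map_literal Orig (entry c i), Pos (Link k (Suc i))]) [0..<length c]"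

definition nae3 :: "'v clause list \<Rightarrow> 'v nae_var clause list" where
  "nae3 \<phi> = concat (map (\<lambda>k. triples k (entry \<phi> k)) [0..<length \<phi>])"

lemma length_nae3: "c \<in> set (nae3 \<phi>) \<Longrightarrow> length c = 3"
  by (auto simp: nae3_def triples_def)

lemma triples_sound:
  assumes "\<not> \<tau> Falsum" and triples: "\<forall>t\<in>set (triples k c). nae \<tau> t"
  shows "\<exists>l\<in>set c. lit_true (\<lambda>v. \<tau> (Orig v)) l"
proof (rule ccontr)
  assume none: "\<not> ?thesis"
  have "i \<le> length c \<Longrightarrow> \<tau> (Link k i)" for i
  proof (induction i)
    case 0
    then show ?case using assms by (simp add: triples_def nae_def)
  next
    case (Suc i)
    then have "nae \<tau> [Neg (Link k i), map_literal Orig (c ! i), Pos (Link k (Suc i))]"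
      using triples by (simp add: triples_def)
    then show ?case using Suc none by (auto simp: nae_def)
  qed
  moreover have "\<not> \<tau> (Link k (length c))"
    using assms by (simp add: triples_def nae_def)
  ultimately show False by blast
qed

lemma triples_complete:
  assumes "\<not> \<tau> Falsum" and sat: "\<exists>l\<in>set c. lit_true (\<lambda>v. \<tau> (Orig v)) l"
    and Link: "\<And>i. \<tau> (Link k i) \<longleftrightarrow> (\<forall>l\<in>set (take i c). \<not> lit_true (\<lambda>v. \<tau> (Orig v)) l)"
    and t: "t \<in> set (triples k c)"
  shows "nae \<tau> t"
proof -
  have "nae \<tau> [Neg (Link k i), map_literal Orig (c ! i), Pos (Link k (Suc i))]"
    if "i < length c" for i
    using that by (auto simp: nae_def Link take_Suc_conv_app_nth)
  then show ?thesis using t assms(1) sat by (auto simp: triples_def nae_def Link)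
qed

fun nae3_assignment :: "('v \<Rightarrow> bool) \<Rightarrow> 'v clause list \<Rightarrow> 'v nae_var \<Rightarrow> bool" where
  "nae3_assignment \<tau> \<phi> Falsum \<longleftrightarrow> False"
| "nae3_assignment \<tau> \<phi> (Orig v) \<longleftrightarrow> \<tau> v"
| "nae3_assignment \<tau> \<phi> (Link k i) \<longleftrightarrow> (\<forall>l\<in>set (take i (\<phi> ! k)). \<not> lit_true \<tau> l)"

lemma NAE_satisfiable_nae3: "NAE_satisfiable (nae3 \<phi>) \<longleftrightarrow> cnf_sat \<phi>"
proof
  assume "NAE_satisfiable (nae3 \<phi>)"
  then obtain \<tau> where \<tau>: "\<forall>c\<in>set (nae3 \<phi>). nae \<tau> c"
    unfolding NAE_satisfiable_iff_nae by blast
  define \<tau>' where "\<tau>' = (if \<tau> Falsum then (\<lambda>v. \<not> \<tau> v) else \<tau>)"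
  have "\<not> \<tau>' Falsum" and "\<forall>c\<in>set (nae3 \<phi>). nae \<tau>' c"
    using \<tau> by (simp_all add: \<tau>'_def nae_complement)
  then have "\<exists>l\<in>set (\<phi> ! k). lit_true (\<lambda>v. \<tau>' (Orig v)) l" if "k < length \<phi>" for k
    using that by (intro triples_sound[of \<tau>' k]) (auto simp: nae3_def)
  then have "models (\<lambda>v. \<tau>' (Orig v)) \<phi>"
    by (auto simp: models_def in_set_conv_nth)
  then show "cnf_sat \<phi>" unfolding cnf_sat_def by blast
next
  assume "cnf_sat \<phi>"
  then obtain \<tau> where "models \<tau> \<phi>" unfolding cnf_sat_def by blast
  then have "nae (nae3_assignment \<tau> \<phi>) t" if "t \<in> set (triples k (\<phi> ! k))" "k < length \<phi>" for k t
    using that by (intro triples_complete[of _ "\<phi> ! k" k t]) (auto simp: models_def)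
  then have "\<forall>c\<in>set (nae3 \<phi>). nae (nae3_assignment \<tau> \<phi>) c" by (auto simp: nae3_def)
  then show "NAE_satisfiable (nae3 \<phi>)" unfolding NAE_satisfiable_iff_nae by blast
qed

lemma polytime_nae3 [polytime_intros]: "polytime f \<Longrightarrow> polytime (\<lambda>x. nae3 (f x))"
  unfolding nae3_def triples_def by (rule polytime_comp) (intro polytime_intros)

subsection \<open>Bounding the occurrences of literals\<close>

text \<open>Every variable gets one block for each position at which a literal may occur. The clauses of
  a block, together with those of the next block in the ring, force its variables \<^term>\<open>Va\<close>,
  \<^term>\<open>Vb\<close> and \<^term>\<open>Vc\<close> to agree with \<^term>\<open>Vb\<close> of the next block. The name of a clause
  tells which two of these variables it relates, with \<open>n\<close> standing for \<^term>\<open>Vb\<close> of the next block.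
  Each block offers the unused slots \<^term>\<open>Pos (b, Vc)\<close> and \<^term>\<open>Neg (b, Va)\<close>.\<close>

datatype role = Va | Vb | Vc | Vy | Vz

datatype edge = Eab | Ebc | Eca | Ecn | Ean

definition roles :: "role list" where "roles = [Va, Vb, Vc, Vy, Vz]"
definition edges :: "edge list" where "edges = [Eab, Ebc, Eca, Ecn, Ean]"

lemma set_roles [simp]: "set roles = UNIV"
  unfolding roles_def using role.exhaust by auto

lemma set_edges [simp]: "set edges = UNIV"
  unfolding edges_def using edge.exhaust by auto

lemma distinct_roles [simp]: "distinct roles" and distinct_edges [simp]: "distinct edges"
  by (simp_all add: roles_def edges_def)

type_synonym 'w block = "'w \<times> nat"
type_synonym 'w block_var = "'w block \<times> role"

fun ring_clause :: "'w block \<Rightarrow> 'w block \<Rightarrow> edge \<Rightarrow> 'w block_var clause" where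
  "ring_clause b b' Eab = [Pos (b, Va), Neg (b, Vb), Pos (b, Vz)]"
| "ring_clause b b' Ebc = [Pos (b, Vb), Neg (b, Vc), Pos (b, Vz)]"
| "ring_clause b b' Eca = [Neg (b, Vc), Pos (b, Va), Neg (b, Vz)]"
| "ring_clause b b' Ecn = [Pos (b, Vc), Neg (b', Vb), Pos (b, Vy)]"
| "ring_clause b b' Ean = [Neg (b, Va), Pos (b', Vb), Pos (b, Vy)]"

definition slot :: "'w literal \<Rightarrow> nat \<Rightarrow> 'w block_var literal" where
  "slot l n = (if is_Pos l then Pos ((var l, n), Vc) else Neg ((var l, n), Va))"

definition main_clause :: "nat \<Rightarrow> 'w clause \<Rightarrow> 'w block_var clause" where
  "main_clause i c = map (\<lambda>p. slot (entry c p) (3 * i + p)) [0..<3]"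

definition next_block :: "nat \<Rightarrow> 'w block \<Rightarrow> 'w block" where
  "next_block N b = (fst b, if Suc (snd b) = N then 0 else Suc (snd b))"

definition prev_block :: "nat \<Rightarrow> 'w block \<Rightarrow> 'w block" where
  "prev_block N b = (fst b, if snd b = 0 then N - 1 else snd b - 1)"

definition vars_of :: "'w clause list \<Rightarrow> 'w list" where
  "vars_of ts = remdups (map var (concat ts))"

definition blocks :: "'w clause list \<Rightarrow> 'w block list" where
  "blocks ts = List.product (vars_of ts) [0..<3 * length ts]"

definition ks_vars :: "'w clause list \<Rightarrow> 'w block_var list" where
  "ks_vars ts = List.product (blocks ts) roles"

datatype 'w key = Ring "'w block" edge | Main nat

fun clause_at :: "'w clause list \<Rightarrow> 'w key \<Rightarrow> 'w block_var clause" where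
  "clause_at ts (Ring b e) = ring_clause b (next_block (3 * length ts) b) e"
| "clause_at ts (Main i) = main_clause i (entry ts i)"

definition keys :: "'w clause list \<Rightarrow> 'w key list" where
  "keys ts = concat (map (\<lambda>b. map (Ring b) edges) (blocks ts)) @
     map Main [0..<length ts]"

definition ks_clauses :: "'w clause list \<Rightarrow> 'w block_var clause list" where
  "ks_clauses ts = map (clause_at ts) (keys ts)"

lemma set_blocks: "b \<in> set (blocks ts) \<longleftrightarrow> fst b \<in> set (vars_of ts) \<and> snd b < 3 * length ts"
  by (cases b) (auto simp: blocks_def)

lemma set_ks_vars: "v \<in> set (ks_vars ts) \<longleftrightarrow> fst v \<in> set (blocks ts)"
  by (cases v) (simp add: ks_vars_def)

lemma Ring_in_keys_iff [simp]: "Ring b e \<in> set (keys ts) \<longleftrightarrow> b \<in> set (blocks ts)"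
  and Main_in_keys_iff [simp]: "Main i \<in> set (keys ts) \<longleftrightarrow> i < length ts"
  by (auto simp: keys_def)

lemma distinct_ks_vars: "distinct (ks_vars ts)"
  by (simp add: ks_vars_def blocks_def vars_of_def distinct_product)

lemma distinct_concat_map:
  assumes "distinct xs" "\<And>x. x \<in> set xs \<Longrightarrow> distinct (f x)"
    and "\<And>x y. x \<in> set xs \<Longrightarrow> y \<in> set xs \<Longrightarrow> x \<noteq> y \<Longrightarrow> set (f x) \<inter> set (f y) = {}"
  shows "distinct (concat (map f xs))"
  using assms by (induction xs) auto

lemma distinct_keys: "distinct (keys ts)"
proof -
  have "distinct (blocks ts)" by (simp add: blocks_def vars_of_def distinct_product)
  then show ?thesis
    unfolding keys_def by (auto intro!: distinct_concat_map simp: distinct_map inj_on_def)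
qed

lemma next_block_in_blocks:
  "b \<in> set (blocks ts) \<Longrightarrow> next_block (3 * length ts) b \<in> set (blocks ts)"
  by (auto simp: set_blocks next_block_def)

lemma prev_block_in_blocks:
  "b \<in> set (blocks ts) \<Longrightarrow> prev_block (3 * length ts) b \<in> set (blocks ts)"
  by (auto simp: set_blocks prev_block_def)

lemma prev_next_block: "snd b < N \<Longrightarrow> prev_block N (next_block N b) = b"
  by (cases b) (auto simp: next_block_def prev_block_def)

lemma next_prev_block: "snd b < N \<Longrightarrow> next_block N (prev_block N b) = b"
  by (cases b) (auto simp: next_block_def prev_block_def)

text \<open>A table of the clauses that contain a literal, from which both the number of occurrences and
  the intersections of clauses can be read off.\<close>

fun keys_of :: "nat \<Rightarrow> 'w block_var literal \<Rightarrow> 'w key set" where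
  "keys_of N (Pos (b, Va)) = {Ring b Eab, Ring b Eca}"
| "keys_of N (Neg (b, Va)) = {Ring b Ean, Main (snd b div 3)}"
| "keys_of N (Pos (b, Vb)) = {Ring b Ebc, Ring (prev_block N b) Ean}"
| "keys_of N (Neg (b, Vb)) = {Ring b Eab, Ring (prev_block N b) Ecn}"
| "keys_of N (Pos (b, Vc)) = {Ring b Ecn, Main (snd b div 3)}"
| "keys_of N (Neg (b, Vc)) = {Ring b Ebc, Ring b Eca}"
| "keys_of N (Pos (b, Vy)) = {Ring b Ecn, Ring b Ean}"
| "keys_of N (Neg (b, Vy)) = {}"
| "keys_of N (Pos (b, Vz)) = {Ring b Eab, Ring b Ebc}"
| "keys_of N (Neg (b, Vz)) = {Ring b Eca}"

lemma card_keys_of_le: "card (keys_of N l) \<le> 2" and finite_keys_of: "finite (keys_of N l)"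
  by (cases "(N, l)" rule: keys_of.cases; simp add: card_insert_if)+

lemma literal_eqI_keys_of:
  assumes "k \<noteq> k'" "{k, k'} \<subseteq> keys_of N l" "{k, k'} \<subseteq> keys_of N l'"
  shows "l = l'"
  using assms
  by (cases "(N, l)" rule: keys_of.cases; cases "(N, l')" rule: keys_of.cases) auto

lemma key_in_keys_of:
  assumes "k \<in> set (keys ts)" "l \<in> set (clause_at ts k)"
  shows "k \<in> keys_of (3 * length ts) l"
proof (cases k)
  case (Ring b e)
  then have "snd b < 3 * length ts" using assms(1) by (auto simp: set_blocks)
  then show ?thesis using assms(2) Ring by (cases e) (auto simp: prev_next_block)
next
  case (Main i)
  then obtain p where "l = slot (entry (entry ts i) p) (3 * i + p)" "p < 3"
    using assms(2) by (auto simp: main_clause_def)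
  then show ?thesis using Main by (auto simp: slot_def)
qed

lemma occurrences_map:
  assumes "distinct ks"
  shows "occurrences (map f ks) l = card {k \<in> set ks. l \<in> set (f k)}"
proof -
  have "occurrences (map f ks) l = length (filter (\<lambda>c. l \<in> set c) (map f ks))"
    by (simp add: occurrences_def length_filter_conv_card)
  also have "\<dots> = length (filter (\<lambda>k. l \<in> set (f k)) ks)"
    by (simp add: filter_map comp_def)
  also have "\<dots> = card {k \<in> set ks. l \<in> set (f k)}"
    using assms by (simp flip: distinct_card)
  finally show ?thesis .
qed

lemma occurrences_ks_clauses:
  "occurrences (ks_clauses ts) l = card {k \<in> set (keys ts). l \<in> set (clause_at ts k)}"
  unfolding ks_clauses_def by (rule occurrences_map[OF distinct_keys])

lemma occurrences_ks_clauses_le: "occurrences (ks_clauses ts) l \<le> 2"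
proof -
  have "occurrences (ks_clauses ts) l \<le> card (keys_of (3 * length ts) l)"
    unfolding occurrences_ks_clauses
    by (rule card_mono[OF finite_keys_of]) (auto intro: key_in_keys_of)
  also note card_keys_of_le
  finally show ?thesis .
qed

lemma occurrences_ks_clauses_eq:
  assumes "b \<in> set (blocks ts)"
  shows "occurrences (ks_clauses ts) (Pos (b, r)) = 2 \<or>
    occurrences (ks_clauses ts) (Neg (b, r)) = 2"
proof -
  let ?N = "3 * length ts"
  have two: "occurrences (ks_clauses ts) l = 2"
    if "{k, k'} \<subseteq> set (keys ts)" "l \<in> set (clause_at ts k)" "l \<in> set (clause_at ts k')" "k \<noteq> k'"
    for k k' l
  proof -
    have "card {k, k'} \<le> occurrences (ks_clauses ts) l"
      unfolding occurrences_ks_clauses by (rule card_mono) (use that in auto)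
    then show ?thesis using occurrences_ks_clauses_le[of ts l] that(4) by simp
  qed
  have keys: "Ring b e \<in> set (keys ts)" "Ring (prev_block ?N b) e \<in> set (keys ts)" for e
    using assms prev_block_in_blocks[OF assms] by simp_all
  have "next_block ?N (prev_block ?N b) = b"
    using assms by (simp add: next_prev_block set_blocks)
  then show ?thesis
    using keys two[of "Ring b Eab" "Ring b Eca" "Pos (b, Va)"]
      two[of "Ring b Ebc" "Ring (prev_block ?N b) Ean" "Pos (b, Vb)"]
      two[of "Ring b Ebc" "Ring b Eca" "Neg (b, Vc)"]
      two[of "Ring b Ecn" "Ring b Ean" "Pos (b, Vy)"]
      two[of "Ring b Eab" "Ring b Ebc" "Pos (b, Vz)"]
    by (cases r) auto
qed

lemma card_inter_ks_clauses_le: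
  assumes "i < length (ks_clauses ts)" "j < length (ks_clauses ts)" "i \<noteq> j"
  shows "card (set (ks_clauses ts ! i) \<inter> set (ks_clauses ts ! j)) \<le> 1"
proof -
  let ?k = "keys ts ! i" and ?k' = "keys ts ! j"
  let ?I = "set (ks_clauses ts ! i) \<inter> set (ks_clauses ts ! j)"
  have ij: "i < length (keys ts)" "j < length (keys ts)"
    using assms by (simp_all add: ks_clauses_def)
  have neq: "?k \<noteq> ?k'"
    using assms(3) ij by (simp add: nth_eq_iff_index_eq distinct_keys)
  have in_both: "{?k, ?k'} \<subseteq> keys_of (3 * length ts) l" if "l \<in> ?I" for l
    using that ij key_in_keys_of[of ?k ts l] key_in_keys_of[of ?k' ts l]
    by (simp add: ks_clauses_def)
  have "l = l'" if "l \<in> ?I" "l' \<in> ?I" for l l'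
    using literal_eqI_keys_of[OF neq in_both[OF that(1)] in_both[OF that(2)]] .
  then show ?thesis by (simp add: card_le_Suc0_iff_eq)
qed

lemma nae_ring_imp:
  assumes "\<And>e. nae \<tau> (ring_clause b b' e)"
  shows "\<tau> (b, Va) = \<tau> (b', Vb)" "\<tau> (b, Vb) = \<tau> (b', Vb)" "\<tau> (b, Vc) = \<tau> (b', Vb)"
  using assms[of Eab] assms[of Ebc] assms[of Eca] assms[of Ecn] assms[of Ean]
  by (auto simp: nae_def)

lemma nae_ring_const: "nae (\<lambda>((w, n), r). \<tau> w) (ring_clause b (next_block N b) e)"
  by (cases b; cases e) (auto simp: nae_def next_block_def)

lemma nae_rings_agree:
  assumes rings: "\<And>n e. n < N \<Longrightarrow> nae \<tau> (ring_clause (w, n) (next_block N (w, n)) e)"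
    and n: "n < N"
  shows "\<tau> ((w, n), Va) = \<tau> ((w, 0), Vb)" "\<tau> ((w, n), Vc) = \<tau> ((w, 0), Vb)"
proof -
  note ring = nae_ring_imp[OF rings]
  have "m < N \<Longrightarrow> \<tau> ((w, m), Vb) = \<tau> ((w, 0), Vb)" for m
  proof (induction m)
    case (Suc m)
    then have "next_block N (w, m) = (w, Suc m)" by (simp add: next_block_def)
    then show ?case using ring(2)[of m] Suc by simp
  qed simp
  from this[OF n] show "\<tau> ((w, n), Va) = \<tau> ((w, 0), Vb)" "\<tau> ((w, n), Vc) = \<tau> ((w, 0), Vb)"
    using ring[OF n] by simp_all
qed

context
  fixes ts :: "'w clause list"
  assumes length3: "\<And>c. c \<in> set ts \<Longrightarrow> length c = 3"
begin

lemma length_nth: "i < length ts \<Longrightarrow> length (ts ! i) = 3"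
  by (simp add: length3)

lemma var_nth_in_vars_of: "i < length ts \<Longrightarrow> p < 3 \<Longrightarrow> var (ts ! i ! p) \<in> set (vars_of ts)"
  by (auto simp: vars_of_def length_nth intro!: imageI bexI[of _ "ts ! i"])

lemma main_clause_eq:
  "i < length ts \<Longrightarrow> main_clause i (ts ! i) = map (\<lambda>p. slot (ts ! i ! p) (3 * i + p)) [0..<3]"
  by (simp add: main_clause_def length_nth)

lemma var_clause_at:
  assumes "k \<in> set (keys ts)" "l \<in> set (clause_at ts k)"
  shows "var l \<in> set (ks_vars ts)"
proof (cases k)
  case (Ring b e)
  then have "b \<in> set (blocks ts)" using assms(1) by auto
  with assms(2) Ring next_block_in_blocks[OF this] show ?thesis
    by (cases e) (auto simp: set_ks_vars)
next
  case (Main i)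
  then obtain p where "p < 3" "i < length ts" "l = slot (ts ! i ! p) (3 * i + p)"
    using assms by (auto simp: main_clause_eq)
  then show ?thesis using var_nth_in_vars_of[of i p] by (auto simp: slot_def set_ks_vars set_blocks)
qed

lemma clause_at_shape:
  assumes "k \<in> set (keys ts)"
  shows "length (clause_at ts k) = 3 \<and> distinct (map var (clause_at ts k))"
proof (cases k)
  case (Ring b e)
  then show ?thesis by (cases e) auto
next
  case (Main i)
  then show ?thesis
    by (auto simp: main_clause_def slot_def comp_def distinct_map inj_on_def)
qed

lemma ks_instance: "NAE_3SAT_KS_instance (set (ks_vars ts)) (ks_clauses ts)"
  unfolding NAE_3SAT_KS_instance_def
proof (intro conjI ballI allI impI)
  show "var l \<in> set (ks_vars ts)" if "c \<in> set (ks_clauses ts)" "l \<in> set c" for c l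
    using that var_clause_at by (auto simp: ks_clauses_def)
  show "length c = 3" "distinct (map var c)" if "c \<in> set (ks_clauses ts)" for c
    using that clause_at_shape by (auto simp: ks_clauses_def)
  show "occurrences (ks_clauses ts) (Pos u) \<le> 2" "occurrences (ks_clauses ts) (Neg u) \<le> 2" for u
    by (rule occurrences_ks_clauses_le)+
  show "occurrences (ks_clauses ts) (Pos u) = 2 \<or> occurrences (ks_clauses ts) (Neg u) = 2"
    if "u \<in> set (ks_vars ts)" for u
    using that occurrences_ks_clauses_eq[of "fst u" ts "snd u"] by (simp add: set_ks_vars)
qed (rule card_inter_ks_clauses_le)

lemma nae_main_clause:
  assumes "i < length ts"
    and agree: "\<And>w n. (w, n) \<in> set (blocks ts) \<Longrightarrow> \<tau>' ((w, n), Va) = \<tau> w \<and> \<tau>' ((w, n), Vc) = \<tau> w"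
  shows "nae \<tau>' (main_clause i (ts ! i)) \<longleftrightarrow> nae \<tau> (ts ! i)"
proof -
  have "lit_true \<tau>' (slot (ts ! i ! p) (3 * i + p)) \<longleftrightarrow> lit_true \<tau> (ts ! i ! p)" if "p < 3" for p
    using agree[of "var (ts ! i ! p)" "3 * i + p"] var_nth_in_vars_of[OF assms(1) that]
      assms(1) that
    by (cases "ts ! i ! p") (auto simp: slot_def set_blocks)
  moreover have "set (ts ! i) = (\<lambda>p. ts ! i ! p) ` {0..<3}"
    using length_nth[OF assms(1)] by (auto simp: set_conv_nth)
  ultimately show ?thesis
    unfolding main_clause_eq[OF assms(1)] nae_def by simp
qed

lemma NAE_satisfiable_ks: "NAE_satisfiable (ks_clauses ts) \<longleftrightarrow> NAE_satisfiable ts"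
proof
  let ?N = "3 * length ts"
  assume "NAE_satisfiable (ks_clauses ts)"
  then obtain \<tau>' where \<tau>': "\<And>k. k \<in> set (keys ts) \<Longrightarrow> nae \<tau>' (clause_at ts k)"
    unfolding NAE_satisfiable_iff_nae ks_clauses_def by auto
  define \<tau> where "\<tau> w = \<tau>' ((w, 0), Vb)" for w
  have "\<tau>' ((w, n), Va) = \<tau> w \<and> \<tau>' ((w, n), Vc) = \<tau> w" if "(w, n) \<in> set (blocks ts)" for w n
  proof -
    have "nae \<tau>' (ring_clause (w, m) (next_block ?N (w, m)) e)" if "m < ?N" for m e
      using \<tau>'[of "Ring (w, m) e"] that \<open>(w, n) \<in> set (blocks ts)\<close> by (simp add: set_blocks)
    then show ?thesis
      unfolding \<tau>_def using nae_rings_agree[of ?N \<tau>' w n] that by (simp add: set_blocks)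
  qed
  then have "nae \<tau> (ts ! i)" if "i < length ts" for i
    using nae_main_clause[OF that, of \<tau>' \<tau>] \<tau>'[of "Main i"] that by simp
  then have "\<forall>c\<in>set ts. nae \<tau> c" by (metis in_set_conv_nth)
  then show "NAE_satisfiable ts" unfolding NAE_satisfiable_iff_nae by blast
next
  assume "NAE_satisfiable ts"
  then obtain \<tau> where \<tau>: "\<forall>c\<in>set ts. nae \<tau> c" unfolding NAE_satisfiable_iff_nae by blast
  let ?\<tau>' = "\<lambda>((w, n), r). \<tau> w"
  have "nae ?\<tau>' (clause_at ts k)" if "k \<in> set (keys ts)" for k
  proof (cases k)
    case (Ring b e)
    then show ?thesis by (simp add: nae_ring_const)
  next
    case (Main i)
    then show ?thesis using that \<tau> nae_main_clause[of i ?\<tau>' \<tau>] by auto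
  qed
  then show "NAE_satisfiable (ks_clauses ts)"
    unfolding NAE_satisfiable_iff_nae ks_clauses_def by auto
qed

end

instantiation role :: encodable
begin
fun code_role :: "role \<Rightarrow> bool list" where
  "code_role Va = []"
| "code_role Vb = [False]"
| "code_role Vc = [True]"
| "code_role Vy = [False, False]"
| "code_role Vz = [True, True]"
instance
proof
  show "code x = code y \<longleftrightarrow> x = y" for x y :: role
    by (cases x; cases y) auto
qed
end

lemma polytime_product [polytime_intros]:
  "polytime f \<Longrightarrow> polytime g \<Longrightarrow> polytime (\<lambda>x. List.product (f x) (g x))"
  by (rule polytime_comp2[of List.product])
    (unfold product_concat_map, intro polytime_intros)

lemma polytime_blocks [polytime_intros]: "polytime f \<Longrightarrow> polytime (\<lambda>x. blocks (f x))"
  unfolding blocks_def vars_of_def by (rule polytime_comp) (intro polytime_intros)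

lemma polytime_ks_vars [polytime_intros]: "polytime f \<Longrightarrow> polytime (\<lambda>x. ks_vars (f x))"
  unfolding ks_vars_def roles_def by (intro polytime_intros)

lemma polytime_ks_clauses [polytime_intros]:
  fixes f :: "'a::encodable \<Rightarrow> 'b::encodable clause list"
  shows "polytime f \<Longrightarrow> polytime (\<lambda>x. ks_clauses (f x))"
proof (rule polytime_comp[of ks_clauses])
  have ks_clauses: "ks_clauses = (\<lambda>ts :: 'b clause list.
      concat (map (\<lambda>b. map (ring_clause b (next_block (3 * length ts) b)) edges) (blocks ts)) @
      map (\<lambda>i. main_clause i (entry ts i)) [0..<length ts])"
    by (simp add: fun_eq_iff ks_clauses_def keys_def map_concat comp_def)
  show "polytime (ks_clauses :: 'b clause list \<Rightarrow> _)"
    unfolding ks_clauses main_clause_def slot_def next_block_def edges_def list.map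
      ring_clause.simps
    by (intro polytime_intros)
qed

subsection \<open>Renaming variables\<close>

abbreviation rename :: "('v \<Rightarrow> 'w) \<Rightarrow> 'v clause list \<Rightarrow> 'w clause list" where
  "rename f C \<equiv> map (map (map_literal f)) C"

lemma NAE_satisfiable_rename:
  assumes "inj f"
  shows "NAE_satisfiable (rename f C) \<longleftrightarrow> NAE_satisfiable C"
proof
  assume "NAE_satisfiable (rename f C)"
  then show "NAE_satisfiable C" by (auto simp: NAE_satisfiable_def)
next
  assume "NAE_satisfiable C"
  then obtain \<tau> where "\<forall>c\<in>set C. nae \<tau> c" unfolding NAE_satisfiable_iff_nae by blast
  then have "\<forall>c\<in>set (rename f C). nae (\<lambda>v. \<tau> (inv f v)) c"
    using assms by (simp add: nae_def)
  then show "NAE_satisfiable (rename f C)" unfolding NAE_satisfiable_iff_nae by blast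
qed

lemma occurrences_rename:
  assumes "inj f"
  shows "occurrences (rename f C) (map_literal f l) = occurrences C l"
proof -
  have "map_literal f l \<in> map_literal f ` A \<longleftrightarrow> l \<in> A" for A
    by (rule inj_image_mem_iff[OF literal.inj_map[OF assms]])
  then show ?thesis unfolding occurrences_def
    by (intro arg_cong[of _ _ card] Collect_cong) (simp cong: conj_cong)
qed

lemma NAE_3SAT_KS_instance_rename:
  assumes "inj f"
  shows "NAE_3SAT_KS_instance (f ` U) (rename f C) \<longleftrightarrow> NAE_3SAT_KS_instance U C"
proof -
  let ?m = "map_literal f"
  have inj: "inj ?m" by (rule literal.inj_map[OF assms])
  have occ: "occurrences (rename f C) (Pos (f u)) = occurrences C (Pos u)"
    "occurrences (rename f C) (Neg (f u)) = occurrences C (Neg u)" for u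
    using occurrences_rename[OF assms, of C "Pos u"] occurrences_rename[OF assms, of C "Neg u"]
    by simp_all
  have "card (set (rename f C ! i) \<inter> set (rename f C ! j)) = card (set (C ! i) \<inter> set (C ! j))"
    if "i < length C" "j < length C" for i j
  proof -
    have "set (rename f C ! i) \<inter> set (rename f C ! j) = ?m ` (set (C ! i) \<inter> set (C ! j))"
      using that by (simp add: image_Int[OF inj])
    then show ?thesis by (simp add: card_image[OF inj_on_subset[OF inj subset_UNIV]])
  qed
  then have inter: "(\<forall>i<length (rename f C). \<forall>j<length (rename f C). i \<noteq> j \<longrightarrow>
        card (set (rename f C ! i) \<inter> set (rename f C ! j)) \<le> 1) \<longleftrightarrow>
      (\<forall>i<length C. \<forall>j<length C. i \<noteq> j \<longrightarrow> card (set (C ! i) \<inter> set (C ! j)) \<le> 1)"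
    by simp
  have dist: "distinct (map var (map ?m c)) \<longleftrightarrow> distinct (map var c)" for c
  proof -
    have "map var (map ?m c) = map f (map var c)" by simp
    then show ?thesis
      using inj_on_subset[OF assms subset_UNIV] by (simp only: distinct_map[of f] simp_thms)
  qed
  show ?thesis
    unfolding NAE_3SAT_KS_instance_def inter
    by (simp add: occ dist[simplified] inj_image_mem_iff[OF assms])
qed

subsection \<open>Encoding instances whose variables are words\<close>

text \<open>A word is the binary expansion of a number unless its most significant bit is 0. Hence words,
  and with an additional bit 1 the codes of arbitrary values, can serve as variables.\<close>

lemma binary_pos: "n > 0 \<Longrightarrow> binary n = odd n # binary (n div 2)"
  by (cases n) auto

lemma binary_horner_sum: "binary (horner_sum of_bool 2 (w @ [True])) = w @ [True]"
proof (induction w)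
  case (Cons b w)
  have "horner_sum of_bool 2 (w @ [True]) > (0 :: nat)" by (induction w) auto
  then have "binary (horner_sum of_bool 2 ((b # w) @ [True])) =
      b # binary (horner_sum of_bool 2 (w @ [True]))"
    by (subst binary_pos) auto
  then show ?case using Cons by simp
qed (simp add: binary_pos)

lemma last_binary: "n > 0 \<Longrightarrow> last (binary n)"
proof (induction n rule: binary.induct[case_names zero Suc])
  case (Suc n)
  show ?case
  proof (cases "Suc n div 2 = 0")
    case True
    then have "n = 0" by auto
    then show ?thesis by simp
  next
    case False
    moreover from this have "binary (Suc n div 2) \<noteq> []" by (simp add: binary_pos)
    ultimately show ?thesis using Suc.IH by simp
  qed
qed simp

lemma range_binary_iff: "w \<in> range binary \<longleftrightarrow> w = [] \<or> entry w (length w - 1)"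
proof (cases w rule: rev_cases)
  case Nil
  then show ?thesis by (metis binary.simps(1) rangeI)
next
  case (snoc v b)
  have "v @ [b] \<in> range binary \<longleftrightarrow> b"
  proof
    assume "v @ [b] \<in> range binary"
    then obtain n where "v @ [b] = binary n" by blast
    moreover from this have "n > 0" by (cases n) auto
    ultimately show b using last_binary[of n] by (metis last_snoc)
  next
    assume b
    then show "v @ [b] \<in> range binary" using binary_horner_sum[of v] by (metis rangeI)
  qed
  then show ?thesis using snoc by (simp add: nth_append)
qed

lemma inj_binary: "inj binary"
  by (simp add: inj_def binary_inject)

definition enc_word_literal :: "bool list literal \<Rightarrow> bool list" where
  "enc_word_literal l = is_Pos l # enc_bits (var l)"

definition enc_word_instance :: "bool list list \<Rightarrow> bool list clause list \<Rightarrow> bool list" where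
  "enc_word_instance U C = enc_list enc_bits U @ enc_list (enc_list enc_word_literal) C"

lemma enc_list_map: "enc_list f (map g xs) = enc_list (\<lambda>x. f (g x)) xs"
  by (simp add: enc_list_def comp_def)

lemma enc_instance_eq_enc_word_instance:
  "enc_instance U C = enc_word_instance (map binary U) (rename binary C)"
proof -
  have "enc_literal = (\<lambda>l. enc_word_literal (map_literal binary l))"
  proof
    show "enc_literal l = enc_word_literal (map_literal binary l)" for l
      by (cases l) (simp_all add: enc_word_literal_def enc_nat_def)
  qed
  then show ?thesis
    by (simp add: enc_instance_def enc_word_instance_def enc_list_map enc_nat_def[abs_def])
qed

lemma enc_word_literal_prefix_free:
  "enc_word_literal k @ s = enc_word_literal l @ t \<longleftrightarrow> k = l \<and> s = t"
  by (cases k; cases l) (auto simp: enc_word_literal_def enc_bits_prefix_free)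

lemma enc_word_instance_inject:
  "enc_word_instance U C = enc_word_instance V D \<longleftrightarrow> U = V \<and> C = D"
proof -
  note pf = enc_list_prefix_free[of "enc_list enc_word_literal", OF enc_list_prefix_free,
      OF enc_word_literal_prefix_free, where s = "[]" and t = "[]", simplified]
  show ?thesis
    by (simp add: enc_word_instance_def enc_list_prefix_free[OF enc_bits_prefix_free] pf)
qed

definition word_instance :: "bool list list \<Rightarrow> bool list clause list \<Rightarrow> bool" where
  "word_instance U C \<longleftrightarrow>
     set U \<subseteq> range binary \<and> distinct U \<and> NAE_3SAT_KS_instance (set U) C"

lemma word_instance_imp_numbers:
  assumes "word_instance U C"
  obtains V D where "U = map binary V" "C = rename binary D"
proof
  let ?m = "map_literal binary" and ?m' = "map_literal (inv binary)"
  have num: "binary (inv binary v) = v" if "v \<in> set U" for v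
    using that assms by (auto simp: word_instance_def intro: f_inv_into_f)
  then show "U = map binary (map (inv binary) U)" by (simp add: map_idI)
  have "?m (?m' l) = l" if "c \<in> set C" "l \<in> set c" for c l
  proof -
    have "var l \<in> set U"
      using assms that by (auto simp: word_instance_def NAE_3SAT_KS_instance_def)
    then show ?thesis using num by (cases l) auto
  qed
  then show "C = rename binary (rename (inv binary) C)" by (simp add: map_idI)
qed

lemma in_NAE_3SAT_KS_iff:
  "x \<in> NAE_3SAT_KS \<longleftrightarrow>
   (\<exists>U C. x = enc_word_instance U C \<and> word_instance U C \<and> NAE_satisfiable C)"
proof -
  have numbers: "word_instance (map binary V) (rename binary D) \<longleftrightarrow>
      distinct V \<and> NAE_3SAT_KS_instance (set V) D" for V D
    using NAE_3SAT_KS_instance_rename[OF inj_binary, of "set V" D] inj_on_subset[OF inj_binary]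
    by (auto simp: word_instance_def distinct_map)
  show ?thesis
  proof
    assume "x \<in> NAE_3SAT_KS"
    then obtain V D where "x = enc_instance V D" "distinct V" "NAE_3SAT_KS_instance (set V) D"
      "NAE_satisfiable D"
      unfolding NAE_3SAT_KS_def by blast
    then show "\<exists>U C. x = enc_word_instance U C \<and> word_instance U C \<and> NAE_satisfiable C"
      using numbers NAE_satisfiable_rename[OF inj_binary] enc_instance_eq_enc_word_instance
      by blast
  next
    assume "\<exists>U C. x = enc_word_instance U C \<and> word_instance U C \<and> NAE_satisfiable C"
    then obtain U C where UC: "x = enc_word_instance U C" "word_instance U C" "NAE_satisfiable C"
      by blast
    from UC(2) obtain V D where VD: "U = map binary V" "C = rename binary D"
      by (rule word_instance_imp_numbers)
    then have "x = enc_instance V D" using UC(1) enc_instance_eq_enc_word_instance by simp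
    moreover have "NAE_satisfiable D" using UC(3) VD NAE_satisfiable_rename[OF inj_binary] by blast
    ultimately show "x \<in> NAE_3SAT_KS"
      using UC(2) numbers unfolding VD NAE_3SAT_KS_def by blast
  qed
qed

lemma polytime_enc_bits [polytime_intros]: "polytime f \<Longrightarrow> polytime (\<lambda>x. enc_bits (f x))"
  unfolding enc_bits_def by (intro polytime_intros)

lemma polytime_enc_list [polytime_intros]:
  fixes g :: "'a::encodable \<Rightarrow> 'b::encodable \<Rightarrow> bool list"
  assumes "polytime (\<lambda>p. g (fst p) (snd p))" "polytime xs"
  shows "polytime (\<lambda>x. enc_list (g x) (xs x))"
  unfolding enc_list_def by (intro polytime_intros assms)

lemma polytime_enc_word_instance [polytime_intros]:
  "polytime f \<Longrightarrow> polytime g \<Longrightarrow> polytime (\<lambda>x. enc_word_instance (f x) (g x))"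
  unfolding enc_word_instance_def enc_word_literal_def
  by (intro polytime_intros)

subsection \<open>The reduction from satisfiability\<close>

definition var_word :: "'v::encodable \<Rightarrow> bool list" where
  "var_word v = code v @ [True]"

definition ks_word :: "'v::encodable clause list \<Rightarrow> bool list" where
  "ks_word \<phi> = enc_word_instance (map var_word (ks_vars (nae3 \<phi>)))
     (rename var_word (ks_clauses (nae3 \<phi>)))"

lemma inj_var_word: "inj var_word"
  by (simp add: inj_def var_word_def code_inject)

lemma var_word_in_range_binary: "var_word v \<in> range binary"
  by (simp add: range_binary_iff var_word_def nth_append)

lemma ks_word_in_NAE_3SAT_KS_iff: "ks_word \<phi> \<in> NAE_3SAT_KS \<longleftrightarrow> cnf_sat \<phi>"
proof -
  let ?V = "ks_vars (nae3 \<phi>)" and ?D = "ks_clauses (nae3 \<phi>)"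
  have "word_instance (map var_word ?V) (rename var_word ?D)"
    using NAE_3SAT_KS_instance_rename[OF inj_var_word, of "set ?V" ?D] ks_instance[of "nae3 \<phi>"]
      inj_on_subset[OF inj_var_word] var_word_in_range_binary
    by (auto simp: word_instance_def distinct_map distinct_ks_vars length_nae3)
  then have "ks_word \<phi> \<in> NAE_3SAT_KS \<longleftrightarrow> NAE_satisfiable (rename var_word ?D)"
    unfolding in_NAE_3SAT_KS_iff ks_word_def enc_word_instance_inject by blast
  also have "\<dots> \<longleftrightarrow> cnf_sat \<phi>"
    by (simp add: NAE_satisfiable_rename inj_var_word NAE_satisfiable_ks length_nae3
        NAE_satisfiable_nae3)
  finally show ?thesis .
qed

lemma polytime_ks_word [polytime_intros]: "polytime f \<Longrightarrow> polytime (\<lambda>x. ks_word (f x))"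
  unfolding ks_word_def var_word_def by (rule polytime_comp) (intro polytime_intros)

section \<open>Computations as satisfying assignments\<close>

subsection \<open>Cells relative to the heads\<close>

definition cell :: "config \<Rightarrow> nat \<Rightarrow> int \<Rightarrow> nat" where
  "cell cf k r = snd (snd cf ! k) (fst (snd cf ! k) + r)"

definition delta_total :: "tm \<Rightarrow> nat \<Rightarrow> nat list \<Rightarrow> nat \<times> (nat \<times> dir) list" where
  "delta_total M q rs = (if q = halt M then (q, map (\<lambda>r. (r, Stay)) rs) else delta M q rs)"

definition transition :: "tm \<Rightarrow> config \<Rightarrow> nat \<times> (nat \<times> dir) list" where
  "transition M cf = delta_total M (fst cf) (map read (snd cf))"

definition wf_config :: "tm \<Rightarrow> config \<Rightarrow> bool" where
  "wf_config M cf \<longleftrightarrow> fst cf < states M \<and> length (snd cf) = tapes M \<and>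
     (\<forall>t\<in>set (snd cf). \<forall>i. snd t i < symbols M)"

lemma wf_config_cell_less: "wf_config M cf \<Longrightarrow> k < tapes M \<Longrightarrow> cell cf k r < symbols M"
  by (simp add: wf_config_def cell_def)

lemma nth_reads: "wf_config M cf \<Longrightarrow> k < tapes M \<Longrightarrow> map read (snd cf) ! k = cell cf k 0"
  by (simp add: wf_config_def cell_def read_def)

lemma step_eq_transition:
  "step M cf = (fst (transition M cf), map2 act (snd (transition M cf)) (snd cf))"
proof (cases "fst cf = halt M")
  case True
  have "map2 act (map (\<lambda>r. (r, Stay)) (map read ts)) ts = ts" for ts
    by (induction ts) auto
  with True show ?thesis by (simp add: step_def transition_def delta_total_def prod_eq_iff)
next
  case False
  then show ?thesis by (simp add: step_def transition_def delta_total_def case_prod_beta)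
qed

lemma transition_wf:
  assumes "wf_tm M" "wf_config M cf"
  shows "fst (transition M cf) < states M" "length (snd (transition M cf)) = tapes M"
    and "k < tapes M \<Longrightarrow> fst (snd (transition M cf) ! k) < symbols M"
proof -
  let ?rs = "map read (snd cf)"
  have rs: "length ?rs = tapes M" "\<forall>r\<in>set ?rs. r < symbols M" and q: "fst cf < states M"
    using assms(2) by (auto simp: wf_config_def read_def)
  have "fst (delta M (fst cf) ?rs) < states M \<and> length (snd (delta M (fst cf) ?rs)) = tapes M \<and>
      (\<forall>(s, d)\<in>set (snd (delta M (fst cf) ?rs)). s < symbols M)"
    using assms(1) rs q unfolding wf_tm_def by blast
  then have "fst (transition M cf) < states M \<and> length (snd (transition M cf)) = tapes M \<and>
      (\<forall>a\<in>set (snd (transition M cf)). fst a < symbols M)"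
    using q rs by (auto simp: transition_def delta_total_def)
  then show "fst (transition M cf) < states M" "length (snd (transition M cf)) = tapes M"
    and "k < tapes M \<Longrightarrow> fst (snd (transition M cf) ! k) < symbols M"
    by simp_all
qed

lemma nth_step:
  assumes "wf_tm M" "wf_config M cf" "k < tapes M"
  shows "snd (step M cf) ! k = act (snd (transition M cf) ! k) (snd cf ! k)"
  using assms transition_wf(2)[OF assms(1,2)] by (simp add: step_eq_transition wf_config_def)

lemma fst_act: "fst (act a t) = fst t + displacement (snd a)"
  and snd_act: "snd (act a t) = (snd t)(fst t := fst a)"
  by (cases a; cases t; simp)+

lemma wf_config_step:
  assumes "wf_tm M" "wf_config M cf"
  shows "wf_config M (step M cf)"
  unfolding wf_config_def
proof (intro conjI ballI allI)
  show "fst (step M cf) < states M" and len: "length (snd (step M cf)) = tapes M"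
    using assms(2) transition_wf[OF assms] by (simp_all add: step_eq_transition wf_config_def)
  fix t i
  assume "t \<in> set (snd (step M cf))"
  then obtain k where k: "k < tapes M" "t = act (snd (transition M cf) ! k) (snd cf ! k)"
    using len nth_step[OF assms] by (auto simp: in_set_conv_nth)
  have "snd (snd cf ! k) i < symbols M"
    using assms(2) k(1) by (simp add: wf_config_def)
  then show "snd t i < symbols M"
    using transition_wf(3)[OF assms k(1)] by (simp add: k(2) snd_act)
qed

lemma wf_config_init:
  assumes "wf_tm M"
  shows "wf_config M (init M w)"
proof -
  have "word_cells w i < symbols M" for w i
    using assms by (auto simp: word_cells_def wf_tm_def)
  then show ?thesis using assms by (auto simp: wf_config_def init_def wf_tm_def)
qed

lemma wf_config_funpow_step: "wf_tm M \<Longrightarrow> wf_config M ((step M ^^ t) (init M w))"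
  by (induction t) (simp_all add: wf_config_init wf_config_step)

lemma head_bound:
  assumes "wf_tm M" "k < tapes M"
  shows "\<bar>fst (snd ((step M ^^ t) (init M w)) ! k)\<bar> \<le> int t"
proof (induction t)
  case 0
  then show ?case using assms(2) by (cases k) (auto simp: init_def)
next
  case (Suc t)
  have "\<bar>displacement d\<bar> \<le> 1" for d by (cases d) auto
  from this[of "snd (snd (transition M ((step M ^^ t) (init M w))) ! k)"] show ?case
    using Suc nth_step[OF assms(1) wf_config_funpow_step[OF assms(1)] assms(2), of t w]
    by (simp add: fst_act)
qed

lemma cell_step:
  assumes "wf_tm M" "wf_config M cf" "k < tapes M" "snd (transition M cf) ! k = (a, d)"
  shows "cell (step M cf) k r =
    (if r + displacement d = 0 then a else cell cf k (r + displacement d))"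
  unfolding cell_def nth_step[OF assms(1-3)] assms(4)
  by (simp add: fst_act snd_act algebra_simps)

lemma cell_init_input: "cell (init M w) 0 r = word_cells w r"
  by (simp add: cell_def init_def)

lemma cell_init_blank: "0 < k \<Longrightarrow> k < tapes M \<Longrightarrow> cell (init M w) k r = 0"
  by (cases k) (simp_all add: cell_def init_def)

lemma cell_output:
  assumes "wf_tm M" "outputs_within M w y t"
  defines "cf \<equiv> (step M ^^ t) (init M w)"
  shows "cell cf (tapes M - 1) r = word_cells y (fst (snd cf ! (tapes M - 1)) + r)"
proof -
  have "tapes M \<ge> 1" using assms(1) by (simp add: wf_tm_def)
  moreover have "length (snd cf) = tapes M"
    using wf_config_funpow_step[OF assms(1)] by (simp add: wf_config_def cf_def)
  ultimately have "last (snd cf) = snd cf ! (tapes M - 1)" by (subst last_conv_nth) auto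
  then show ?thesis
    using assms(2) by (auto simp: cf_def outputs_within_def cell_def split: prod.splits)
qed

subsection \<open>The clauses\<close>

text \<open>The variable \<^term>\<open>State t q\<close> says that the state is \<^term>\<open>q\<close> at time \<^term>\<open>t\<close>, and
  \<^term>\<open>Cell k t j a\<close> that the cell of tape \<^term>\<open>k\<close> at distance \<^term>\<open>j - c\<close> from the head then
  contains \<^term>\<open>a\<close>, where \<^term>\<open>c\<close> is an offset that keeps addresses natural.\<close>

datatype tableau_var = State nat nat | Cell nat nat nat nat

instantiation tableau_var :: encodable
begin
fun code_tableau_var :: "tableau_var \<Rightarrow> bool list" where
  "code_tableau_var (State t q) = [False] @ code (t, q)"
| "code_tableau_var (Cell k t j a) = [True] @ code (k, t, j, a)"
instance
proof
  show "code x = code y \<longleftrightarrow> x = y" for x y :: tableau_var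
    by (cases x; cases y) (auto simp: code_inject)
qed
end

lemma polytime_State [polytime_intros]:
  "polytime f \<Longrightarrow> polytime g \<Longrightarrow> polytime (\<lambda>x. State (f x) (g x))"
  by (rule polytime_comp2[OF polytime_prefix]) auto

lemma polytime_Cell [polytime_intros]:
  assumes "polytime f" "polytime g" "polytime h" "polytime i"
  shows "polytime (\<lambda>x. Cell (f x) (g x) (h x) (i x))"
proof -
  have "polytime (\<lambda>(k, t, j, a). Cell k t j a)"
    by (rule polytime_prefix[of _ "[True]"]) auto
  from polytime_comp[OF this, of "\<lambda>x. (f x, g x, h x, i x)"] show ?thesis
    using assms by (simp add: polytime_intros)
qed

definition implication :: "'v list \<Rightarrow> 'v \<Rightarrow> 'v clause" where
  "implication ps q = Pos q # map Neg ps"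

lemma models_implication_iff [simp]:
  "(\<exists>l\<in>set (implication ps q). lit_true \<tau> l) \<longleftrightarrow> ((\<forall>p\<in>set ps. \<tau> p) \<longrightarrow> \<tau> q)"
  by (auto simp: implication_def)

lemma models_append [simp]: "models \<tau> (\<phi> @ \<psi>) \<longleftrightarrow> models \<tau> \<phi> \<and> models \<tau> \<psi>"
  by (auto simp: models_def)

lemma models_Nil [simp]: "models \<tau> []"
  by (simp add: models_def)

lemma models_Cons [simp]: "models \<tau> (c # \<phi>) \<longleftrightarrow> (\<exists>l\<in>set c. lit_true \<tau> l) \<and> models \<tau> \<phi>"
  by (simp add: models_def)

lemma models_map: "models \<tau> (map f xs) \<longleftrightarrow> (\<forall>x\<in>set xs. \<exists>l\<in>set (f x). lit_true \<tau> l)"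
  by (simp add: models_def)

lemma models_concat_map: "models \<tau> (concat (map f xs)) \<longleftrightarrow> (\<forall>x\<in>set xs. models \<tau> (f x))"
  by (auto simp: models_def)

lemma polytime_implication [polytime_intros]:
  "polytime f \<Longrightarrow> polytime g \<Longrightarrow> polytime (\<lambda>x. implication (f x) (g x))"
  unfolding implication_def by (intro polytime_intros)

text \<open>The address, relative to the old head position, of the cell that a head movement puts at the
  address \<^term>\<open>Suc i\<close>.\<close>

fun source :: "dir \<Rightarrow> nat \<Rightarrow> nat" where
  "source MoveLeft i = i"
| "source Stay i = Suc i"
| "source MoveRight i = Suc (Suc i)"

lemma source_displacement: "int (source d i) = int (Suc i) + displacement d"
  by (cases d) auto

lemma polytime_source [polytime_intros]: "polytime f \<Longrightarrow> polytime (\<lambda>x. source d (f x))"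
  by (cases d) (simp_all add: polytime_intros)

definition tape_clauses ::
  "nat \<Rightarrow> nat \<Rightarrow> nat \<Rightarrow> tableau_var list \<Rightarrow> nat \<Rightarrow> nat \<times> dir \<Rightarrow> tableau_var clause list" where
  "tape_clauses S c t ps k ad = concat (map (\<lambda>i.
     if source (snd ad) i = c then [implication ps (Cell k (Suc t) (Suc i) (fst ad))]
     else map (\<lambda>s. implication (Cell k t (source (snd ad) i) s # ps) (Cell k (Suc t) (Suc i) s))
       [0..<S])
     [0..<2 * c])"

definition situation :: "tm \<Rightarrow> nat \<Rightarrow> nat \<Rightarrow> nat \<Rightarrow> nat list \<Rightarrow> tableau_var list" where
  "situation M c t q rs = State t q # map (\<lambda>k. Cell k t c (rs ! k)) [0..<tapes M]"

definition transition_clauses ::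
  "tm \<Rightarrow> nat \<Rightarrow> nat \<Rightarrow> nat \<times> nat list \<Rightarrow> tableau_var clause list" where
  "transition_clauses M c t qrs =
     implication (situation M c t (fst qrs) (snd qrs))
       (State (Suc t) (fst (delta_total M (fst qrs) (snd qrs)))) #
     concat (map (\<lambda>k. tape_clauses (symbols M) c t (situation M c t (fst qrs) (snd qrs)) k
       (snd (delta_total M (fst qrs) (snd qrs)) ! k)) [0..<tapes M])"

definition step_clauses :: "tm \<Rightarrow> nat \<Rightarrow> nat \<Rightarrow> tableau_var clause list" where
  "step_clauses M c t = concat (map (transition_clauses M c t)
     (List.product [0..<states M] (List.n_lists (tapes M) [0..<symbols M])))"

definition input_symbols :: "nat \<Rightarrow> bool list \<Rightarrow> nat \<Rightarrow> nat \<Rightarrow> nat list" where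
  "input_symbols c v m j =
     (if j < c then [0]
      else if j < c + length v then [if entry v (j - c) then 2 else 1]
      else if j < c + length v + m then [0, 1, 2]
      else [0])"

definition init_clauses :: "tm \<Rightarrow> nat \<Rightarrow> bool list \<Rightarrow> nat \<Rightarrow> tableau_var clause list" where
  "init_clauses M c v m =
     map (\<lambda>j. map (\<lambda>a. Pos (Cell 0 0 j a)) (input_symbols c v m j)) [0..<2 * c + 1] @
     map (\<lambda>i. implication [Cell 0 0 (c + length v + i) 0] (Cell 0 0 (c + length v + Suc i) 0))
       [0..<m] @
     concat (map (\<lambda>k. map (\<lambda>j. implication [] (Cell k 0 j 0)) [0..<2 * c + 1]) [1..<tapes M]) @
     [implication [] (State 0 (start M))]"

text \<open>By time \<^term>\<open>T\<close>, heads have moved by at most \<^term>\<open>T\<close>, and the addresses at which the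
  contents of cells are forced have shrunk by \<^term>\<open>T\<close> on both sides.\<close>

definition tableau :: "tm \<Rightarrow> nat \<Rightarrow> bool list \<Rightarrow> nat \<Rightarrow> tableau_var clause list" where
  "tableau M T v m = (let c = 2 * T + 1 in
     init_clauses M c v m @ concat (map (step_clauses M c) [0..<T]) @
     map (\<lambda>j. [Neg (Cell (tapes M - 1) T j 1)]) [0..<2 * c + 1])"

lemma polytime_transition_clauses:
  assumes "polytime c" "polytime t"
  shows "polytime (\<lambda>x. transition_clauses M (c x) (t x) qrs)"
proof -
  have situation: "polytime (\<lambda>x. situation M (c x) (t x) q rs)" for q rs
    unfolding situation_def
    by (intro polytime_Cons polytime_State polytime_map_const polytime_Cell polytime_const assms)
  have tape: "polytime (\<lambda>x. tape_clauses S (c x) (t x) (ps x) k ad)" if "polytime ps"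
    for S ps k ad
    unfolding tape_clauses_def
    by (intro polytime_intros polytime_comp[OF assms(1)] polytime_comp[OF assms(2)]
        polytime_comp[OF that] assms that)
  show ?thesis
    unfolding transition_clauses_def
    by (intro polytime_Cons polytime_concat_map_const polytime_intros tape[OF situation]
        situation assms)
qed

lemma polytime_step_clauses [polytime_intros]:
  "polytime c \<Longrightarrow> polytime t \<Longrightarrow> polytime (\<lambda>x. step_clauses M (c x) (t x))"
  unfolding step_clauses_def
  by (intro polytime_concat_map_const polytime_transition_clauses)

lemma polytime_tableau [polytime_intros]:
  assumes "polytime f" "polytime g" "polytime h"
  shows "polytime (\<lambda>x. tableau M (f x) (g x) (h x))"
proof -
  have "polytime (\<lambda>p. tableau M (fst p) (fst (snd p)) (snd (snd p)))"
    unfolding tableau_def Let_def init_clauses_def input_symbols_def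
    by (intro polytime_intros)
  from polytime_comp[OF this, of "\<lambda>x. (f x, g x, h x)"] show ?thesis
    using assms by (simp add: polytime_intros)
qed

subsection \<open>Correctness of the clauses\<close>

definition tape_update ::
  "(tableau_var \<Rightarrow> bool) \<Rightarrow> nat \<Rightarrow> nat \<Rightarrow> nat \<Rightarrow> nat \<Rightarrow> nat \<times> dir \<Rightarrow> bool" where
  "tape_update \<tau> S c t k = (\<lambda>(a, d). \<forall>i<2 * c.
     if source d i = c then \<tau> (Cell k (Suc t) (Suc i) a)
     else \<forall>s<S. \<tau> (Cell k t (source d i) s) \<longrightarrow> \<tau> (Cell k (Suc t) (Suc i) s))"

lemma models_tape_clauses:
  "models \<tau> (tape_clauses S c t ps k ad) \<longleftrightarrow>
   ((\<forall>p\<in>set ps. \<tau> p) \<longrightarrow> tape_update \<tau> S c t k ad)"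
  by (cases ad) (auto simp: tape_clauses_def tape_update_def models_concat_map models_map)

lemma models_step_clauses:
  "models \<tau> (step_clauses M c t) \<longleftrightarrow>
   (\<forall>q<states M. \<forall>rs. length rs = tapes M \<longrightarrow> set rs \<subseteq> {..<symbols M} \<longrightarrow>
     \<tau> (State t q) \<longrightarrow> (\<forall>k<tapes M. \<tau> (Cell k t c (rs ! k))) \<longrightarrow>
     \<tau> (State (Suc t) (fst (delta_total M q rs))) \<and>
     (\<forall>k<tapes M. tape_update \<tau> (symbols M) c t k (snd (delta_total M q rs) ! k)))"
proof -
  have "(\<forall>p\<in>set (situation M c t q rs). \<tau> p) \<longleftrightarrow>
      \<tau> (State t q) \<and> (\<forall>k<tapes M. \<tau> (Cell k t c (rs ! k)))" for q rs
    by (auto simp: situation_def)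
  then have "models \<tau> (transition_clauses M c t (q, rs)) \<longleftrightarrow>
      (\<tau> (State t q) \<longrightarrow> (\<forall>k<tapes M. \<tau> (Cell k t c (rs ! k))) \<longrightarrow>
       \<tau> (State (Suc t) (fst (delta_total M q rs))) \<and>
       (\<forall>k<tapes M. tape_update \<tau> (symbols M) c t k (snd (delta_total M q rs) ! k)))" for q rs
    by (auto simp: transition_clauses_def models_concat_map models_tape_clauses)
  then show ?thesis
    by (auto simp: step_clauses_def models_concat_map set_n_lists atLeast0LessThan)
qed

lemma models_init_clauses:
  "models \<tau> (init_clauses M c v m) \<longleftrightarrow>
   (\<forall>j\<le>2 * c. \<exists>a\<in>set (input_symbols c v m j). \<tau> (Cell 0 0 j a)) \<and>
   (\<forall>i<m. \<tau> (Cell 0 0 (c + length v + i) 0) \<longrightarrow> \<tau> (Cell 0 0 (c + length v + Suc i) 0)) \<and>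
   (\<forall>k<tapes M. 0 < k \<longrightarrow> (\<forall>j\<le>2 * c. \<tau> (Cell k 0 j 0))) \<and> \<tau> (State 0 (start M))"
  unfolding init_clauses_def
  by (auto simp: models_map models_concat_map less_Suc_eq_le simp del: upt_Suc)

lemma word_cells_shifted:
  "word_cells w (int j - int c) =
   (if c \<le> j \<and> j < c + length w then if w ! (j - c) then 2 else 1 else 0)"
  by (auto simp: word_cells_def simp flip: of_nat_diff)

lemma upward_closed_threshold:
  fixes P :: "nat \<Rightarrow> bool"
  assumes "\<And>i. i < m \<Longrightarrow> P i \<Longrightarrow> P (Suc i)"
  obtains n where "n \<le> m" "\<And>i. i < n \<Longrightarrow> \<not> P i" "\<And>i. n \<le> i \<Longrightarrow> i < m \<Longrightarrow> P i"
proof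
  define n where "n = (LEAST i. i = m \<or> P i)"
  have n: "n = m \<or> P n" unfolding n_def by (rule LeastI[of _ m]) simp
  show "n \<le> m" unfolding n_def by (rule Least_le) simp
  show "\<not> P i" if "i < n" for i
    using not_less_Least[of i "\<lambda>i. i = m \<or> P i"] that unfolding n_def by blast
  show "P i" if "n \<le> i" "i < m" for i
    using that
  proof (induction i rule: dec_induct)
    case base
    then show ?case using n by simp
  next
    case (step i)
    then show ?case using assms[of i] by simp
  qed
qed

lemma input_symbols_sound:
  assumes symbols: "\<And>j. j \<le> 2 * c \<Longrightarrow> \<exists>a\<in>set (input_symbols c v m j). \<tau> (Cell 0 0 j a)"
    and blank: "\<And>i. i < m \<Longrightarrow> \<tau> (Cell 0 0 (c + length v + i) 0) \<Longrightarrow>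
      \<tau> (Cell 0 0 (c + length v + Suc i) 0)"
  obtains u where "length u \<le> m"
    and "\<And>j. j \<le> 2 * c \<Longrightarrow> \<tau> (Cell 0 0 j (word_cells (v @ u) (int j - int c)))"
proof -
  let ?tape = "\<lambda>i. Cell 0 0 (c + length v + i)"
  obtain n where n: "n \<le> m" "\<And>i. i < n \<Longrightarrow> \<not> \<tau> (?tape i 0)" "\<And>i. n \<le> i \<Longrightarrow> i < m \<Longrightarrow> \<tau> (?tape i 0)"
    using upward_closed_threshold[of m "\<lambda>i. \<tau> (?tape i 0)"] blank by blast
  define u where "u = map (\<lambda>i. \<tau> (?tape i 2)) [0..<n]"
  have "\<tau> (Cell 0 0 j (word_cells (v @ u) (int j - int c)))" if j: "j \<le> 2 * c" for j
  proof -
    obtain a where a: "a \<in> set (input_symbols c v m j)" "\<tau> (Cell 0 0 j a)"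
      using symbols[OF j] by blast
    consider (fixed) "j < c + length v \<or> c + length v + m \<le> j"
      | (bit) i where "i < n" "j = c + length v + i"
      | (blank) i where "n \<le> i" "i < m" "j = c + length v + i"
      by (metis add_less_cancel_left le_Suc_ex not_less)
    then show ?thesis
    proof cases
      case fixed
      then show ?thesis
        using a n(1)
        by (auto simp: word_cells_shifted input_symbols_def nth_append u_def split: if_splits)
    next
      case (bit i)
      then have "a = 1 \<or> a = 2" using a n(1) n(2)[of i] by (auto simp: input_symbols_def)
      then show ?thesis using a bit
        by (auto simp: word_cells_shifted nth_append u_def simp del: of_nat_add)
    next
      case (blank i)
      then show ?thesis using n(3)[of i]
        by (simp add: word_cells_shifted u_def del: of_nat_add)
    qed
  qed
  then show ?thesis using that[of u] n(1) by (simp add: u_def)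
qed

definition describes :: "(tableau_var \<Rightarrow> bool) \<Rightarrow> tm \<Rightarrow> nat \<Rightarrow> nat \<Rightarrow> config \<Rightarrow> bool" where
  "describes \<tau> M c t cf \<longleftrightarrow> \<tau> (State t (fst cf)) \<and>
     (\<forall>k<tapes M. \<forall>j. Suc t \<le> j \<and> j + t \<le> 2 * c \<longrightarrow> \<tau> (Cell k t j (cell cf k (int j - int c))))"

lemma describes_cell:
  "describes \<tau> M c t cf \<Longrightarrow> k < tapes M \<Longrightarrow> Suc t \<le> j \<Longrightarrow> j + t \<le> 2 * c \<Longrightarrow>
   \<tau> (Cell k t j (cell cf k (int j - int c)))"
  by (simp add: describes_def)

lemma cell_step_source:
  assumes "wf_tm M" "wf_config M cf" "k < tapes M" "snd (transition M cf) ! k = (a, d)"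
  shows "cell (step M cf) k (int (Suc i) - int c) =
    (if source d i = c then a else cell cf k (int (source d i) - int c))"
proof -
  have address: "int (Suc i) - int c + displacement d = int (source d i) - int c"
    by (simp add: source_displacement)
  show ?thesis unfolding cell_step[OF assms] address by simp
qed

lemma describes_step:
  assumes M: "wf_tm M" and wf: "wf_config M cf" and "Suc t \<le> c"
    and models: "models \<tau> (step_clauses M c t)" and describes: "describes \<tau> M c t cf"
  shows "describes \<tau> M c (Suc t) (step M cf)"
proof -
  let ?rs = "map read (snd cf)"
  have "length ?rs = tapes M" "set ?rs \<subseteq> {..<symbols M}" "fst cf < states M"
    using wf by (auto simp: wf_config_def read_def)
  moreover have "\<forall>k<tapes M. \<tau> (Cell k t c (?rs ! k))"
  proof (intro allI impI)
    fix k assume k: "k < tapes M"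
    then show "\<tau> (Cell k t c (?rs ! k))"
      using describes_cell[OF describes k, of c] assms(3) by (simp add: nth_reads[OF wf k])
  qed
  moreover have "\<tau> (State t (fst cf))" using describes by (simp add: describes_def)
  ultimately have next_state: "\<tau> (State (Suc t) (fst (transition M cf)))"
    and update: "\<And>k. k < tapes M \<Longrightarrow>
      tape_update \<tau> (symbols M) c t k (snd (transition M cf) ! k)"
    using models unfolding models_step_clauses transition_def by blast+
  have "\<tau> (Cell k (Suc t) j (cell (step M cf) k (int j - int c)))"
    if k: "k < tapes M" and j: "Suc (Suc t) \<le> j" "j + Suc t \<le> 2 * c" for k j
  proof -
    obtain a d where ad: "snd (transition M cf) ! k = (a, d)" by fastforce
    obtain i where i: "j = Suc i" using j(1) by (cases j) auto
    then have "i < 2 * c" "Suc t \<le> source d i" "source d i + t \<le> 2 * c"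
      using j by (cases d; simp)+
    moreover from this have "\<tau> (Cell k t (source d i) (cell cf k (int (source d i) - int c)))"
      by (intro describes_cell[OF describes k])
    ultimately show ?thesis
      using update[OF k] wf_config_cell_less[OF wf k] unfolding i cell_step_source[OF M wf k ad]
      by (auto simp: tape_update_def ad split: if_splits)
  qed
  with next_state show ?thesis by (simp add: describes_def step_eq_transition)
qed

lemma describes_init:
  assumes "models \<tau> (init_clauses M c v m)"
    and "\<And>j. j \<le> 2 * c \<Longrightarrow> \<tau> (Cell 0 0 j (word_cells w (int j - int c)))"
  shows "describes \<tau> M c 0 (init M w)"
proof -
  have "\<tau> (Cell k 0 j (cell (init M w) k (int j - int c)))" if "k < tapes M" "j \<le> 2 * c" for k j
    using that assms
    by (cases "k = 0") (simp_all add: models_init_clauses cell_init_input cell_init_blank)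
  moreover have "\<tau> (State 0 (start M))" using assms(1) by (simp add: models_init_clauses)
  ultimately show ?thesis by (simp add: describes_def init_def)
qed

lemma describes_rejection:
  assumes M: "wf_tm M" and rejects: "outputs_within M w [False] T"
    and describes: "describes \<tau> M (2 * T + 1) T ((step M ^^ T) (init M w))"
  shows "\<exists>j\<le>2 * (2 * T + 1). \<tau> (Cell (tapes M - 1) T j 1)"
proof -
  let ?cf = "(step M ^^ T) (init M w)" and ?c = "2 * T + 1" and ?K = "tapes M - 1"
  define j where "j = nat (int ?c - fst (snd ?cf ! ?K))"
  have K: "?K < tapes M" using M by (simp add: wf_tm_def)
  have j: "int j = int ?c - fst (snd ?cf ! ?K)" "Suc T \<le> j" "j + T \<le> 2 * ?c"
    using head_bound[OF M K, of T w] by (auto simp: j_def abs_le_iff)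
  then have "cell ?cf ?K (int j - int ?c) = 1"
    using cell_output[OF M rejects] by (simp add: word_cells_def)
  then have "\<tau> (Cell ?K T j 1)"
    using describes_cell[OF describes K j(2,3)] by simp
  then show ?thesis using j(3) by (intro exI[of _ j]) simp
qed

lemma tableau_sound:
  assumes M: "wf_tm M" and models: "models \<tau> (tableau M T v m)"
  obtains u where "length u \<le> m" "\<not> outputs_within M (v @ u) [False] T"
proof -
  define c where "c = 2 * T + 1"
  have init: "models \<tau> (init_clauses M c v m)"
    and steps: "\<And>t. t < T \<Longrightarrow> models \<tau> (step_clauses M c t)"
    and accepts: "\<And>j. j \<le> 2 * c \<Longrightarrow> \<not> \<tau> (Cell (tapes M - 1) T j 1)"
    using models unfolding tableau_def Let_def c_def[symmetric]
    by (auto simp: models_concat_map models_map less_Suc_eq_le simp del: upt_Suc)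
  obtain u where u: "length u \<le> m"
    and input: "\<And>j. j \<le> 2 * c \<Longrightarrow> \<tau> (Cell 0 0 j (word_cells (v @ u) (int j - int c)))"
    using input_symbols_sound[of c v m \<tau>] init unfolding models_init_clauses by metis
  have "describes \<tau> M c t ((step M ^^ t) (init M (v @ u)))" if "t \<le> T" for t
    using that
  proof (induction t)
    case 0
    show ?case using describes_init[OF init input] by simp
  next
    case (Suc t)
    then show ?case
      using describes_step[OF M wf_config_funpow_step[OF M]] steps by (simp add: c_def)
  qed
  from this[of T] have "\<not> outputs_within M (v @ u) [False] T"
    using describes_rejection[OF M] accepts unfolding c_def by blast
  with u show ?thesis by (rule that)
qed

fun run_assignment :: "tm \<Rightarrow> bool list \<Rightarrow> nat \<Rightarrow> tableau_var \<Rightarrow> bool" where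
  "run_assignment M w c (State t q) \<longleftrightarrow> fst ((step M ^^ t) (init M w)) = q"
| "run_assignment M w c (Cell k t j a) \<longleftrightarrow> cell ((step M ^^ t) (init M w)) k (int j - int c) = a"

lemma run_assignment_init:
  assumes "length u \<le> m"
  shows "models (run_assignment M (v @ u) c) (init_clauses M c v m)"
proof -
  have "word_cells (v @ u) (int j - int c) \<in> set (input_symbols c v m j)" for j
    using assms by (auto simp: word_cells_shifted input_symbols_def nth_append)
  moreover have "fst (init M (v @ u)) = start M" by (simp add: init_def)
  ultimately show ?thesis
    using assms
    by (auto simp: models_init_clauses cell_init_input cell_init_blank word_cells_shifted
        simp del: of_nat_add of_nat_Suc)
qed

lemma run_assignment_step:
  assumes M: "wf_tm M"
  shows "models (run_assignment M w c) (step_clauses M c t)"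
  unfolding models_step_clauses
proof (intro allI impI)
  let ?\<tau> = "run_assignment M w c" and ?cf = "\<lambda>t. (step M ^^ t) (init M w)"
  fix q rs
  assume rs: "length rs = tapes M" "\<forall>k<tapes M. ?\<tau> (Cell k t c (rs ! k))" and q: "?\<tau> (State t q)"
  note wf = wf_config_funpow_step[OF M, of t w]
  have "map read (snd (?cf t)) = rs"
    using rs wf nth_reads[OF wf] by (intro nth_equalityI) (simp_all add: wf_config_def)
  then have delta: "delta_total M q rs = transition M (?cf t)"
    using q by (simp add: transition_def)
  have "tape_update ?\<tau> (symbols M) c t k (snd (delta_total M q rs) ! k)" if "k < tapes M" for k
    using cell_step_source[OF M wf that, of _ _ _ c]
    by (cases "snd (delta_total M q rs) ! k") (auto simp: delta tape_update_def)
  then show "?\<tau> (State (Suc t) (fst (delta_total M q rs))) \<and>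
      (\<forall>k<tapes M. tape_update ?\<tau> (symbols M) c t k (snd (delta_total M q rs) ! k))"
    by (simp add: delta step_eq_transition)
qed

lemma tableau_complete:
  assumes M: "wf_tm M" and accepts: "outputs_within M (v @ u) [True] T" and "length u \<le> m"
  shows "cnf_sat (tableau M T v m)"
proof -
  define c where "c = 2 * T + 1"
  have "word_cells [True] i \<noteq> 1" for i by (simp add: word_cells_def)
  then have "models (run_assignment M (v @ u) c)
      (map (\<lambda>j. [Neg (Cell (tapes M - 1) T j 1)]) [0..<2 * c + 1])"
    using cell_output[OF M accepts] by (simp add: models_map)
  then have "models (run_assignment M (v @ u) c) (tableau M T v m)"
    using run_assignment_init[OF assms(3)] run_assignment_step[OF M]
    unfolding tableau_def Let_def c_def[symmetric] by (simp add: models_concat_map del: upt_Suc)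
  then show ?thesis unfolding cnf_sat_def by blast
qed

lemma cnf_sat_tableau_iff:
  assumes M: "wf_tm M" and "\<And>u. length u \<le> m \<Longrightarrow> outputs_within M (v @ u) [v @ u \<in> V] T"
  shows "cnf_sat (tableau M T v m) \<longleftrightarrow> (\<exists>u. length u \<le> m \<and> v @ u \<in> V)"
proof
  assume "cnf_sat (tableau M T v m)"
  then obtain u where "length u \<le> m" "\<not> outputs_within M (v @ u) [False] T"
    unfolding cnf_sat_def using tableau_sound[OF M] by metis
  then show "\<exists>u. length u \<le> m \<and> v @ u \<in> V" using assms(2)[of u] by (cases "v @ u \<in> V") auto
next
  assume "\<exists>u. length u \<le> m \<and> v @ u \<in> V"
  then show "cnf_sat (tableau M T v m)"
    using tableau_complete[OF M] assms(2) by (metis (full_types))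
qed

theorem NP_hard_NAE_3SAT_KS: "NP_hard NAE_3SAT_KS"
  unfolding NP_hard_def ptime_reducible_def
proof
  fix A assume "A \<in> class_NP"
  then obtain V p where V: "V \<in> class_P"
    and A: "\<And>x. x \<in> A \<longleftrightarrow> (\<exists>u. length u \<le> poly p (length x) \<and> pair x u \<in> V)"
    unfolding class_NP_def by blast
  from V obtain M q where M: "wf_tm M" "\<And>w. outputs_within M w [w \<in> V] (poly q (length w))"
    unfolding class_P_def ptime_computable_def by blast
  define m where "m x = poly p (length x)" for x :: "bool list"
  define T where "T x = poly q (2 * length x + 1 + m x)" for x :: "bool list"
  define f where "f x = ks_word (tableau M (T x) (enc_bits x) (m x))" for x
  have "polytime f" unfolding f_def T_def m_def by (intro polytime_intros)
  then have "ptime_computable f" by (rule polytime_imp_ptime_computable)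
  moreover have "x \<in> A \<longleftrightarrow> f x \<in> NAE_3SAT_KS" for x
  proof -
    have "outputs_within M (enc_bits x @ u) [enc_bits x @ u \<in> V] (T x)" if "length u \<le> m x" for u
      unfolding T_def
      by (rule outputs_within_mono[OF M(2)], rule poly_nat_mono)
        (use that length_pair[of x u] in \<open>simp add: pair_def\<close>)
    from cnf_sat_tableau_iff[OF M(1) this]
    show ?thesis by (simp add: f_def ks_word_in_NAE_3SAT_KS_iff A m_def pair_def)
  qed
  ultimately show "\<exists>f. ptime_computable f \<and> (\<forall>x. (x \<in> A) = (f x \<in> NAE_3SAT_KS))" by blast
qed

section \<open>Membership in NP\<close>

subsection \<open>Parsing certificates\<close>

definition raw_fst :: "raw \<Rightarrow> raw" where
  "raw_fst r = Raw (fst (unpair (code r)))"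

definition raw_snd :: "raw \<Rightarrow> raw" where
  "raw_snd r = Raw (snd (unpair (code r)))"

lemma polytime_raw_fst [polytime_intros]: "polytime f \<Longrightarrow> polytime (\<lambda>x. raw_fst (f x))"
  by (rule polytime_comp[OF polytime_unpair_fst[of raw_fst]]) (simp_all add: raw_fst_def)

lemma polytime_raw_snd [polytime_intros]: "polytime f \<Longrightarrow> polytime (\<lambda>x. raw_snd (f x))"
  by (rule polytime_comp[OF polytime_unpair_snd[of raw_snd]]) (simp_all add: raw_snd_def)

lemma raw_fst_pair [simp]: "raw_fst (Raw (pair u v)) = Raw u"
  and raw_snd_pair [simp]: "raw_snd (Raw (pair u v)) = Raw v"
  by (simp_all add: raw_fst_def raw_snd_def)

definition item_step :: "raw \<times> raw list \<Rightarrow> raw \<times> raw list" where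
  "item_step s = (if fst s = Raw [] then s else (raw_snd (fst s), snd s @ [raw_fst (fst s)]))"

lemma item_step_Nil: "item_step (Raw [], rs) = (Raw [], rs)"
  and item_step_pair: "item_step (Raw (pair u v), rs) = (Raw v, rs @ [Raw u])"
  by (simp_all add: item_step_def)

lemma size_item_step_le: "size_of (item_step s) \<le> size_of s + 3"
  using length_unpair[of "code (fst s)"]
  by (cases s) (simp add: item_step_def raw_fst_def raw_snd_def)

definition items :: "raw \<Rightarrow> raw list" where
  "items r = snd ((item_step ^^ size_of r) (r, []))"

lemma items_code [simp]: "items (Raw (code xs)) = map (\<lambda>x. Raw (code x)) xs"
proof -
  have "(item_step ^^ n) (Raw (code xs), rs) = (Raw [], rs @ map (\<lambda>x. Raw (code x)) xs)"
    if "length xs \<le> n" for n rs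
    using that
  proof (induction n arbitrary: xs rs)
    case (Suc n)
    show ?case
    proof (cases xs)
      case Nil
      then show ?thesis
        using Suc.IH[of "[]" rs] by (simp add: funpow_Suc_right item_step_Nil del: funpow.simps)
    next
      case (Cons x xs')
      then show ?thesis
        using Suc.IH[of xs' "rs @ [Raw (code x)]"] Suc.prems
        by (simp add: funpow_Suc_right item_step_pair code_Cons del: funpow.simps)
    qed
  qed simp
  then show ?thesis by (simp add: items_def length_le_size)
qed

lemma polytime_items [polytime_intros]:
  assumes "polytime f"
  shows "polytime (\<lambda>x. items (f x))"
proof (rule polytime_comp[OF _ assms])
  have size: "size_of ((item_step ^^ i) (r, [])) \<le> 2 * size_of r + 1 + 3 * i" for i r
  proof (induction i)
    case (Suc i)
    then show ?case using size_item_step_le[of "(item_step ^^ i) (r, [])"] by simp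
  qed simp
  have "size_of ((item_step ^^ i) (r, [])) \<le> poly [:1, 5:] (size_of r)" if "i \<le> size_of r" for i r
    using size[of i r] that by simp
  moreover have "polytime item_step"
    unfolding item_step_def by (intro polytime_intros)
  ultimately have "polytime (\<lambda>r :: raw. (item_step ^^ size_of r) (r, []))"
    by (intro polytime_funpow_size polytime_intros)
  then show "polytime items" unfolding items_def by (intro polytime_intros)
qed

definition raw_literal :: "raw \<Rightarrow> bool list literal" where
  "raw_literal r = (if hd (code r) then Pos (tl (code r)) else Neg (tl (code r)))"

subsection \<open>The verifier\<close>

definition cert_vars :: "raw \<Rightarrow> bool list list" where
  "cert_vars r = map code (items (raw_fst r))"

definition cert_true :: "raw \<Rightarrow> bool list list" where
  "cert_true r = map code (items (raw_fst (raw_snd r)))"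

definition cert_clauses :: "raw \<Rightarrow> bool list clause list" where
  "cert_clauses r = map (\<lambda>c. map raw_literal (items c)) (items (raw_snd (raw_snd r)))"

definition certifies :: "raw \<Rightarrow> bool list \<Rightarrow> bool" where
  "certifies r x \<longleftrightarrow> x = enc_word_instance (cert_vars r) (cert_clauses r) \<and>
     word_instance (cert_vars r) (cert_clauses r) \<and>
     (\<forall>c\<in>set (cert_clauses r). nae (\<lambda>v. v \<in> set (cert_true r)) c)"

definition certificate ::
  "bool list list \<Rightarrow> bool list list \<Rightarrow> bool list clause list \<Rightarrow> bool list" where
  "certificate U T C = code (map Raw U, map Raw T, rename Raw C)"

lemma cert_certificate:
  "cert_vars (Raw (certificate U T C)) = U"
  "cert_true (Raw (certificate U T C)) = T"
  "cert_clauses (Raw (certificate U T C)) = C"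
proof -
  have "raw_literal (Raw (code (map_literal Raw l))) = l" for l
    by (cases l) (simp_all add: raw_literal_def)
  then show "cert_vars (Raw (certificate U T C)) = U"
    "cert_true (Raw (certificate U T C)) = T"
    "cert_clauses (Raw (certificate U T C)) = C"
    by (simp_all add: certificate_def cert_vars_def cert_true_def cert_clauses_def code_Pair
        comp_def)
qed

lemma in_NAE_3SAT_KS_if_certifies: "certifies r x \<Longrightarrow> x \<in> NAE_3SAT_KS"
  unfolding certifies_def in_NAE_3SAT_KS_iff NAE_satisfiable_iff_nae by blast

lemma size_map_le_enc_list:
  assumes "m \<ge> 1" "\<And>x. 2 * size_of (g x) \<le> m * length (f x)"
  shows "size_of (map g xs) \<le> m * length (enc_list f xs)"
proof (induction xs)
  case (Cons x xs)
  then show ?case using assms(1) assms(2)[of x] by (simp add: enc_list_def algebra_simps)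
qed simp

lemma length_enc_bits: "length (enc_bits w) = 2 * length w + 1"
  using length_pair[of w "[]"] by (simp add: pair_def)

lemma length_certificate_le:
  "length (certificate U (filter P U) C) \<le> 4 * length (enc_word_instance U C) + 2"
proof -
  have vars: "size_of (map Raw ws) \<le> length (enc_list enc_bits ws)" for ws
    using size_map_le_enc_list[of 1 Raw enc_bits ws] by (simp add: length_enc_bits)
  have "length (enc_list enc_bits (filter P U)) \<le> length (enc_list enc_bits U)"
    by (induction U) (simp_all add: enc_list_def)
  then have true: "size_of (map Raw (filter P U)) \<le> length (enc_list enc_bits U)"
    using vars le_trans by blast
  have literal: "2 * size_of (map_literal Raw l) \<le> length (enc_word_literal l)" for l
    by (cases l) (simp_all add: enc_word_literal_def length_enc_bits)
  then have "size_of (map (map_literal Raw) c) \<le> length (enc_list enc_word_literal c)" for c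
    using size_map_le_enc_list[of 1 "map_literal Raw" enc_word_literal c] by simp
  then have clauses: "size_of (rename Raw C) \<le> 2 * length (enc_list (enc_list enc_word_literal) C)"
    by (intro size_map_le_enc_list) simp_all
  show ?thesis
    using vars[of U] true clauses by (simp add: certificate_def enc_word_instance_def)
qed

lemma certifies_if_in_NAE_3SAT_KS:
  assumes "x \<in> NAE_3SAT_KS"
  shows "\<exists>u. length u \<le> 4 * length x + 2 \<and> certifies (Raw u) x"
proof -
  from assms obtain U C \<tau> where x: "x = enc_word_instance U C" and inst: "word_instance U C"
    and \<tau>: "\<And>c. c \<in> set C \<Longrightarrow> nae \<tau> c"
    unfolding in_NAE_3SAT_KS_iff NAE_satisfiable_iff_nae by blast
  let ?T = "filter \<tau> U"
  have "nae (\<lambda>v. v \<in> set ?T) c" if "c \<in> set C" for c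
  proof -
    have "var l \<in> set U" if "l \<in> set c" for l
      using inst \<open>c \<in> set C\<close> that by (auto simp: word_instance_def NAE_3SAT_KS_instance_def)
    then have "lit_true (\<lambda>v. v \<in> set ?T) l \<longleftrightarrow> lit_true \<tau> l" if "l \<in> set c" for l
      using that by (cases l) force+
    then show ?thesis using \<tau>[OF that] by (simp add: nae_def)
  qed
  then have "certifies (Raw (certificate U ?T C)) x"
    using x inst by (simp add: certifies_def cert_certificate)
  moreover have "length (certificate U ?T C) \<le> 4 * length x + 2"
    unfolding x by (rule length_certificate_le)
  ultimately show ?thesis by blast
qed

lemma polytime_card_inter:
  fixes f g :: "'a::encodable \<Rightarrow> 'b::encodable list"
  assumes "polytime f" "polytime g"
  shows "polytime (\<lambda>x. card (set (f x) \<inter> set (g x)))"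
proof -
  have "polytime (\<lambda>x. length (remdups (filter (\<lambda>a. a \<in> set (g x)) (f x))))"
    by (intro polytime_intros assms polytime_comp[OF assms(2)])
  moreover have "set (f x) \<inter> set (g x) = set (filter (\<lambda>a. a \<in> set (g x)) (f x))" for x
    by auto
  ultimately show ?thesis by (simp only: length_remdups_card_conv)
qed

lemma polytime_occurrences:
  assumes "polytime f" "polytime g"
  shows "polytime (\<lambda>x. occurrences (f x) (g x))"
proof -
  have "polytime (\<lambda>x. length (filter (\<lambda>c. g x \<in> set c) (f x)))"
    by (intro polytime_intros assms polytime_comp[OF assms(2)])
  then show ?thesis by (simp add: occurrences_def length_filter_conv_card)
qed

lemma polytime_word_instance:
  "polytime f \<Longrightarrow> polytime g \<Longrightarrow> polytime (\<lambda>x. word_instance (f x) (g x))"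
proof (rule polytime_comp2[of word_instance])
  have "word_instance U C \<longleftrightarrow> (\<forall>v\<in>set U. v = [] \<or> entry v (length v - 1)) \<and> distinct U \<and>
     (\<forall>c\<in>set C. \<forall>l\<in>set c. var l \<in> set U) \<and>
     (\<forall>c\<in>set C. length c = 3) \<and>
     (\<forall>u\<in>set U. occurrences C (Pos u) \<le> 2 \<and> occurrences C (Neg u) \<le> 2) \<and>
     (\<forall>u\<in>set U. occurrences C (Pos u) = 2 \<or> occurrences C (Neg u) = 2) \<and>
     (\<forall>i\<in>set [0..<length C]. \<forall>j\<in>set [0..<length C].
        i \<noteq> j \<longrightarrow> card (set (entry C i) \<inter> set (entry C j)) \<le> 1) \<and>
     (\<forall>c\<in>set C. distinct (map var c))" for U C
    by (auto simp: word_instance_def NAE_3SAT_KS_instance_def subset_eq range_binary_iff)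
  then show "polytime (\<lambda>p. word_instance (fst p) (snd p))"
    by (simp only:) (intro polytime_intros polytime_occurrences polytime_card_inter)
qed

lemma lit_true_iff_is_Pos: "lit_true \<tau> l \<longleftrightarrow> \<tau> (var l) = is_Pos l"
  by (cases l) auto

lemma polytime_certifies: "polytime (\<lambda>r. certifies (raw_snd r) (code (raw_fst r)))"
  unfolding certifies_def nae_def lit_true_iff_is_Pos cert_vars_def cert_true_def
    cert_clauses_def raw_literal_def
  by (intro polytime_word_instance polytime_intros)

theorem NAE_3SAT_KS_in_NP: "NAE_3SAT_KS \<in> class_NP"
proof -
  define V where "V = {w. certifies (raw_snd (Raw w)) (code (raw_fst (Raw w)))}"
  have "polytime (\<lambda>r. [certifies (raw_snd r) (code (raw_fst r))])"
    by (intro polytime_intros polytime_certifies)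
  from polytime_raw_imp_ptime_computable[OF this] have "V \<in> class_P"
    by (simp add: class_P_def V_def)
  moreover have "x \<in> NAE_3SAT_KS \<longleftrightarrow> (\<exists>u. length u \<le> poly [:2, 4:] (length x) \<and> pair x u \<in> V)"
    for x
    using certifies_if_in_NAE_3SAT_KS[of x] in_NAE_3SAT_KS_if_certifies
    by (auto simp: V_def algebra_simps)
  ultimately show ?thesis unfolding class_NP_def by blast
qed

theorem theorem3: "NP_complete NAE_3SAT_KS"
  unfolding NP_complete_def using NAE_3SAT_KS_in_NP NP_hard_NAE_3SAT_KS by blast

end
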